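(* Let $\varrho:V\to\mathbb{R}_{\ge 0}$ be smooth. For every compact set $\mathcal{K}\subset D([0,T];\mathcal{M}_V)$, $$\limsup_{N\to\infty}\frac1N\log\mathbb{P}^{\varrho}_N(\pi^N_{\cdot}\in\mathcal{K})\le-\inf_{\widehat\alpha\in\mathcal{K}}\mathcal{I}^{\varrho}(\widehat\alpha).$$
   Context: Spaces. $\mathbb{T}_N=\mathbb{Z}/N\mathbb{Z}$, $S=\{-1,1\}$, $V_N=\mathbb{T}_N\times S$, $\Omega_N=\mathbb{N}^{V_N}$ (with $0\in\mathbb{N}$ here). $\mathbb{T}=[0,1]$ is the torus (endpoints identified), $V=\mathbb{T}\times S$. $\mathcal{M}_V$ is the space of positive Radon measures on $V$ with the weak topology; $D([0,T];\mathcal{M}_V)$ is the Skorokhod space, $T>0$ fixed. $\langle\beta,\phi\rangle$ is the integral of $\phi$ against $\beta\in\mathcal{M}_V$. $C^\infty(V)$ (resp. $C^\infty([0,T]\times V)$) denotes functions smooth in $x$ (resp. $(t,x)$) for each $\sigma$. $\langle\psi,\phi\rangle_{L^2(V)}=\sum_{\sigma\in S}\int_{\mathbb{T}}\psi(x,\sigma)\phi(x,\sigma)\,dx$. Rates. $c:S\times[-1,1]\to(0,\infty)$ is bounded from above and bounded away from zero, and there is $L>0$ with $|c(\sigma,m_1)-c(\sigma,m_2)|\le L|m_1-m_2|$ for all $\sigma\in S$, $m_1,m_2\in[-1,1]$. Magnetization. For $\eta\in\Omega_N$, $|\eta|=\sum_{(x,\sigma)\in V_N}\eta(x,\sigma)$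 and $m_N(\eta)=\frac{1}{|\eta|}\sum_{x\in\mathbb{T}_N}(\eta(x,1)-\eta(x,-1))$, with $m_N(\eta)=0$ if $|\eta|=0$. For $\beta\in\mathcal{M}_V$, $m(\beta)=\langle\beta,\mathbf{1}_{\sigma=1}-\mathbf{1}_{\sigma=-1}\rangle/\langle\beta,1\rangle$ (with the same convention $m(0)=0$). Process. $\{\eta^N_t\}$ is the Markov process on $\Omega_N$ with generator $$\mathscr{L}_Nf(\eta)=N\sum_{(x,\sigma)\in V_N}\eta(x,\sigma)[f(\eta^{(x,\sigma)\to(x+\sigma,\sigma)})-f(\eta)]+\sum_{(x,\sigma)\in V_N}c(\sigma,m_N(\eta))\eta(x,\sigma)[f(\eta^{(x,\sigma)\to(x,-\sigma)})-f(\eta)],$$ where $\eta^{(x,\sigma)\to(y,\sigma')}$ is $\eta$ with one particle moved from $(x,\sigma)$ to $(y,\sigma')$. $\mathbb{P}^{\varrho}_N$ is the path-space measure (up to time $T$) of this process when $\eta^N_0$ has the law $\mu_N^{\varrho}=\bigotimes_{(x,\sigma)\in V_N}\mathrm{Pois}(\varrho(x/N,\sigma))$. The empirical measure is $\pi^N_t=\frac1N\sum_{(x,\sigma)\in V_N}\eta^N_t(x,\sigma)\delta_{(x/N,\sigma)}$. Rate function. $\mathcal{I}^{\varrho}:D([0,T];\mathcal{M}_V)\to[0,\infty]$ is $\mathcal{I}^{\varrho}(\widehat\alpha)=h_0^{\varrho}(\widehat\alpha_0)+\mathcal{I}_{tr}(\widehat\alpha)$, where $$h_0^{\varrho}(\widehat\alpha_0)=\sup_{\phi\in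 C^\infty(V)}\{\langle\widehat\alpha_0,\phi\rangle-\langle\varrho,e^{\phi}-1\rangle_{L^2(V)}\},$$ $$\mathcal{I}_{tr}(\widehat\alpha)=\sup_{G\in C^\infty([0,T]\times V)}\Big\{\ell(\widehat\alpha;G)-\int_0^T\big\langle\widehat\alpha_t,\,c(\sigma,m(\widehat\alpha_t))(e^{-\sigma\widetilde G_t(x)}-1)\big\rangle dt\Big\},\qquad \widetilde G_t(x)=G_t(x,1)-G_t(x,-1),$$ $$\ell(\widehat\alpha;G)=\langle\widehat\alpha_T,G_T\rangle-\langle\widehat\alpha_0,G_0\rangle-\int_0^T\langle\widehat\alpha_t,(\partial_t+\sigma\partial_x)G_t\rangle dt.$$ *)

theory Defs
  imports "HOL-Probability.Probability"
begin

section \<open>The space \<open>V\<close>, test functions and measures\<close>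

text \<open>
  The torus \<open>[0,1]\<close> with identified endpoints is represented by the fundamental domain \<open>[0,1)\<close>,
  and functions on it by 1-periodic functions on the real line. The half-open interval carries the
  Borel sets of the torus; the topology of the torus enters only through the test functions.
\<close>

definition spins :: "int set" where
  "spins = {-1, 1}"

definition V :: "(real \<times> int) set" where
  "V = {0..<1} \<times> spins"

abbreviation borelV :: "(real \<times> int) measure" where
  "borelV \<equiv> restrict_space borel V"

definition continuous_V :: "(real \<times> int \<Rightarrow> real) set" where
  "continuous_V = {\<phi>. \<forall>\<sigma>\<in>spins. (\<forall>x. \<phi> (x + 1, \<sigma>) = \<phi> (x, \<sigma>)) \<and>
     continuous_on UNIV (\<lambda>x. \<phi> (x, \<sigma>))}"

definition smooth_V :: "(real \<times> int \<Rightarrow> real) set" where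
  "smooth_V = {\<phi>. \<forall>\<sigma>\<in>spins. (\<forall>x. \<phi> (x + 1, \<sigma>) = \<phi> (x, \<sigma>)) \<and>
     (\<forall>k x. ((deriv ^^ k) (\<lambda>y. \<phi> (y, \<sigma>))) differentiable (at x))}"

text \<open>
  Smoothness on the closed time interval is one-sided at its endpoints: \<open>D i j\<close> is the mixed
  partial derivative of order \<open>i\<close> in time and \<open>j\<close> in space.
\<close>

definition smooth_TV :: "real \<Rightarrow> (real \<Rightarrow> real \<times> int \<Rightarrow> real) set" where
  "smooth_TV T = {G. \<forall>\<sigma>\<in>spins.
     (\<forall>t\<in>{0..T}. \<forall>x. G t (x + 1, \<sigma>) = G t (x, \<sigma>)) \<and>
     (\<exists>D :: nat \<Rightarrow> nat \<Rightarrow> real \<Rightarrow> real \<Rightarrow> real.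
        (\<forall>t\<in>{0..T}. \<forall>x. D 0 0 t x = G t (x, \<sigma>)) \<and>
        (\<forall>i j. continuous_on ({0..T} \<times> UNIV) (\<lambda>(t, x). D i j t x) \<and>
          (\<forall>t\<in>{0..T}. \<forall>x.
             ((\<lambda>s. D i j s x) has_real_derivative D (Suc i) j t x) (at t within {0..T}) \<and>
             (D i j t has_real_derivative D i (Suc j) t x) (at x))))}"

text \<open>On the compact space \<open>V\<close> the positive Radon measures are the finite Borel measures.\<close>

definition measures_V :: "(real \<times> int) measure set" where
  "measures_V = {\<beta>. sets \<beta> = sets borelV \<and> finite_measure \<beta>}"

definition pairing :: "(real \<times> int) measure \<Rightarrow> (real \<times> int \<Rightarrow> real) \<Rightarrow> real" where
  "pairing \<beta> \<phi> = (LINT v|\<beta>. \<phi> v)"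

definition weak_topology :: "(real \<times> int) measure topology" where
  "weak_topology = topology_generated_by
     {{\<beta> \<in> measures_V. pairing \<beta> \<phi> \<in> U} | \<phi> U. \<phi> \<in> continuous_V \<and> open U}"

section \<open>The Skorokhod space\<close>

definition skorokhod_space :: "real \<Rightarrow> (real \<Rightarrow> (real \<times> int) measure) set" where
  "skorokhod_space T = {\<alpha> \<in> {0..T} \<rightarrow>\<^sub>E measures_V.
     (\<forall>t\<in>{0..<T}. limitin weak_topology \<alpha> (\<alpha> t) (at_right t)) \<and>
     (\<forall>t\<in>{0<..T}. \<exists>\<beta>. limitin weak_topology \<alpha> \<beta> (at_left t))}"

definition time_changes :: "real \<Rightarrow> (real \<Rightarrow> real) set" where
  "time_changes T = {\<theta>. strict_mono_on {0..T} \<theta> \<and> \<theta> ` {0..T} = {0..T}}"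

text \<open>
  The Skorokhod (J1) topology over the weak topology. The weak topology is generated by the
  pseudometrics \<open>|\<langle>\<beta>,\<phi>\<rangle> - \<langle>\<beta>',\<phi>\<rangle>|\<close>; the sets below are the balls of the corresponding
  Skorokhod pseudometrics. Since the Skorokhod topology depends only on the topology of the state
  space, no metric on \<open>measures_V\<close> has to be chosen.
\<close>

definition skorokhod_ball ::
  "real \<Rightarrow> (real \<Rightarrow> (real \<times> int) measure) \<Rightarrow> (real \<times> int \<Rightarrow> real) set \<Rightarrow> real
   \<Rightarrow> (real \<Rightarrow> (real \<times> int) measure) set" where
  "skorokhod_ball T \<alpha> F \<epsilon> = {\<beta> \<in> skorokhod_space T. \<exists>\<theta>\<in>time_changes T. \<forall>t\<in>{0..T}.
     \<bar>\<theta> t - t\<bar> < \<epsilon> \<and> (\<forall>\<phi>\<in>F. \<bar>pairing (\<beta> (\<theta> t)) \<phi> - pairing (\<alpha> t) \<phi>\<bar> < \<epsilon>)}"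

definition skorokhod_open :: "real \<Rightarrow> (real \<Rightarrow> (real \<times> int) measure) set \<Rightarrow> bool" where
  "skorokhod_open T U \<longleftrightarrow> U \<subseteq> skorokhod_space T \<and>
     (\<forall>\<alpha>\<in>U. \<exists>F \<epsilon>. finite F \<and> F \<subseteq> continuous_V \<and> \<epsilon> > 0 \<and> skorokhod_ball T \<alpha> F \<epsilon> \<subseteq> U)"

definition skorokhod_topology :: "real \<Rightarrow> (real \<Rightarrow> (real \<times> int) measure) topology" where
  "skorokhod_topology T = topology (skorokhod_open T)"

lemma skorokhod_ball_mono:
  "F \<subseteq> F' \<Longrightarrow> \<epsilon>' \<le> \<epsilon> \<Longrightarrow> skorokhod_ball T \<alpha> F' \<epsilon>' \<subseteq> skorokhod_ball T \<alpha> F \<epsilon>"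
  unfolding skorokhod_ball_def by (smt (verit) Collect_mono subsetD)

lemma istopology_skorokhod_open: "istopology (skorokhod_open T)"
  unfolding istopology_def
proof (intro conjI allI impI ballI)
  fix A B assume A: "skorokhod_open T A" and B: "skorokhod_open T B"
  show "skorokhod_open T (A \<inter> B)"
    unfolding skorokhod_open_def
  proof (intro conjI ballI)
    show "A \<inter> B \<subseteq> skorokhod_space T" using A by (auto simp: skorokhod_open_def)
    fix \<alpha> assume \<alpha>: "\<alpha> \<in> A \<inter> B"
    obtain F1 e1 where 1: "finite F1" "F1 \<subseteq> continuous_V" "e1 > 0" "skorokhod_ball T \<alpha> F1 e1 \<subseteq> A"
      using A \<alpha> unfolding skorokhod_open_def by blast
    obtain F2 e2 where 2: "finite F2" "F2 \<subseteq> continuous_V" "e2 > 0" "skorokhod_ball T \<alpha> F2 e2 \<subseteq> B"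
      using B \<alpha> unfolding skorokhod_open_def by blast
    have "skorokhod_ball T \<alpha> (F1 \<union> F2) (min e1 e2) \<subseteq> A \<inter> B"
      using 1(4) 2(4) skorokhod_ball_mono[of F1 "F1 \<union> F2" "min e1 e2" e1 T \<alpha>]
        skorokhod_ball_mono[of F2 "F1 \<union> F2" "min e1 e2" e2 T \<alpha>] by auto
    then show "\<exists>F \<epsilon>. finite F \<and> F \<subseteq> continuous_V \<and> \<epsilon> > 0 \<and> skorokhod_ball T \<alpha> F \<epsilon> \<subseteq> A \<inter> B"
      using 1 2 by (intro exI[of _ "F1 \<union> F2"] exI[of _ "min e1 e2"]) auto
  qed
next
  fix \<K> assume "\<forall>U\<in>\<K>. skorokhod_open T U"
  then have *: "U \<subseteq> skorokhod_space T" "\<alpha> \<in> U \<Longrightarrow> \<exists>F \<epsilon>. finite F \<and> F \<subseteq> continuous_V \<and> \<epsilon> > 0 \<and>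
      skorokhod_ball T \<alpha> F \<epsilon> \<subseteq> U" if "U \<in> \<K>" for U \<alpha>
    using that by (simp_all add: skorokhod_open_def)
  show "skorokhod_open T (\<Union>\<K>)"
    unfolding skorokhod_open_def
  proof (intro conjI ballI)
    show "\<Union>\<K> \<subseteq> skorokhod_space T" using *(1) by (rule Union_least)
    fix \<alpha> assume "\<alpha> \<in> \<Union>\<K>"
    then obtain U where U: "U \<in> \<K>" "\<alpha> \<in> U" by (rule UnionE)
    obtain F \<epsilon> where "finite F" "F \<subseteq> continuous_V" "\<epsilon> > 0" "skorokhod_ball T \<alpha> F \<epsilon> \<subseteq> U"
      using *(2)[OF U] by (elim exE conjE)
    moreover have "U \<subseteq> \<Union>\<K>" using U(1) by (rule Union_upper)
    ultimately show "\<exists>F \<epsilon>. finite F \<and> F \<subseteq> continuous_V \<and> \<epsilon> > 0 \<and>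
        skorokhod_ball T \<alpha> F \<epsilon> \<subseteq> \<Union>\<K>"
      by (intro exI[of _ F] exI[of _ \<epsilon>] conjI) (assumption | erule subset_trans)+
  qed
qed

lemma openin_skorokhod_topology: "openin (skorokhod_topology T) U \<longleftrightarrow> skorokhod_open T U"
  by (simp add: skorokhod_topology_def topology_inverse'[OF istopology_skorokhod_open])

section \<open>The particle system\<close>

type_synonym config = "int \<times> int \<Rightarrow> nat"

definition sites :: "nat \<Rightarrow> (int \<times> int) set" where
  "sites N = {0..<int N} \<times> spins"

definition configs :: "nat \<Rightarrow> config set" where
  "configs N = {\<eta>. \<forall>v. v \<notin> sites N \<longrightarrow> \<eta> v = 0}"

text \<open>Moving a particle only makes sense if \<open>\<eta> v > 0\<close>; otherwise the rate in the generator vanishes.\<close>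

definition move :: "config \<Rightarrow> int \<times> int \<Rightarrow> int \<times> int \<Rightarrow> config" where
  "move \<eta> v w = (let \<eta>' = \<eta>(v := \<eta> v - 1) in \<eta>'(w := \<eta>' w + 1))"

text \<open>Both magnetizations vanish for zero total mass, since \<open>0 / 0 = 0\<close>.\<close>

definition magnetization_N :: "nat \<Rightarrow> config \<Rightarrow> real" where
  "magnetization_N N \<eta> =
     (\<Sum>x\<in>{0..<int N}. real (\<eta> (x, 1)) - real (\<eta> (x, -1))) / real (\<Sum>v\<in>sites N. \<eta> v)"

definition magnetization :: "(real \<times> int) measure \<Rightarrow> real" where
  "magnetization \<beta> =
     pairing \<beta> (\<lambda>(x, \<sigma>). of_bool (\<sigma> = 1) - of_bool (\<sigma> = -1)) / pairing \<beta> (\<lambda>_. 1)"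

definition generator ::
  "(int \<Rightarrow> real \<Rightarrow> real) \<Rightarrow> nat \<Rightarrow> (config \<Rightarrow> real) \<Rightarrow> config \<Rightarrow> real" where
  "generator c N f \<eta> =
     real N * (\<Sum>(x, \<sigma>)\<in>sites N.
        real (\<eta> (x, \<sigma>)) * (f (move \<eta> (x, \<sigma>) ((x + \<sigma>) mod int N, \<sigma>)) - f \<eta>)) +
     (\<Sum>(x, \<sigma>)\<in>sites N.
        c \<sigma> (magnetization_N N \<eta>) * real (\<eta> (x, \<sigma>)) * (f (move \<eta> (x, \<sigma>) (x, -\<sigma>)) - f \<eta>))"

text \<open>
  The semigroup \<open>e\<^sup>t\<^sup>L\<close> of the generator \<open>L\<close>. As \<open>L\<close> conserves the number of particles, it acts as a
  finite matrix on the functions on each set of configurations with a given number of particles,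
  so the series converges absolutely at every configuration, for every \<open>f\<close>
  (\<open>summable_semigroup_N\<close>), and its derivative at time 0 is \<open>L f\<close> (\<open>generator_of_semigroup_N\<close>).
\<close>

definition semigroup_N ::
  "(int \<Rightarrow> real \<Rightarrow> real) \<Rightarrow> nat \<Rightarrow> real \<Rightarrow> (config \<Rightarrow> real) \<Rightarrow> config \<Rightarrow> real" where
  "semigroup_N c N t f \<eta> = (\<Sum>k. t ^ k / fact k * ((generator c N ^^ k) f) \<eta>)"

lemma finite_sites: "finite (sites N)"
  by (simp add: sites_def spins_def)

lemma finite_configs_mass: "finite {\<xi> \<in> configs N. (\<Sum>v\<in>sites N. \<xi> v) = n}"
proof (rule finite_subset)
  show "finite {\<xi>. \<forall>v. (v \<in> sites N \<longrightarrow> \<xi> v \<in> {..n}) \<and> (v \<notin> sites N \<longrightarrow> \<xi> v = 0)}"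
    by (rule finite_set_of_finite_funs[OF finite_sites]) simp
  show "{\<xi> \<in> configs N. (\<Sum>v\<in>sites N. \<xi> v) = n}
      \<subseteq> {\<xi>. \<forall>v. (v \<in> sites N \<longrightarrow> \<xi> v \<in> {..n}) \<and> (v \<notin> sites N \<longrightarrow> \<xi> v = 0)}"
    using finite_sites by (auto simp: configs_def intro!: member_le_sum)
qed

lemma sum_move:
  assumes "v \<in> sites N" "w \<in> sites N" "\<eta> v > 0"
  shows "(\<Sum>u\<in>sites N. move \<eta> v w u) = (\<Sum>u\<in>sites N. \<eta> u)"
proof -
  have "(\<Sum>u\<in>sites N. move \<eta> v w u) + (\<Sum>u\<in>sites N. of_bool (u = v))
      = (\<Sum>u\<in>sites N. \<eta> u) + (\<Sum>u\<in>sites N. of_bool (u = w))"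
    unfolding sum.distrib[symmetric]
    using assms(3) by (intro sum.cong) (auto simp: move_def)
  then show ?thesis using assms(1,2) finite_sites[of N]
    by (simp add: of_bool_def sum.delta)
qed

lemma move_configs:
  "\<eta> \<in> configs N \<Longrightarrow> v \<in> sites N \<Longrightarrow> w \<in> sites N \<Longrightarrow> move \<eta> v w \<in> configs N"
  by (auto simp: configs_def move_def Let_def)

lemma generator_funpow_bound:
  assumes "\<eta> \<in> configs N"
  obtains B C where "\<And>k. \<bar>(generator c N ^^ k) f \<eta>\<bar> \<le> B * C ^ k"
proof -
  define n where "n = (\<Sum>v\<in>sites N. \<eta> v)"
  define A where "A = {\<xi> \<in> configs N. (\<Sum>v\<in>sites N. \<xi> v) = n}"
  define R where "R \<xi> = real N * (\<Sum>(x, \<sigma>)\<in>sites N. real (\<xi> (x, \<sigma>)) * 2) +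
    (\<Sum>(x, \<sigma>)\<in>sites N. \<bar>c \<sigma> (magnetization_N N \<xi>)\<bar> * real (\<xi> (x, \<sigma>)) * 2)" for \<xi>
  define C where "C = Max (R ` A)"
  define B where "B = Max ((\<lambda>\<xi>. \<bar>f \<xi>\<bar>) ` A)"
  have A: "finite A" "\<eta> \<in> A"
    using assms finite_configs_mass by (auto simp: A_def n_def)
  have closed: "move \<xi> v w \<in> A" if "\<xi> \<in> A" "v \<in> sites N" "w \<in> sites N" "\<xi> v > 0" for \<xi> v w
    using that by (simp add: A_def sum_move move_configs)
  have step: "\<bar>generator c N g \<xi>\<bar> \<le> b * C" if g: "\<forall>\<zeta>\<in>A. \<bar>g \<zeta>\<bar> \<le> b" and \<xi>: "\<xi> \<in> A" for g b \<xi>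
  proof -
    have b: "b \<ge> 0" using g \<xi> by force
    have d: "real (\<xi> v) * \<bar>g (move \<xi> v w) - g \<xi>\<bar> \<le> real (\<xi> v) * (2 * b)"
      if "v \<in> sites N" "w \<in> sites N" for v w
    proof (cases "\<xi> v = 0")
      case False
      have "\<bar>g (move \<xi> v w)\<bar> \<le> b" "\<bar>g \<xi>\<bar> \<le> b"
        using g \<xi> closed[OF \<xi> that] False by auto
      then show ?thesis by (intro mult_left_mono) auto
    qed simp
    have 1: "\<bar>\<Sum>(x, \<sigma>)\<in>sites N. real (\<xi> (x, \<sigma>)) * (g (move \<xi> (x, \<sigma>) ((x + \<sigma>) mod int N, \<sigma>)) - g \<xi>)\<bar>
        \<le> (\<Sum>(x, \<sigma>)\<in>sites N. real (\<xi> (x, \<sigma>)) * 2) * b"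
      unfolding sum_distrib_right
    proof (rule order_trans[OF sum_abs], rule sum_mono, clarify)
      fix x \<sigma> assume v: "(x, \<sigma>) \<in> sites N"
      then have "((x + \<sigma>) mod int N, \<sigma>) \<in> sites N" by (auto simp: sites_def)
      from d[OF v this]
      show "\<bar>real (\<xi> (x, \<sigma>)) * (g (move \<xi> (x, \<sigma>) ((x + \<sigma>) mod int N, \<sigma>)) - g \<xi>)\<bar>
          \<le> real (\<xi> (x, \<sigma>)) * 2 * b"
        by (simp add: abs_mult mult.assoc)
    qed
    have 2: "\<bar>\<Sum>(x, \<sigma>)\<in>sites N. c \<sigma> (magnetization_N N \<xi>) * real (\<xi> (x, \<sigma>)) *
          (g (move \<xi> (x, \<sigma>) (x, -\<sigma>)) - g \<xi>)\<bar>
        \<le> (\<Sum>(x, \<sigma>)\<in>sites N. \<bar>c \<sigma> (magnetization_N N \<xi>)\<bar> * real (\<xi> (x, \<sigma>)) * 2) * b"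
      unfolding sum_distrib_right
    proof (rule order_trans[OF sum_abs], rule sum_mono, clarify)
      fix x \<sigma> assume v: "(x, \<sigma>) \<in> sites N"
      then have "(x, -\<sigma>) \<in> sites N" by (auto simp: sites_def spins_def)
      from mult_left_mono[OF d[OF v this] abs_ge_zero[of "c \<sigma> (magnetization_N N \<xi>)"]]
      show "\<bar>c \<sigma> (magnetization_N N \<xi>) * real (\<xi> (x, \<sigma>)) * (g (move \<xi> (x, \<sigma>) (x, -\<sigma>)) - g \<xi>)\<bar>
          \<le> \<bar>c \<sigma> (magnetization_N N \<xi>)\<bar> * real (\<xi> (x, \<sigma>)) * 2 * b"
        by (simp add: abs_mult mult.assoc)
    qed
    have "\<bar>generator c N g \<xi>\<bar> \<le> R \<xi> * b"
      unfolding generator_def R_def distrib_right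
      using mult_left_mono[OF 1, of "real N"] 2
      by (intro order_trans[OF abs_triangle_ineq] add_mono) (simp_all add: abs_mult mult.assoc)
    also have "\<dots> \<le> C * b" using A \<xi> b by (intro mult_right_mono) (auto simp: C_def)
    finally show ?thesis by (simp add: mult.commute)
  qed
  have "\<forall>\<xi>\<in>A. \<bar>(generator c N ^^ k) f \<xi>\<bar> \<le> B * C ^ k" for k
  proof (induction k)
    case 0
    then show ?case using A by (auto simp: B_def)
  next
    case (Suc k)
    then show ?case using step[of "(generator c N ^^ k) f" "B * C ^ k"]
      by (simp add: mult.commute mult.left_commute)
  qed
  then show thesis using A(2) by (intro that) blast
qed

lemma summable_semigroup_N:
  assumes "\<eta> \<in> configs N"
  shows "summable (\<lambda>k. t ^ k / fact k * ((generator c N ^^ k) f) \<eta>)"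
proof -
  obtain B C where BC: "\<And>k. \<bar>(generator c N ^^ k) f \<eta>\<bar> \<le> B * C ^ k"
    using generator_funpow_bound[OF assms] by blast
  show ?thesis
  proof (rule summable_comparison_test')
    show "summable (\<lambda>k. B * (inverse (fact k) * (\<bar>t\<bar> * C) ^ k))"
      by (intro summable_mult summable_exp)
    fix k show "norm (t ^ k / fact k * ((generator c N ^^ k) f) \<eta>) \<le> B * (inverse (fact k) * (\<bar>t\<bar> * C) ^ k)"
      using mult_left_mono[OF BC[of k], of "\<bar>t\<bar> ^ k / fact k"]
      by (simp add: abs_mult power_abs power_mult_distrib field_simps)
  qed
qed

lemma generator_of_semigroup_N:
  assumes "\<eta> \<in> configs N"
  shows "((\<lambda>t. semigroup_N c N t f \<eta>) has_real_derivative generator c N f \<eta>) (at 0)"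
proof -
  let ?a = "\<lambda>k. ((generator c N ^^ k) f) \<eta> / fact k"
  have "summable (\<lambda>k. ?a k * t ^ k)" for t
    using summable_semigroup_N[OF assms, of t c f] by (simp add: field_simps)
  then have "((\<lambda>t. \<Sum>k. ?a k * t ^ k) has_real_derivative (\<Sum>k. diffs ?a k * 0 ^ k)) (at 0)"
    by (intro termdiffs_strong_converges_everywhere)
  moreover have "(\<Sum>k. diffs ?a k * 0 ^ k) = generator c N f \<eta>"
    by (simp add: powser_zero[of "diffs ?a"]) (simp add: diffs_def)
  ultimately show ?thesis by (simp add: semigroup_N_def[abs_def] field_simps)
qed

definition past :: "'w measure \<Rightarrow> (real \<Rightarrow> 'w \<Rightarrow> config) \<Rightarrow> real \<Rightarrow> 'w measure" where
  "past M \<eta> s = sigma (space M) {\<eta> u -` A \<inter> space M | u A. u \<in> {0..s}}"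

text \<open>
  A Markov process up to time \<open>T\<close> with generator \<open>generator c N\<close> and paths that are right-continuous
  with left limits, for the discrete topology of \<open>configs N\<close>.
\<close>

definition particle_process ::
  "(int \<Rightarrow> real \<Rightarrow> real) \<Rightarrow> real \<Rightarrow> nat \<Rightarrow> 'w measure \<Rightarrow> (real \<Rightarrow> 'w \<Rightarrow> config) \<Rightarrow> bool" where
  "particle_process c T N M \<eta> \<longleftrightarrow>
     prob_space M \<and>
     (\<forall>t\<in>{0..T}. \<eta> t \<in> M \<rightarrow>\<^sub>M count_space UNIV) \<and>
     (\<forall>\<omega>\<in>space M.
        (\<forall>t\<in>{0..T}. \<eta> t \<omega> \<in> configs N) \<and>
        (\<forall>t\<in>{0..<T}. \<forall>\<^sub>F s in at_right t. \<eta> s \<omega> = \<eta> t \<omega>) \<and>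
        (\<forall>t\<in>{0<..T}. \<exists>\<xi>. \<forall>\<^sub>F s in at_left t. \<eta> s \<omega> = \<xi>)) \<and>
     (\<forall>s\<ge>0. \<forall>t\<ge>0. s + t \<le> T \<longrightarrow> (\<forall>f. bounded (range f) \<longrightarrow>
        (AE \<omega> in M. real_cond_exp M (past M \<eta> s) (\<lambda>\<omega>'. f (\<eta> (s + t) \<omega>')) \<omega>
           = semigroup_N c N t f (\<eta> s \<omega>))))"

text \<open>The library's \<open>poisson_pmf\<close> is specified for positive rates only; the Poisson law of rate 0 is
  the point mass at 0.\<close>

definition poisson0_pmf :: "real \<Rightarrow> nat pmf" where
  "poisson0_pmf r = (if r > 0 then poisson_pmf r else return_pmf 0)"

definition initial_law :: "(real \<times> int \<Rightarrow> real) \<Rightarrow> nat \<Rightarrow> config pmf" where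
  "initial_law \<rho> N =
     Pi_pmf (sites N) 0 (\<lambda>(x, \<sigma>). poisson0_pmf (\<rho> (real_of_int x / real N, \<sigma>)))"

text \<open>The empirical measure is the image, under \<open>(x,\<sigma>) \<mapsto> (x/N,\<sigma>)\<close>, of the measure on the sites
  with weights \<open>\<eta>(x,\<sigma>)/N\<close>.\<close>

definition empirical_measure :: "nat \<Rightarrow> config \<Rightarrow> (real \<times> int) measure" where
  "empirical_measure N \<eta> =
     distr (point_measure (sites N) (\<lambda>v. ennreal (real (\<eta> v) / real N))) borelV
       (\<lambda>(x, \<sigma>). (real_of_int x / real N, \<sigma>))"

definition empirical_path ::
  "real \<Rightarrow> nat \<Rightarrow> (real \<Rightarrow> 'w \<Rightarrow> config) \<Rightarrow> 'w \<Rightarrow> real \<Rightarrow> (real \<times> int) measure" where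
  "empirical_path T N \<eta> \<omega> = (\<lambda>t\<in>{0..T}. empirical_measure N (\<eta> t \<omega>))"

lemma
  assumes "N \<ge> 1"
  shows empirical_measure_in: "empirical_measure N \<eta> \<in> measures_V"
    and pairing_empirical_measure: "\<phi> \<in> borel_measurable borelV \<Longrightarrow>
      pairing (empirical_measure N \<eta>) \<phi>
        = (1 / real N) * (\<Sum>(x, \<sigma>)\<in>sites N. real (\<eta> (x, \<sigma>)) * \<phi> (real_of_int x / real N, \<sigma>))"
proof -
  let ?g = "\<lambda>(x, \<sigma>). (real_of_int x / real N, \<sigma>) :: real \<times> int"
  let ?P = "point_measure (sites N) (\<lambda>v. ennreal (real (\<eta> v) / real N))"
  note fin = finite_sites[of N]
  have "?g \<in> sites N \<rightarrow> space borelV"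
    using assms by (auto simp: sites_def V_def space_restrict_space divide_simps)
  then have g: "?g \<in> ?P \<rightarrow>\<^sub>M borelV"
    by (auto simp: measurable_def space_point_measure sets_point_measure)
  have "finite_measure ?P"
    using fin by (intro finite_measureI)
      (simp add: space_point_measure emeasure_point_measure_finite)
  then show "empirical_measure N \<eta> \<in> measures_V"
    unfolding measures_V_def empirical_measure_def
    using finite_measure.finite_measure_distr[OF _ g] by simp
  assume "\<phi> \<in> borel_measurable borelV"
  then show "pairing (empirical_measure N \<eta>) \<phi>
        = (1 / real N) * (\<Sum>(x, \<sigma>)\<in>sites N. real (\<eta> (x, \<sigma>)) * \<phi> (real_of_int x / real N, \<sigma>))"
    unfolding pairing_def empirical_measure_def
    using fin g
    by (subst integral_distr) (auto simp: lebesgue_integral_point_measure_finite sum_distrib_left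
        case_prod_unfold intro!: sum.cong)
qed

section \<open>The rate function\<close>

definition L2_V :: "(real \<times> int \<Rightarrow> real) \<Rightarrow> (real \<times> int \<Rightarrow> real) \<Rightarrow> real" where
  "L2_V \<psi> \<phi> = (\<Sum>\<sigma>\<in>spins. LBINT x:{0..1}. \<psi> (x, \<sigma>) * \<phi> (x, \<sigma>))"

definition rate_initial :: "(real \<times> int \<Rightarrow> real) \<Rightarrow> (real \<times> int) measure \<Rightarrow> ereal" where
  "rate_initial \<rho> \<beta> = (SUP \<phi>\<in>smooth_V. ereal (pairing \<beta> \<phi> - L2_V \<rho> (\<lambda>v. exp (\<phi> v) - 1)))"

definition transport ::
  "real \<Rightarrow> (real \<Rightarrow> real \<times> int \<Rightarrow> real) \<Rightarrow> real \<Rightarrow> real \<times> int \<Rightarrow> real" where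
  "transport T G t = (\<lambda>(x, \<sigma>).
     vector_derivative (\<lambda>s. G s (x, \<sigma>)) (at t within {0..T}) +
     real_of_int \<sigma> * deriv (\<lambda>y. G t (y, \<sigma>)) x)"

definition ell ::
  "real \<Rightarrow> (real \<Rightarrow> (real \<times> int) measure) \<Rightarrow> (real \<Rightarrow> real \<times> int \<Rightarrow> real) \<Rightarrow> real" where
  "ell T \<alpha> G = pairing (\<alpha> T) (G T) - pairing (\<alpha> 0) (G 0)
     - (LBINT t:{0..T}. pairing (\<alpha> t) (transport T G t))"

definition rate_transport ::
  "(int \<Rightarrow> real \<Rightarrow> real) \<Rightarrow> real \<Rightarrow> (real \<Rightarrow> (real \<times> int) measure) \<Rightarrow> ereal" where
  "rate_transport c T \<alpha> = (SUP G\<in>smooth_TV T. ereal (ell T \<alpha> G -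
     (LBINT t:{0..T}. pairing (\<alpha> t) (\<lambda>(x, \<sigma>). c \<sigma> (magnetization (\<alpha> t)) *
        (exp (- real_of_int \<sigma> * (G t (x, 1) - G t (x, -1))) - 1)))))"

definition rate_function ::
  "(int \<Rightarrow> real \<Rightarrow> real) \<Rightarrow> (real \<times> int \<Rightarrow> real) \<Rightarrow> real
   \<Rightarrow> (real \<Rightarrow> (real \<times> int) measure) \<Rightarrow> ereal" where
  "rate_function c \<rho> T \<alpha> = rate_initial \<rho> (\<alpha> 0) + rate_transport c T \<alpha>"

definition log_prob :: "real \<Rightarrow> ereal" where
  "log_prob p = (if p > 0 then ereal (ln p) else -\<infinity>)"

end

(*
  For test functions phi and G, the process exp (N * J_G(pi)), with J_G the functional maximised in
  the dynamical part of the rate function, is up to a factor exp (O(1)) the exponential martingale of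
  the energy H_t = N * <pi_t, G_t>; hence on paths of bounded mass E[exp (N * (<pi_0, phi> + J_G(pi)))]
  is at most E[exp (N * <pi_0, phi>)] = exp (N * <rho, e^phi - 1> + o(N)) by the Poisson initial law.
  Markov's inequality then bounds the probability of every set on which the functional exceeds a
  level. The functional is lower semicontinuous on the Skorokhod space, with mass bounded locally, so
  every path has a neighbourhood on which the optimal phi and G for that path still do almost as well,
  and finitely many neighbourhoods cover a compact set.

  The martingale inequality is obtained along time grids: one step of the semigroup is expanded to
  second order on the finite set of configurations of bounded mass, the steps are chained by the
  Markov property, and Fatou's lemma lets the mesh tend to zero. Test functions with a rational time
  argument suffice to control the time integrals, at all times outside the countably many
  discontinuities of the limit path.
*)

theory Submission
  imports Defs
begin

section \<open>Test functions\<close>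

text \<open>Three points shape the argument. The generator is unbounded on the set of all
  configurations, but it conserves the number of particles: on configurations with at most
  \<open>m\<close> particles its norm is at most \<open>2 * (N + b) * m\<close>. This
  \<open>m\<close> does not come from a tail estimate. It is read off from the neighbourhood of the
  path under study, where all masses stay below some \<open>B\<close>, so that there are at most
  \<open>N * B\<close> particles. Constants that depend on \<open>N\<close> and \<open>m\<close> are
  harmless: they only multiply powers of the mesh, which tends to zero at fixed \<open>N\<close>.
  What survives is the Taylor error of the jumps, at most \<open>C * B\<close> with \<open>C\<close>
  depending on \<open>G\<close> and \<open>T\<close> only, against an exponent of order
  \<open>N\<close>. The events need not be measurable, so every estimate bounds a measurable
  superset. A Skorokhod ball sees finitely many test functions and a time change that moves the
  jumps of a path. Semicontinuity is therefore derived by contradiction, along a sequence of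
  shrinking balls that exhaust a countable family of test functions.\<close>

lemma finite_spins [simp]: "finite spins" and spins_cases: "\<sigma> \<in> spins \<longleftrightarrow> \<sigma> = 1 \<or> \<sigma> = -1"
  by (auto simp: spins_def)

lemma space_borelV [simp]: "space borelV = V"
  by (simp add: space_restrict_space)

text \<open>A test function is continuous in the position for each of the two spins and arbitrary
  for other integers. It is rewritten as the sum \<open>\<psi>\<close> of slice indicators times
  functions of the position alone, which is Borel on the whole product and agrees with
  \<open>\<phi>\<close> on \<open>V\<close>.\<close>

lemma borel_measurable_borelV:
  fixes \<phi> :: "real \<times> int \<Rightarrow> real"
  assumes "\<And>\<sigma>. \<sigma> \<in> spins \<Longrightarrow> continuous_on UNIV (\<lambda>x. \<phi> (x, \<sigma>))"
  shows "\<phi> \<in> borel_measurable borelV"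
proof -
  define \<psi> where "\<psi> v = (\<Sum>\<sigma>\<in>spins. indicator {v. snd v = \<sigma>} v * \<phi> (fst v, \<sigma>))" for v
  have "\<psi> \<in> borel_measurable borel"
    unfolding \<psi>_def
  proof (intro borel_measurable_sum borel_measurable_times borel_measurable_indicator)
    fix \<sigma> :: int assume \<sigma>: "\<sigma> \<in> spins"
    have "closed (snd -` {\<sigma>} :: (real \<times> int) set)"
      by (intro continuous_closed_vimage) (auto intro!: continuous_intros)
    then have "closed {v :: real \<times> int. snd v = \<sigma>}"
      by (simp add: vimage_def)
    then show "{v :: real \<times> int. snd v = \<sigma>} \<in> sets borel"
      by (rule borel_closed)
    have "continuous_on UNIV (\<lambda>v :: real \<times> int. \<phi> (fst v, \<sigma>))"
      by (rule continuous_on_compose2[OF assms[OF \<sigma>]]) (auto intro!: continuous_intros)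
    then show "(\<lambda>v :: real \<times> int. \<phi> (fst v, \<sigma>)) \<in> borel_measurable borel"
      by (rule borel_measurable_continuous_onI)
  qed
  then have "\<psi> \<in> borel_measurable borelV"
    by (rule measurable_restrict_space1)
  moreover have "\<psi> v = \<phi> v" if "v \<in> V" for v
    using that by (cases v) (auto simp: V_def spins_def \<psi>_def indicator_def)
  ultimately show ?thesis
    by (subst measurable_cong[of _ _ \<psi>]) auto
qed

lemma continuous_V_measurable: "\<phi> \<in> continuous_V \<Longrightarrow> \<phi> \<in> borel_measurable borelV"
  by (intro borel_measurable_borelV) (simp add: continuous_V_def)

lemma continuous_V_bounded:
  assumes "\<phi> \<in> continuous_V"
  obtains C where "\<And>v. v \<in> V \<Longrightarrow> \<bar>\<phi> v\<bar> \<le> C"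
proof -
  have "\<exists>C. \<forall>x\<in>{0..1}. \<bar>\<phi> (x, \<sigma>)\<bar> \<le> C" if "\<sigma> \<in> spins" for \<sigma>
  proof -
    have "continuous_on {0..1} (\<lambda>x. \<phi> (x, \<sigma>))"
      using assms that continuous_on_subset by (fastforce simp: continuous_V_def)
    then have "compact ((\<lambda>x. \<phi> (x, \<sigma>)) ` {0..1})"
      by (intro compact_continuous_image) auto
    then show ?thesis
      using compact_imp_bounded bounded_real by (metis (no_types, lifting) imageI)
  qed
  then obtain C where C: "\<And>\<sigma> x. \<sigma> \<in> spins \<Longrightarrow> x \<in> {0..1} \<Longrightarrow> \<bar>\<phi> (x, \<sigma>)\<bar> \<le> C \<sigma>"
    by metis
  have "\<bar>\<phi> v\<bar> \<le> \<bar>C 1\<bar> + \<bar>C (-1)\<bar>" if "v \<in> V" for v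
  proof -
    obtain x \<sigma> where v: "v = (x, \<sigma>)" "x \<in> {0..1}" "\<sigma> \<in> spins"
      using \<open>v \<in> V\<close> by (auto simp: V_def)
    then show ?thesis using C[of \<sigma> x] by (auto simp: spins_cases)
  qed
  then show thesis by (rule that)
qed

lemma integrable_measures_V:
  fixes \<phi> :: "real \<times> int \<Rightarrow> real"
  assumes "\<beta> \<in> measures_V" "\<phi> \<in> borel_measurable borelV" "\<And>v. v \<in> V \<Longrightarrow> \<bar>\<phi> v\<bar> \<le> C"
  shows "integrable \<beta> \<phi>"
proof -
  interpret finite_measure \<beta> using assms(1) by (simp add: measures_V_def)
  have sets: "sets \<beta> = sets borelV" using assms(1) by (simp add: measures_V_def)
  have "\<phi> \<in> borel_measurable \<beta>"
    using assms(2) measurable_cong_sets[OF sets refl] by blast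
  moreover have "space \<beta> = V"
    using sets_eq_imp_space_eq[OF sets] by simp
  ultimately show ?thesis
    using assms(3) by (intro integrable_const_bound[where B = C]) auto
qed

lemma space_measures_V: "\<beta> \<in> measures_V \<Longrightarrow> space \<beta> = V"
  using sets_eq_imp_space_eq[of \<beta> borelV] by (simp add: measures_V_def)

lemma continuous_V_integrable:
  assumes "\<beta> \<in> measures_V" "\<phi> \<in> continuous_V"
  shows "integrable \<beta> \<phi>"
  using assms continuous_V_bounded[OF assms(2)] continuous_V_measurable integrable_measures_V by metis

lemma const_continuous_V [simp]: "(\<lambda>_. a) \<in> continuous_V"
  by (simp add: continuous_V_def)

abbreviation (input) mass :: "(real \<times> int) measure \<Rightarrow> real" where
  "mass \<beta> \<equiv> pairing \<beta> (\<lambda>_. 1)"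

lemma pairing_one_nonneg: "mass \<beta> \<ge> 0"
  by (simp add: pairing_def)

lemma pairing_cong:
  "\<beta> \<in> measures_V \<Longrightarrow> (\<And>v. v \<in> V \<Longrightarrow> \<phi> v = \<psi> v) \<Longrightarrow> pairing \<beta> \<phi> = pairing \<beta> \<psi>"
  unfolding pairing_def by (intro Bochner_Integration.integral_cong) (auto simp: space_measures_V)

lemma pairing_abs_le:
  assumes "\<beta> \<in> measures_V" "\<phi> \<in> continuous_V" "\<And>v. v \<in> V \<Longrightarrow> \<bar>\<phi> v\<bar> \<le> C"
  shows "\<bar>pairing \<beta> \<phi>\<bar> \<le> C * mass \<beta>"
proof -
  have "\<bar>pairing \<beta> \<phi>\<bar> \<le> (LINT v|\<beta>. \<bar>\<phi> v\<bar>)"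
    unfolding pairing_def by (rule integral_abs_bound)
  also have "\<dots> \<le> (LINT v|\<beta>. C)"
    using assms by (intro integral_mono integrable_abs continuous_V_integrable)
      (auto simp: space_measures_V)
  finally show ?thesis by (simp add: pairing_def mult.commute)
qed

lemma pairing_diff:
  "\<beta> \<in> measures_V \<Longrightarrow> \<phi> \<in> continuous_V \<Longrightarrow> \<psi> \<in> continuous_V \<Longrightarrow>
    pairing \<beta> (\<lambda>v. \<phi> v - \<psi> v) = pairing \<beta> \<phi> - pairing \<beta> \<psi>"
  unfolding pairing_def by (intro Bochner_Integration.integral_diff continuous_V_integrable)

lemma pairing_diff_le:
  assumes "\<beta> \<in> measures_V" "\<phi> \<in> continuous_V" "\<psi> \<in> continuous_V"
    and "\<And>v. v \<in> V \<Longrightarrow> \<bar>\<phi> v - \<psi> v\<bar> \<le> C"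
  shows "\<bar>pairing \<beta> \<phi> - pairing \<beta> \<psi>\<bar> \<le> C * mass \<beta>"
proof -
  have "(\<lambda>v. \<phi> v - \<psi> v) \<in> continuous_V"
    using assms(2,3) by (auto simp: continuous_V_def intro!: continuous_intros)
  from pairing_abs_le[OF assms(1) this assms(4)] show ?thesis
    using assms by (simp add: pairing_diff)
qed

text \<open>Only times in \<open>{0..T}\<close> are constrained, as in \<open>smooth_TV\<close>.
  Continuity is joint in time and position, so compactness of one period makes the slices move
  uniformly in time.\<close>

definition continuous_TV :: "real \<Rightarrow> (real \<Rightarrow> real \<times> int \<Rightarrow> real) set" where
  "continuous_TV T = {u. \<forall>\<sigma>\<in>spins. (\<forall>t\<in>{0..T}. \<forall>x. u t (x + 1, \<sigma>) = u t (x, \<sigma>)) \<and>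
     continuous_on ({0..T} \<times> UNIV) (\<lambda>(t, x). u t (x, \<sigma>))}"

lemma continuous_TV_slice:
  assumes "u \<in> continuous_TV T" "t \<in> {0..T}"
  shows "u t \<in> continuous_V"
proof -
  have "continuous_on UNIV (\<lambda>x. u t (x, \<sigma>))" if "\<sigma> \<in> spins" for \<sigma>
  proof -
    have c: "continuous_on ({0..T} \<times> UNIV) (\<lambda>(t, x). u t (x, \<sigma>))"
      using assms that by (simp add: continuous_TV_def)
    have "continuous_on UNIV (\<lambda>x. (\<lambda>(t, x). u t (x, \<sigma>)) (t, x))"
      by (rule continuous_on_compose2[OF c]) (use assms(2) in \<open>auto intro!: continuous_intros\<close>)
    then show ?thesis by simp
  qed
  then show ?thesis using assms by (simp add: continuous_V_def continuous_TV_def)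
qed

lemma continuous_TV_time:
  assumes "u \<in> continuous_TV T" "\<sigma> \<in> spins"
  shows "continuous_on {0..T} (\<lambda>t. u t (x, \<sigma>))"
proof -
  have c: "continuous_on ({0..T} \<times> UNIV) (\<lambda>(t, x). u t (x, \<sigma>))"
    using assms by (simp add: continuous_TV_def)
  have "continuous_on {0..T} (\<lambda>t. (\<lambda>(t, x). u t (x, \<sigma>)) (t, x))"
    by (rule continuous_on_compose2[OF c]) (auto intro!: continuous_intros)
  then show ?thesis by simp
qed

text \<open>\<open>{-1..2}\<close> is the period \<open>{0..1}\<close> widened by 1 on both sides: a
  jump has length \<open>1 / N \<le> 1\<close>, so the intermediate point of a Taylor expansion at a
  site stays inside.\<close>

lemma continuous_strip_bounded:
  assumes "continuous_on ({0..T} \<times> UNIV) (\<lambda>(t, x). (f :: real \<Rightarrow> real \<Rightarrow> real) t x)"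
  obtains C where "\<And>t x. t \<in> {0..T} \<Longrightarrow> x \<in> {-1..2} \<Longrightarrow> \<bar>f t x\<bar> \<le> C"
proof -
  have "continuous_on ({0..T} \<times> {-1..2}) (\<lambda>(t, x). f t x)"
    using assms by (rule continuous_on_subset) auto
  then have "compact ((\<lambda>(t, x). f t x) ` ({0..T} \<times> {-1..2}))"
    by (intro compact_continuous_image compact_Times) auto
  then obtain C where "\<And>y. y \<in> (\<lambda>(t, x). f t x) ` ({0..T} \<times> {-1..2}) \<Longrightarrow> \<bar>y\<bar> \<le> C"
    using compact_imp_bounded bounded_real by metis
  then show thesis by (intro that[of C]) force
qed

lemma continuous_TV_bounded:
  assumes "u \<in> continuous_TV T"
  obtains C where "C \<ge> 0" "\<And>t x \<sigma>. t \<in> {0..T} \<Longrightarrow> x \<in> {-1..2} \<Longrightarrow> \<sigma> \<in> spins \<Longrightarrow> \<bar>u t (x, \<sigma>)\<bar> \<le> C"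
proof -
  have "\<exists>C. \<forall>t\<in>{0..T}. \<forall>x\<in>{-1..2}. \<bar>u t (x, \<sigma>)\<bar> \<le> C" if "\<sigma> \<in> spins" for \<sigma>
  proof -
    have "continuous_on ({0..T} \<times> UNIV) (\<lambda>(t, x). u t (x, \<sigma>))"
      using assms that by (simp add: continuous_TV_def)
    then show ?thesis by (rule continuous_strip_bounded) blast
  qed
  then obtain C where C: "\<And>\<sigma> t x. \<sigma> \<in> spins \<Longrightarrow> t \<in> {0..T} \<Longrightarrow> x \<in> {-1..2} \<Longrightarrow> \<bar>u t (x, \<sigma>)\<bar> \<le> C \<sigma>"
    by metis
  have "\<bar>u t (x, \<sigma>)\<bar> \<le> \<bar>C 1\<bar> + \<bar>C (-1)\<bar>" if "t \<in> {0..T}" "x \<in> {-1..2}" "\<sigma> \<in> spins" for t x \<sigma>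
    using C[OF that(3,1,2)] that(3) by (auto simp: spins_cases)
  then show thesis by (intro that[of "\<bar>C 1\<bar> + \<bar>C (-1)\<bar>"]) auto
qed

lemma continuous_TV_uniform:
  assumes "u \<in> continuous_TV T" "\<epsilon> > 0"
  obtains d where "d > 0"
    "\<And>s t v. s \<in> {0..T} \<Longrightarrow> t \<in> {0..T} \<Longrightarrow> \<bar>s - t\<bar> < d \<Longrightarrow> v \<in> V \<Longrightarrow> \<bar>u s v - u t v\<bar> \<le> \<epsilon>"
proof -
  have "\<exists>d>0. \<forall>s\<in>{0..T}. \<forall>t\<in>{0..T}. \<forall>x\<in>{0..1}. \<bar>s - t\<bar> < d \<longrightarrow> \<bar>u s (x, \<sigma>) - u t (x, \<sigma>)\<bar> \<le> \<epsilon>"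
    if "\<sigma> \<in> spins" for \<sigma>
  proof -
    have "continuous_on ({0..T} \<times> {0..1}) (\<lambda>(t, x). u t (x, \<sigma>))"
      by (rule continuous_on_subset[of "{0..T} \<times> UNIV"])
        (use assms that in \<open>auto simp: continuous_TV_def\<close>)
    then have "uniformly_continuous_on ({0..T} \<times> {0..1}) (\<lambda>(t, x). u t (x, \<sigma>))"
      by (intro compact_uniformly_continuous compact_Times) auto
    then obtain d where "d > 0" and d: "\<And>p q. p \<in> {0..T} \<times> {0..1} \<Longrightarrow> q \<in> {0..T} \<times> {0..1} \<Longrightarrow>
        dist q p < d \<Longrightarrow> dist ((\<lambda>(t, x). u t (x, \<sigma>)) q) ((\<lambda>(t, x). u t (x, \<sigma>)) p) < \<epsilon>"
      unfolding uniformly_continuous_on_def using \<open>\<epsilon> > 0\<close> by metis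
    have "\<bar>u s (x, \<sigma>) - u t (x, \<sigma>)\<bar> \<le> \<epsilon>"
      if "s \<in> {0..T}" "t \<in> {0..T}" "x \<in> {0..1}" "\<bar>s - t\<bar> < d" for s t x
      using d[of "(t, x)" "(s, x)"] that by (simp add: dist_Pair_Pair dist_real_def)
    then show ?thesis using \<open>d > 0\<close> by blast
  qed
  then obtain d where d: "\<And>\<sigma>. \<sigma> \<in> spins \<Longrightarrow> d \<sigma> > 0"
    "\<And>\<sigma> s t x. \<sigma> \<in> spins \<Longrightarrow> s \<in> {0..T} \<Longrightarrow> t \<in> {0..T} \<Longrightarrow> x \<in> {0..1} \<Longrightarrow> \<bar>s - t\<bar> < d \<sigma> \<Longrightarrow>
      \<bar>u s (x, \<sigma>) - u t (x, \<sigma>)\<bar> \<le> \<epsilon>"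
    by metis
  have "\<bar>u s v - u t v\<bar> \<le> \<epsilon>"
    if "s \<in> {0..T}" "t \<in> {0..T}" "\<bar>s - t\<bar> < min (d 1) (d (-1))" "v \<in> V" for s t v
  proof -
    obtain x \<sigma> where v: "v = (x, \<sigma>)" "x \<in> {0..1}" "\<sigma> \<in> spins"
      using \<open>v \<in> V\<close> by (auto simp: V_def)
    then show ?thesis using d(2)[of \<sigma> s t x] that by (auto simp: spins_cases)
  qed
  moreover have "min (d 1) (d (-1)) > 0" using d(1) by (simp add: spins_def)
  ultimately show thesis by (rule that[rotated])
qed

section \<open>Cadlag paths\<close>

text \<open>The least multiple of \<open>T / n\<close> that is not below \<open>s\<close>. Rounding
  up makes a right-continuous function evaluated at \<open>grid_up T n s\<close> converge to its
  value at \<open>s\<close> as the mesh shrinks.\<close>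

definition grid_up :: "real \<Rightarrow> nat \<Rightarrow> real \<Rightarrow> real" where
  "grid_up T n s = T * real_of_int \<lceil>real n * s / T\<rceil> / real n"

lemma grid_up_ge:
  assumes "T > 0" "n \<ge> 1"
  shows "s \<le> grid_up T n s"
proof -
  have "real n * s \<le> real_of_int \<lceil>real n * s / T\<rceil> * T"
    using le_of_int_ceiling[of "real n * s / T"] assms(1) by (simp only: pos_divide_le_eq)
  then show ?thesis
    using assms(2) by (simp add: grid_up_def pos_le_divide_eq mult.commute)
qed

lemma grid_up_less: "T > 0 \<Longrightarrow> n \<ge> 1 \<Longrightarrow> grid_up T n s < s + T / real n"
  using ceiling_correct[of "real n * s / T"] by (simp add: grid_up_def field_simps)

lemma grid_up_mem: "T > 0 \<Longrightarrow> n \<ge> 1 \<Longrightarrow> s \<in> {0..T} \<Longrightarrow> grid_up T n s \<in> {s..T}"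
proof -
  assume a: "T > 0" "n \<ge> 1" "s \<in> {0..T}"
  have "\<lceil>real n * s / T\<rceil> \<le> int n"
    using a by (intro ceiling_le) (simp add: field_simps)
  then have "real_of_int \<lceil>real n * s / T\<rceil> \<le> real n"
    by linarith
  then show ?thesis using a grid_up_ge[of T n s] by (simp add: grid_up_def field_simps)
qed

lemma grid_up_tendsto:
  assumes "T > 0"
  shows "(\<lambda>n. grid_up T (Suc n) s) \<longlonglongrightarrow> s"
proof (rule tendsto_sandwich)
  show "\<forall>\<^sub>F n in sequentially. s \<le> grid_up T (Suc n) s"
    using grid_up_ge[OF assms, of "Suc _"] by simp
  show "\<forall>\<^sub>F n in sequentially. grid_up T (Suc n) s \<le> s + T / real (Suc n)"
    using grid_up_less[OF assms, of "Suc _" s] by (intro always_eventually allI less_imp_le) simp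
  show "(\<lambda>n. s + T / real (Suc n)) \<longlonglongrightarrow> s"
    using tendsto_add[OF tendsto_const LIMSEQ_Suc[OF lim_const_over_n[of T]], of s] by simp
qed simp

lemma grid_up_tendsto_compose:
  fixes f :: "real \<Rightarrow> 'a :: topological_space"
  assumes "T > 0" "s \<in> {0..T}" "continuous (at s within {s..T}) f"
  shows "(\<lambda>n. f (grid_up T (Suc n) s)) \<longlonglongrightarrow> f s"
  using assms(3) by (rule continuous_within_tendsto_compose')
    (use assms(1,2) grid_up_mem grid_up_tendsto in auto)

lemma tendsto_at_right_continuous:
  fixes f :: "real \<Rightarrow> 'a :: t2_space"
  assumes "(f \<longlongrightarrow> f t) (at_right t)"
  shows "continuous (at t within {t..T}) f"
proof -
  have "{t..T} - {t} \<subseteq> {t<..} - {t}"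
    by auto
  then have "at t within {t..T} \<le> at_right t"
    unfolding at_within_def by (intro inf_mono) auto
  then show ?thesis
    unfolding continuous_within using assms tendsto_mono by blast
qed

text \<open>Continuity within \<open>{s..T}\<close> is vacuous at \<open>s = T\<close>, so one
  formula covers the closed interval, and it applies directly to the points
  \<open>grid_up T n s \<ge> s\<close>.\<close>

definition right_continuous :: "real \<Rightarrow> (real \<Rightarrow> 'a :: topological_space) \<Rightarrow> bool" where
  "right_continuous T f \<longleftrightarrow> (\<forall>s\<in>{0..T}. continuous (at s within {s..T}) f)"

text \<open>On the interval \<open>f\<close> is the pointwise limit of its values at
  \<open>grid_up T (Suc n) s\<close>; each approximation factors through an integer-valued ceiling
  and is therefore measurable whatever \<open>f\<close> is.\<close>

lemma right_continuous_measurable: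
  fixes f :: "real \<Rightarrow> real"
  assumes "T > 0" "right_continuous T f"
  shows "(\<lambda>s. indicator {0..T} s * f s) \<in> borel_measurable borel"
proof (rule borel_measurable_LIMSEQ_real)
  fix s :: real
  show "(\<lambda>n. indicator {0..T} s * f (grid_up T (Suc n) s)) \<longlonglongrightarrow> indicator {0..T} s * f s"
    using grid_up_tendsto_compose[of T s f] assms
    by (cases "s \<in> {0..T}") (auto simp: right_continuous_def intro!: tendsto_intros)
next
  fix n
  have "(\<lambda>k. f (T * real_of_int k / real (Suc n))) \<in> count_space UNIV \<rightarrow>\<^sub>M borel"
    by simp
  moreover have "(\<lambda>s. \<lceil>real (Suc n) * s / T\<rceil>) \<in> borel \<rightarrow>\<^sub>M count_space UNIV"
    by measurable
  ultimately have "(\<lambda>s. f (grid_up T (Suc n) s)) \<in> borel_measurable borel"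
    unfolding grid_up_def by (rule measurable_compose[rotated])
  then show "(\<lambda>s. indicator {0..T} s * f (grid_up T (Suc n) s)) \<in> borel_measurable borel"
    by measurable
qed

lemma right_continuous_set_integrable:
  fixes f :: "real \<Rightarrow> real"
  assumes "T > 0" "right_continuous T f" "\<And>s. s \<in> {0..T} \<Longrightarrow> \<bar>f s\<bar> \<le> B"
  shows "set_integrable lborel {0..T} f"
  unfolding set_integrable_def
proof (rule Bochner_Integration.integrable_bound)
  show "integrable lborel (\<lambda>s. indicator {0..T} s *\<^sub>R B)"
    by (rule integrable_real_mult_indicator[of "{0..T}" lborel "\<lambda>_. B", simplified mult.commute]
        | simp add: integrable_indicator_iff emeasure_lborel_Icc_eq)+
  show "(\<lambda>s. indicator {0..T} s *\<^sub>R f s) \<in> borel_measurable lborel"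
    using right_continuous_measurable[OF assms(1,2)] by simp
  show "AE s in lborel. norm (indicator {0..T} s *\<^sub>R f s) \<le> norm (indicator {0..T} s *\<^sub>R B)"
    using assms(3) by (auto simp: indicator_def intro!: AE_I2 order_trans[OF assms(3) abs_ge_self])
qed

definition one_sided_limits :: "real \<Rightarrow> (real \<Rightarrow> real) \<Rightarrow> bool" where
  "one_sided_limits T a \<longleftrightarrow> (\<forall>t\<in>{0..<T}. \<exists>l. (a \<longlongrightarrow> l) (at_right t)) \<and>
     (\<forall>t\<in>{0<..T}. \<exists>l. (a \<longlongrightarrow> l) (at_left t))"

lemma one_sided_limits_local:
  fixes a :: "real \<Rightarrow> real"
  assumes "one_sided_limits T a"
    and "x \<in> {0..T}" "e > 0"
  obtains d l r where "d > 0"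
    "\<And>t. t \<in> {0..T} \<Longrightarrow> x < t \<Longrightarrow> t < x + d \<Longrightarrow> \<bar>a t - r\<bar> < e"
    "\<And>t. t \<in> {0..T} \<Longrightarrow> x - d < t \<Longrightarrow> t < x \<Longrightarrow> \<bar>a t - l\<bar> < e"
proof -
  have "\<exists>d>0. \<exists>r. \<forall>t\<in>{0..T}. x < t \<and> t < x + d \<longrightarrow> \<bar>a t - r\<bar> < e"
  proof (cases "x < T")
    case True
    then obtain r where "(a \<longlongrightarrow> r) (at_right x)"
      using assms(1,2) unfolding one_sided_limits_def by (metis atLeastAtMost_iff atLeastLessThan_iff)
    then have "\<forall>\<^sub>F t in at_right x. \<bar>a t - r\<bar> < e"
      using tendstoD[OF _ \<open>e > 0\<close>] by (fastforce simp: dist_real_def)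
    then obtain b where "b > x" "\<And>t. x < t \<Longrightarrow> t < b \<Longrightarrow> \<bar>a t - r\<bar> < e"
      by (auto simp: eventually_at_right_field)
    then show ?thesis by (intro exI[of _ "b - x"] conjI exI[of _ r]) auto
  qed (use assms(2) in \<open>auto intro!: exI[of _ 1]\<close>)
  moreover have "\<exists>d>0. \<exists>l. \<forall>t\<in>{0..T}. x - d < t \<and> t < x \<longrightarrow> \<bar>a t - l\<bar> < e"
  proof (cases "x > 0")
    case True
    then obtain l where "(a \<longlongrightarrow> l) (at_left x)"
      using assms(1,2) unfolding one_sided_limits_def by (metis atLeastAtMost_iff greaterThanAtMost_iff)
    then have "\<forall>\<^sub>F t in at_left x. \<bar>a t - l\<bar> < e"
      using tendstoD[OF _ \<open>e > 0\<close>] by (fastforce simp: dist_real_def)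
    then obtain b where "b < x" "\<And>t. b < t \<Longrightarrow> t < x \<Longrightarrow> \<bar>a t - l\<bar> < e"
      by (auto simp: eventually_at_left_field)
    then show ?thesis by (intro exI[of _ "x - b"] conjI exI[of _ l]) auto
  qed (use assms(2) in \<open>auto intro!: exI[of _ 1]\<close>)
  ultimately obtain d1 d2 r l where "d1 > 0" "d2 > 0"
    "\<And>t. t \<in> {0..T} \<Longrightarrow> x < t \<Longrightarrow> t < x + d1 \<Longrightarrow> \<bar>a t - r\<bar> < e"
    "\<And>t. t \<in> {0..T} \<Longrightarrow> x - d2 < t \<Longrightarrow> t < x \<Longrightarrow> \<bar>a t - l\<bar> < e"
    by metis
  then show thesis by (intro that[of "min d1 d2" r l]) auto
qed

text \<open>Near each point the values lie within 1 of one of the two one-sided limits, apart from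
  the value at the point itself. So \<open>a\<close> is locally bounded, and bisection makes the
  bound global.\<close>

lemma one_sided_limits_bounded:
  fixes a :: "real \<Rightarrow> real"
  assumes "one_sided_limits T a"
    and "T > 0"
  obtains B where "\<And>t. t \<in> {0..T} \<Longrightarrow> \<bar>a t\<bar> \<le> B"
proof -
  have "\<exists>B. \<forall>t\<in>{0..T}. 0 \<le> t \<and> t \<le> T \<longrightarrow> \<bar>a t\<bar> \<le> B"
  proof (rule Bolzano[where P = "\<lambda>x y. \<exists>B. \<forall>t\<in>{0..T}. x \<le> t \<and> t \<le> y \<longrightarrow> \<bar>a t\<bar> \<le> B"
        and a = 0 and b = T], goal_cases)
    case 1
    then show ?case using \<open>T > 0\<close> by simp
  next
    case (2 x y z)
    then obtain B B' where "\<forall>t\<in>{0..T}. x \<le> t \<and> t \<le> y \<longrightarrow> \<bar>a t\<bar> \<le> B"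
      "\<forall>t\<in>{0..T}. y \<le> t \<and> t \<le> z \<longrightarrow> \<bar>a t\<bar> \<le> B'" by blast
    then show ?case by (intro exI[of _ "max B B'"]) (metis le_max_iff_disj linear)
  next
    case (3 x)
    then have x: "x \<in> {0..T}" by simp
    obtain d l r where d: "d > 0"
      "\<And>t. t \<in> {0..T} \<Longrightarrow> x < t \<Longrightarrow> t < x + d \<Longrightarrow> \<bar>a t - r\<bar> < 1"
      "\<And>t. t \<in> {0..T} \<Longrightarrow> x - d < t \<Longrightarrow> t < x \<Longrightarrow> \<bar>a t - l\<bar> < 1"
      by (rule one_sided_limits_local[OF assms(1) x zero_less_one]) (rule that)
    have "\<bar>a t\<bar> \<le> \<bar>a x\<bar> + \<bar>r\<bar> + \<bar>l\<bar> + 1"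
      if pq: "p \<le> x" "x \<le> q" "q - p < d" "t \<in> {0..T}" "p \<le> t" "t \<le> q" for p q t
    proof -
      consider "t = x" | "x < t" "t < x + d" | "x - d < t" "t < x" using pq by linarith
      then show ?thesis using d(2,3)[OF \<open>t \<in> {0..T}\<close>] by cases auto
    qed
    then show ?case using d(1) by blast
  qed
  then show thesis by (metis that atLeastAtMost_iff)
qed

text \<open>For fixed \<open>e\<close> the points of \<open>bad e\<close> do not accumulate: close
  to \<open>x\<close>, all values on one side of \<open>x\<close> are within \<open>e / 2\<close> of
  a common limit, so no nearby point other than \<open>x\<close> is bad. Bisection gives finitely
  many bad points for each \<open>e\<close>, and the scales \<open>1 / Suc n\<close> exhaust the
  discontinuities.\<close>

lemma one_sided_limits_countable:
  fixes a :: "real \<Rightarrow> real"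
  assumes "one_sided_limits T a"
    and "T > 0"
  shows "countable {t \<in> {0..T}. \<not> continuous (at t within {0..T}) a}"
proof -
  define bad where "bad e = {t \<in> {0..T}. \<not> (\<exists>d>0. \<forall>u\<in>{0..T}. \<bar>u - t\<bar> < d \<longrightarrow> \<bar>a u - a t\<bar> < e)}" for e
  have fin: "finite (bad e \<inter> {0..T})" if "e > 0" for e
  proof (rule Bolzano[where P = "\<lambda>x y. finite (bad e \<inter> {x..y})" and a = 0 and b = T], goal_cases)
    case 1
    then show ?case using \<open>T > 0\<close> by simp
  next
    case (2 x y z)
    then have "finite (bad e \<inter> {x..y} \<union> bad e \<inter> {y..z})" by blast
    then show ?case by (rule finite_subset[rotated]) auto
  next
    case (3 x)
    then have x: "x \<in> {0..T}" by simp
    have "e / 2 > 0" using \<open>e > 0\<close> by simp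
    obtain d l r where d: "d > 0"
      "\<And>t. t \<in> {0..T} \<Longrightarrow> x < t \<Longrightarrow> t < x + d \<Longrightarrow> \<bar>a t - r\<bar> < e / 2"
      "\<And>t. t \<in> {0..T} \<Longrightarrow> x - d < t \<Longrightarrow> t < x \<Longrightarrow> \<bar>a t - l\<bar> < e / 2"
      by (rule one_sided_limits_local[OF assms(1) x \<open>e / 2 > 0\<close>]) (rule that)
    have "bad e \<inter> {p..q} \<subseteq> {x}" if pq: "p \<le> x" "x \<le> q" "q - p < d" for p q
    proof
      fix t assume t: "t \<in> bad e \<inter> {p..q}"
      then have tT: "t \<in> {0..T}" by (simp add: bad_def)
      show "t \<in> {x}"
      proof (rule ccontr)
        assume "t \<notin> {x}"
        then consider "x < t" "t < x + d" | "x - d < t" "t < x" using pq t by force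
        then have "\<exists>d>0. \<forall>u\<in>{0..T}. \<bar>u - t\<bar> < d \<longrightarrow> \<bar>a u - a t\<bar> < e"
        proof cases
          case 1
          have "\<bar>a u - a t\<bar> < e" if u: "u \<in> {0..T}" "\<bar>u - t\<bar> < min (t - x) (x + d - t)" for u
          proof -
            have "x < u" "u < x + d" using u(2) by linarith+
            from d(2)[OF u(1) this] d(2)[OF tT 1] show ?thesis by linarith
          qed
          then show ?thesis using 1 by (intro exI[of _ "min (t - x) (x + d - t)"]) auto
        next
          case 2
          have "\<bar>a u - a t\<bar> < e" if u: "u \<in> {0..T}" "\<bar>u - t\<bar> < min (x - t) (t - x + d)" for u
          proof -
            have "x - d < u" "u < x" using u(2) by linarith+
            from d(3)[OF u(1) this] d(3)[OF tT 2] show ?thesis by linarith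
          qed
          then show ?thesis using 2 by (intro exI[of _ "min (x - t) (t - x + d)"]) auto
        qed
        then show False using t unfolding bad_def by blast
      qed
    qed
    then show ?case using d(1) by (meson finite.emptyI finite.insertI finite_subset)
  qed
  have "countable (\<Union>n. bad (1 / real (Suc n)) \<inter> {0..T})"
    by (rule countable_UN[OF _ countable_finite[OF fin]]) simp_all
  moreover have "{t \<in> {0..T}. \<not> continuous (at t within {0..T}) a} \<subseteq> (\<Union>n. bad (1 / real (Suc n)) \<inter> {0..T})"
  proof
    fix t assume "t \<in> {t \<in> {0..T}. \<not> continuous (at t within {0..T}) a}"
    then have t: "t \<in> {0..T}" and "\<not> continuous (at t within {0..T}) a" by auto
    then obtain e where e: "e > 0" "\<not> (\<exists>d>0. \<forall>u\<in>{0..T}. \<bar>u - t\<bar> < d \<longrightarrow> \<bar>a u - a t\<bar> < e)"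
      unfolding continuous_within_eps_delta dist_real_def by blast
    obtain n where "1 / real (Suc n) < e" using reals_Archimedean[OF e(1)] by (auto simp: inverse_eq_divide)
    then have "t \<in> bad (1 / real (Suc n))"
      using e(2) t unfolding bad_def by (simp del: of_nat_Suc) (meson less_trans)
    then show "t \<in> (\<Union>n. bad (1 / real (Suc n)) \<inter> {0..T})" using t by blast
  qed
  ultimately show ?thesis using countable_subset by blast
qed

section \<open>Pairings along Skorokhod paths and their limits\<close>

lemma topspace_weak_topology_subset: "topspace weak_topology \<subseteq> measures_V"
  unfolding weak_topology_def by (auto simp: topology_generated_by_topspace)

lemma limitin_weak_topology_pairing:
  assumes "limitin weak_topology \<alpha> \<beta> F" "\<phi> \<in> continuous_V"
  shows "((\<lambda>t. pairing (\<alpha> t) \<phi>) \<longlongrightarrow> pairing \<beta> \<phi>) F"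
proof (rule topological_tendstoI)
  fix U :: "real set" assume U: "open U" "pairing \<beta> \<phi> \<in> U"
  have "\<beta> \<in> measures_V"
    using assms(1) topspace_weak_topology_subset by (auto simp: limitin_def)
  moreover have "openin weak_topology {\<beta> \<in> measures_V. pairing \<beta> \<phi> \<in> U}"
    unfolding weak_topology_def using assms(2) U(1) by (intro topology_generated_by_Basis) blast
  ultimately have "\<forall>\<^sub>F t in F. \<alpha> t \<in> {\<beta> \<in> measures_V. pairing \<beta> \<phi> \<in> U}"
    using assms(1) U unfolding limitin_def by blast
  then show "\<forall>\<^sub>F t in F. pairing (\<alpha> t) \<phi> \<in> U" by eventually_elim simp
qed

lemma skorokhod_space_measures: "\<alpha> \<in> skorokhod_space T \<Longrightarrow> t \<in> {0..T} \<Longrightarrow> \<alpha> t \<in> measures_V"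
  by (auto simp: skorokhod_space_def)

context
  fixes T \<alpha> \<phi>
  assumes \<alpha>: "\<alpha> \<in> skorokhod_space T" and \<phi>: "\<phi> \<in> continuous_V" and T: "T > 0"
begin

lemma skorokhod_limits:
  "t \<in> {0..<T} \<Longrightarrow> ((\<lambda>s. pairing (\<alpha> s) \<phi>) \<longlongrightarrow> pairing (\<alpha> t) \<phi>) (at_right t)"
  "t \<in> {0<..T} \<Longrightarrow> \<exists>l. ((\<lambda>s. pairing (\<alpha> s) \<phi>) \<longlongrightarrow> l) (at_left t)"
  using \<alpha> limitin_weak_topology_pairing[OF _ \<phi>] unfolding skorokhod_space_def by blast+

lemma skorokhod_one_sided_limits: "one_sided_limits T (\<lambda>s. pairing (\<alpha> s) \<phi>)"
  unfolding one_sided_limits_def using skorokhod_limits by blast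

lemma skorokhod_right_continuous: "right_continuous T (\<lambda>s. pairing (\<alpha> s) \<phi>)"
  unfolding right_continuous_def
proof
  fix s assume s: "s \<in> {0..T}"
  show "continuous (at s within {s..T}) (\<lambda>s. pairing (\<alpha> s) \<phi>)"
  proof (cases "s = T")
    case False
    then show ?thesis using s by (intro tendsto_at_right_continuous skorokhod_limits) auto
  qed (simp add: continuous_within at_within_def)
qed

lemma skorokhod_bounded:
  obtains B where "\<And>t. t \<in> {0..T} \<Longrightarrow> \<bar>pairing (\<alpha> t) \<phi>\<bar> \<le> B"
  using one_sided_limits_bounded[OF skorokhod_one_sided_limits T] by blast

lemma skorokhod_countable_discontinuities:
  "countable {t \<in> {0..T}. \<not> continuous (at t within {0..T}) (\<lambda>s. pairing (\<alpha> s) \<phi>)}"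
  using skorokhod_one_sided_limits T by (rule one_sided_limits_countable)

end

text \<open>The masses converge, so they are eventually below \<open>\<bar>m\<bar> + 1\<close>, and
  replacing the moving test function by its uniform limit changes the pairing by an arbitrarily
  small amount.\<close>

lemma pairing_tendsto_uniform:
  assumes "\<forall>\<^sub>F i in F. \<beta> i \<in> measures_V" "\<forall>\<^sub>F i in F. \<phi> i \<in> continuous_V" "\<psi> \<in> continuous_V"
    and one: "((\<lambda>i. mass (\<beta> i)) \<longlongrightarrow> m) F"
    and lim: "((\<lambda>i. pairing (\<beta> i) \<psi>) \<longlongrightarrow> l) F"
    and unif: "\<And>e. e > 0 \<Longrightarrow> \<forall>\<^sub>F i in F. \<forall>v\<in>V. \<bar>\<phi> i v - \<psi> v\<bar> \<le> e"
  shows "((\<lambda>i. pairing (\<beta> i) (\<phi> i)) \<longlongrightarrow> l) F"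
proof -
  have "((\<lambda>i. pairing (\<beta> i) (\<phi> i) - pairing (\<beta> i) \<psi>) \<longlongrightarrow> 0) F"
  proof (rule tendstoI)
    fix e :: real assume "e > 0"
    define d where "d = e / (\<bar>m\<bar> + 2)"
    have d: "d > 0" "d * (\<bar>m\<bar> + 2) = e" using \<open>e > 0\<close> by (auto simp: d_def)
    have "\<forall>\<^sub>F i in F. mass (\<beta> i) < \<bar>m\<bar> + 1"
      using one by (rule order_tendstoD) auto
    with unif[OF d(1)] assms(1,2)
    show "\<forall>\<^sub>F i in F. dist (pairing (\<beta> i) (\<phi> i) - pairing (\<beta> i) \<psi>) 0 < e"
    proof eventually_elim
      case (elim i)
      have "\<bar>pairing (\<beta> i) (\<phi> i) - pairing (\<beta> i) \<psi>\<bar> \<le> d * mass (\<beta> i)"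
        using elim assms(3) by (intro pairing_diff_le) auto
      also have "\<dots> < d * (\<bar>m\<bar> + 2)"
        using d(1) elim by (intro mult_strict_left_mono) auto
      finally show ?case using d(2) by simp
    qed
  qed
  from tendsto_add[OF this lim] show ?thesis by simp
qed

text \<open>A three-term estimate: \<open>\<phi>\<close> is replaced by a nearby
  \<open>\<psi>\<close> in the pairings with \<open>\<beta> i\<close> and with
  \<open>\<gamma>\<close>, and convergence of the masses keeps both errors near
  \<open>d * mass \<gamma>\<close>. It is applied with \<open>\<psi>\<close> a neighbouring time
  slice of the same test function.\<close>

lemma pairing_tendsto_dense:
  assumes \<beta>: "\<forall>\<^sub>F i in F. \<beta> i \<in> measures_V" "\<gamma> \<in> measures_V" and \<phi>: "\<phi> \<in> continuous_V"
    and one: "((\<lambda>i. mass (\<beta> i)) \<longlongrightarrow> mass \<gamma>) F"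
    and dense: "\<And>e. e > 0 \<Longrightarrow> \<exists>\<psi>\<in>continuous_V. (\<forall>v\<in>V. \<bar>\<psi> v - \<phi> v\<bar> \<le> e) \<and>
      ((\<lambda>i. pairing (\<beta> i) \<psi>) \<longlongrightarrow> pairing \<gamma> \<psi>) F"
  shows "((\<lambda>i. pairing (\<beta> i) \<phi>) \<longlongrightarrow> pairing \<gamma> \<phi>) F"
proof (rule tendstoI)
  fix e :: real assume "e > 0"
  define m where "m = mass \<gamma>"
  have m: "m \<ge> 0" by (simp add: m_def pairing_one_nonneg)
  define d where "d = e / (2 * (m + 1))"
  have d: "d > 0" "d * (2 * m + 2) = e" using \<open>e > 0\<close> m by (auto simp: d_def field_simps)
  obtain \<psi> where \<psi>: "\<psi> \<in> continuous_V" "\<And>v. v \<in> V \<Longrightarrow> \<bar>\<psi> v - \<phi> v\<bar> \<le> d"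
    "((\<lambda>i. pairing (\<beta> i) \<psi>) \<longlongrightarrow> pairing \<gamma> \<psi>) F"
    using dense[OF d(1)] by blast
  have "((\<lambda>i. \<bar>pairing (\<beta> i) \<psi> - pairing \<gamma> \<psi>\<bar> + d * mass (\<beta> i) + d * m) \<longlongrightarrow>
      \<bar>pairing \<gamma> \<psi> - pairing \<gamma> \<psi>\<bar> + d * m + d * m) F"
    using \<psi>(3) one unfolding m_def by (intro tendsto_intros)
  then have "\<forall>\<^sub>F i in F. \<bar>pairing (\<beta> i) \<psi> - pairing \<gamma> \<psi>\<bar> + d * mass (\<beta> i) + d * m < e"
    by (rule order_tendstoD) (use d in \<open>auto simp: algebra_simps\<close>)
  with \<beta>(1) show "\<forall>\<^sub>F i in F. dist (pairing (\<beta> i) \<phi>) (pairing \<gamma> \<phi>) < e"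
  proof eventually_elim
    case (elim i)
    have "\<bar>pairing (\<beta> i) \<psi> - pairing (\<beta> i) \<phi>\<bar> \<le> d * mass (\<beta> i)"
      using elim \<phi> \<psi> by (intro pairing_diff_le) auto
    moreover have "\<bar>pairing \<gamma> \<psi> - pairing \<gamma> \<phi>\<bar> \<le> d * m"
      unfolding m_def using \<beta>(2) \<phi> \<psi> by (intro pairing_diff_le) auto
    ultimately show ?case using elim(2) by (simp add: dist_real_def)
  qed
qed

section \<open>The flip rates\<close>

text \<open>The flip rate is constant on each spin component, so cutting the test function this way
  turns the nonlinear flip term into two scalar rates times ordinary pairings.\<close>

definition spin_part :: "int \<Rightarrow> (real \<times> int \<Rightarrow> real) \<Rightarrow> real \<times> int \<Rightarrow> real" where
  "spin_part \<tau> w = (\<lambda>(x, \<sigma>). of_bool (\<sigma> = \<tau>) * w (x, \<sigma>))"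

lemma spin_part_continuous_V: "w \<in> continuous_V \<Longrightarrow> spin_part \<tau> w \<in> continuous_V"
  by (auto simp: continuous_V_def spin_part_def intro!: continuous_intros)

lemma spin_part_continuous_TV: "w \<in> continuous_TV T \<Longrightarrow> (\<lambda>t. spin_part \<tau> (w t)) \<in> continuous_TV T"
  by (auto simp: continuous_TV_def spin_part_def case_prod_unfold intro!: continuous_intros)

abbreviation (input) spin :: "real \<times> int \<Rightarrow> real" where
  "spin \<equiv> (\<lambda>(x, \<sigma>). of_bool (\<sigma> = 1) - of_bool (\<sigma> = -1))"

lemma spin_continuous_V: "spin \<in> continuous_V"
  by (auto simp: continuous_V_def)

lemma pairing_spin_abs_le: "\<beta> \<in> measures_V \<Longrightarrow> \<bar>pairing \<beta> spin\<bar> \<le> mass \<beta>"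
  using pairing_abs_le[OF _ spin_continuous_V, of \<beta> 1] by (force simp: case_prod_unfold)

text \<open>For mass zero the quotient is 0 by the convention for division; otherwise the mass
  bounds the numerator.\<close>

lemma magnetization_mem: "\<beta> \<in> measures_V \<Longrightarrow> magnetization \<beta> \<in> {-1..1}"
  using pairing_spin_abs_le[of \<beta>] pairing_one_nonneg[of \<beta>]
  unfolding magnetization_def
  by (cases "mass \<beta> = 0") (auto simp: abs_le_iff divide_le_eq le_divide_eq)

lemma pairing_TV_abs_le:
  assumes u: "u \<in> continuous_TV T"
  obtains C where "C \<ge> 0" "\<forall>\<beta>\<in>measures_V. \<forall>t\<in>{0..T}. \<bar>pairing \<beta> (u t)\<bar> \<le> C * mass \<beta>"
proof -
  obtain C where C: "C \<ge> 0" "\<And>t x \<sigma>. t \<in> {0..T} \<Longrightarrow> x \<in> {-1..2} \<Longrightarrow> \<sigma> \<in> spins \<Longrightarrow> \<bar>u t (x, \<sigma>)\<bar> \<le> C"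
    using continuous_TV_bounded[OF u] by metis
  show thesis
    by (rule that[OF C(1)], intro ballI pairing_abs_le continuous_TV_slice[OF u])
      (auto simp: V_def intro!: C(2))
qed

locale flip_rates =
  fixes c :: "int \<Rightarrow> real \<Rightarrow> real" and b :: real
  assumes c_nonneg: "\<sigma> \<in> spins \<Longrightarrow> m \<in> {-1..1} \<Longrightarrow> c \<sigma> m \<ge> 0"
    and c_le: "\<sigma> \<in> spins \<Longrightarrow> m \<in> {-1..1} \<Longrightarrow> c \<sigma> m \<le> b"
    and c_continuous: "\<sigma> \<in> spins \<Longrightarrow> continuous_on {-1..1} (c \<sigma>)"
begin

lemma b_nonneg: "b \<ge> 0"
  using c_nonneg[of 1 0] c_le[of 1 0] by (simp add: spins_def)

text \<open>Linear in \<open>w\<close> but not in \<open>\<beta>\<close>: the rate is evaluated at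
  the magnetization of the same measure.\<close>

definition flip_pairing :: "(real \<times> int) measure \<Rightarrow> (real \<times> int \<Rightarrow> real) \<Rightarrow> real" where
  "flip_pairing \<beta> w = pairing \<beta> (\<lambda>(x, \<sigma>). c \<sigma> (magnetization \<beta>) * w (x, \<sigma>))"

lemma flip_test_continuous_V: "w \<in> continuous_V \<Longrightarrow> (\<lambda>(x, \<sigma>). c \<sigma> m * w (x, \<sigma>)) \<in> continuous_V"
  by (auto simp: continuous_V_def intro!: continuous_intros)

lemma flip_pairing_eq:
  assumes "\<beta> \<in> measures_V" "w \<in> continuous_V"
  shows "flip_pairing \<beta> w = (\<Sum>\<tau>\<in>spins. c \<tau> (magnetization \<beta>) * pairing \<beta> (spin_part \<tau> w))"
proof -
  have "(\<Sum>\<tau>\<in>spins. c \<tau> (magnetization \<beta>) * pairing \<beta> (spin_part \<tau> w))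
      = (\<Sum>\<tau>\<in>spins. LINT v|\<beta>. c \<tau> (magnetization \<beta>) * spin_part \<tau> w v)"
    by (simp add: pairing_def)
  also have "\<dots> = pairing \<beta> (\<lambda>v. \<Sum>\<tau>\<in>spins. c \<tau> (magnetization \<beta>) * spin_part \<tau> w v)"
    unfolding pairing_def
    by (rule Bochner_Integration.integral_sum[symmetric])
      (use assms spin_part_continuous_V in \<open>auto intro!: integrable_mult_right continuous_V_integrable\<close>)
  also have "\<dots> = flip_pairing \<beta> w"
    unfolding flip_pairing_def using assms(1)
    by (rule pairing_cong) (auto simp: V_def spins_def spin_part_def)
  finally show ?thesis ..
qed

lemma flip_pairing_abs_le:
  assumes "\<beta> \<in> measures_V" "w \<in> continuous_V" "\<And>v. v \<in> V \<Longrightarrow> \<bar>w v\<bar> \<le> C"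
  shows "\<bar>flip_pairing \<beta> w\<bar> \<le> b * C * mass \<beta>"
  unfolding flip_pairing_def
proof (rule pairing_abs_le[OF assms(1) flip_test_continuous_V[OF assms(2)]])
  fix v assume v: "v \<in> V"
  obtain x \<sigma> where x: "v = (x, \<sigma>)" "\<sigma> \<in> spins" using v by (auto simp: V_def)
  have "\<bar>c \<sigma> (magnetization \<beta>)\<bar> * \<bar>w v\<bar> \<le> b * C"
    using c_nonneg[OF x(2) magnetization_mem[OF assms(1)]] c_le[OF x(2) magnetization_mem[OF assms(1)]]
      assms(3)[OF v] by (intro mult_mono) auto
  then show "\<bar>case v of (x, \<sigma>) \<Rightarrow> c \<sigma> (magnetization \<beta>) * w (x, \<sigma>)\<bar> \<le> b * C"
    by (simp add: x abs_mult)
qed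

lemma flip_pairing_TV_abs_le:
  assumes w: "w \<in> continuous_TV T"
  obtains C where "C \<ge> 0" "\<forall>\<beta>\<in>measures_V. \<forall>t\<in>{0..T}. \<bar>flip_pairing \<beta> (w t)\<bar> \<le> C * mass \<beta>"
proof -
  obtain C where C: "C \<ge> 0" "\<And>t x \<sigma>. t \<in> {0..T} \<Longrightarrow> x \<in> {-1..2} \<Longrightarrow> \<sigma> \<in> spins \<Longrightarrow> \<bar>w t (x, \<sigma>)\<bar> \<le> C"
    using continuous_TV_bounded[OF w] by metis
  have "b * C \<ge> 0" using C(1) b_nonneg by simp
  then show thesis
    by (rule that, intro ballI flip_pairing_abs_le continuous_TV_slice[OF w])
      (auto simp: V_def intro!: C(2))
qed

text \<open>At total mass zero the magnetization jumps, but there the bounded rates multiply a pairing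
  that tends to zero.\<close>

lemma flip_pairing_tendsto:
  assumes \<beta>: "\<forall>\<^sub>F i in F. \<beta> i \<in> measures_V" "\<gamma> \<in> measures_V"
    and w: "\<forall>\<^sub>F i in F. w i \<in> continuous_V" "w' \<in> continuous_V"
    and C: "\<forall>\<^sub>F i in F. \<forall>v\<in>V. \<bar>w i v\<bar> \<le> C"
    and one: "((\<lambda>i. mass (\<beta> i)) \<longlongrightarrow> mass \<gamma>) F"
    and spin: "((\<lambda>i. pairing (\<beta> i) spin) \<longlongrightarrow> pairing \<gamma> spin) F"
    and part: "\<And>\<tau>. \<tau> \<in> spins \<Longrightarrow>
      ((\<lambda>i. pairing (\<beta> i) (spin_part \<tau> (w i))) \<longlongrightarrow> pairing \<gamma> (spin_part \<tau> w')) F"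
  shows "((\<lambda>i. flip_pairing (\<beta> i) (w i)) \<longlongrightarrow> flip_pairing \<gamma> w') F"
proof (cases "mass \<gamma> = 0")
  case True
  have "\<forall>\<^sub>F i in F. norm (flip_pairing (\<beta> i) (w i)) \<le> b * C * mass (\<beta> i)"
    using \<beta>(1) w(1) C by eventually_elim (use flip_pairing_abs_le in auto)
  moreover have "((\<lambda>i. b * C * mass (\<beta> i)) \<longlongrightarrow> 0) F"
    using tendsto_mult_left[OF one, of "b * C"] True by simp
  ultimately have "((\<lambda>i. flip_pairing (\<beta> i) (w i)) \<longlongrightarrow> 0) F"
    by (rule Lim_null_comparison)
  moreover obtain C' where "\<And>v. v \<in> V \<Longrightarrow> \<bar>w' v\<bar> \<le> C'"
    using continuous_V_bounded[OF w(2)] by blast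
  then have "flip_pairing \<gamma> w' = 0"
    using flip_pairing_abs_le[OF \<beta>(2) w(2), of C'] True by simp
  ultimately show ?thesis by simp
next
  case False
  have m: "((\<lambda>i. magnetization (\<beta> i)) \<longlongrightarrow> magnetization \<gamma>) F"
    unfolding magnetization_def by (intro tendsto_divide one spin False)
  have "((\<lambda>i. c \<tau> (magnetization (\<beta> i))) \<longlongrightarrow> c \<tau> (magnetization \<gamma>)) F" if "\<tau> \<in> spins" for \<tau>
    using c_continuous[OF that] m magnetization_mem[OF \<beta>(2)]
  proof (rule continuous_on_tendsto_compose)
    show "\<forall>\<^sub>F i in F. magnetization (\<beta> i) \<in> {-1..1}"
      using \<beta>(1) by eventually_elim (rule magnetization_mem)
  qed
  then have "((\<lambda>i. \<Sum>\<tau>\<in>spins. c \<tau> (magnetization (\<beta> i)) * pairing (\<beta> i) (spin_part \<tau> (w i))) \<longlongrightarrow>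
      (\<Sum>\<tau>\<in>spins. c \<tau> (magnetization \<gamma>) * pairing \<gamma> (spin_part \<tau> w'))) F"
    using part by (intro tendsto_intros)
  moreover have "\<forall>\<^sub>F i in F. (\<Sum>\<tau>\<in>spins. c \<tau> (magnetization (\<beta> i)) * pairing (\<beta> i) (spin_part \<tau> (w i)))
      = flip_pairing (\<beta> i) (w i)"
    using \<beta>(1) w(1) by eventually_elim (simp add: flip_pairing_eq)
  ultimately show ?thesis
    unfolding flip_pairing_eq[OF \<beta>(2) w(2)] by (rule Lim_transform_eventually)
qed

end

section \<open>Lower semicontinuity in the Skorokhod topology\<close>

lemma eventually_at_within_mem: "\<forall>\<^sub>F x in at a within S. x \<in> S"
  by (simp add: eventually_at_filter)

lemma continuous_TV_eventually_uniform:
  assumes "u \<in> continuous_TV T" "s \<in> {0..T}" "e > 0"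
  shows "\<forall>\<^sub>F t in at s within {s..T}. \<forall>v\<in>V. \<bar>u t v - u s v\<bar> \<le> e"
proof -
  obtain d where d: "d > 0"
    "\<And>s t v. s \<in> {0..T} \<Longrightarrow> t \<in> {0..T} \<Longrightarrow> \<bar>s - t\<bar> < d \<Longrightarrow> v \<in> V \<Longrightarrow> \<bar>u s v - u t v\<bar> \<le> e"
    using continuous_TV_uniform[OF assms(1,3)] by metis
  show ?thesis unfolding eventually_at dist_real_def
    using d(1) d(2)[OF _ assms(2)] assms(2) by (intro exI[of _ d]) auto
qed

lemma skorokhod_right_tendsto:
  assumes "\<alpha> \<in> skorokhod_space T" "\<phi> \<in> continuous_V" "T > 0" "s \<in> {0..T}"
  shows "((\<lambda>t. pairing (\<alpha> t) \<phi>) \<longlongrightarrow> pairing (\<alpha> s) \<phi>) (at s within {s..T})"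
  using skorokhod_right_continuous[OF assms(1-3)] assms(4) by (auto simp: right_continuous_def continuous_within)

lemma right_continuous_pairing:
  assumes \<alpha>: "\<alpha> \<in> skorokhod_space T" and u: "u \<in> continuous_TV T" and T: "T > 0"
  shows "right_continuous T (\<lambda>t. pairing (\<alpha> t) (u t))"
  unfolding right_continuous_def
proof
  fix s assume s: "s \<in> {0..T}"
  have ev: "\<forall>\<^sub>F t in at s within {s..T}. t \<in> {0..T}"
    using eventually_at_within_mem by (rule eventually_mono) (use s in auto)
  note lim = skorokhod_right_tendsto[OF \<alpha> _ T s]
  show "continuous (at s within {s..T}) (\<lambda>t. pairing (\<alpha> t) (u t))"
    unfolding continuous_within
  proof (rule pairing_tendsto_uniform[OF _ _ _ lim[OF const_continuous_V]
        lim[OF continuous_TV_slice[OF u s]]])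
    show "\<forall>\<^sub>F t in at s within {s..T}. \<alpha> t \<in> measures_V"
      using ev by eventually_elim (rule skorokhod_space_measures[OF \<alpha>])
    show "\<forall>\<^sub>F t in at s within {s..T}. u t \<in> continuous_V"
      using ev by eventually_elim (rule continuous_TV_slice[OF u])
  qed (use continuous_TV_slice[OF u s] continuous_TV_eventually_uniform[OF u s] in simp_all)
qed

text \<open>Dominated convergence. Right continuity supplies measurability, and the countable set
  \<open>N\<close> is a Lebesgue null set, so the jump times of a limit path may be left
  out.\<close>

lemma LBINT_tendsto_of_right_continuous:
  fixes a :: "nat \<Rightarrow> real \<Rightarrow> real"
  assumes T: "T > 0" and a: "\<And>n. right_continuous T (a n)" "right_continuous T l"
    and B: "\<And>n t. t \<in> {0..T} \<Longrightarrow> \<bar>a n t\<bar> \<le> B"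
    and N: "countable N" "\<And>t. t \<in> {0..T} \<Longrightarrow> t \<notin> N \<Longrightarrow> (\<lambda>n. a n t) \<longlonglongrightarrow> l t"
  shows "(\<lambda>n. LBINT t:{0..T}. a n t) \<longlonglongrightarrow> (LBINT t:{0..T}. l t)"
  unfolding set_lebesgue_integral_def
proof (rule integral_dominated_convergence)
  show "(\<lambda>t. indicator {0..T} t *\<^sub>R l t) \<in> borel_measurable lborel"
    using right_continuous_measurable[OF T a(2)] by simp
  show "(\<lambda>t. indicator {0..T} t *\<^sub>R a n t) \<in> borel_measurable lborel" for n
    using right_continuous_measurable[OF T a(1)] by simp
  show "integrable lborel (\<lambda>t. indicator {0..T} t *\<^sub>R B)"
    by (rule integrable_scaleR_left) (simp add: integrable_indicator_iff emeasure_lborel_Icc_eq)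
  have "AE t in lborel. t \<notin> N"
    using countable_imp_null_set_lborel[OF N(1)] by (rule AE_not_in)
  then show "AE t in lborel. (\<lambda>n. indicator {0..T} t *\<^sub>R a n t) \<longlonglongrightarrow> indicator {0..T} t *\<^sub>R l t"
    by eventually_elim (use N(2) in \<open>auto simp: indicator_def\<close>)
  show "AE t in lborel. norm (indicator {0..T} t *\<^sub>R a n t) \<le> indicator {0..T} t *\<^sub>R B" for n
    using B by (auto simp: indicator_def)
qed

section \<open>Time changes and sequences in the Skorokhod topology\<close>

lemma time_change_endpoints:
  assumes "\<theta> \<in> time_changes T" "T > 0"
  shows "\<theta> 0 = 0" "\<theta> T = T"
proof -
  have mono: "\<And>s t. s \<in> {0..T} \<Longrightarrow> t \<in> {0..T} \<Longrightarrow> s < t \<Longrightarrow> \<theta> s < \<theta> t"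
    and im: "\<theta> ` {0..T} = {0..T}"
    using assms(1) by (auto simp: time_changes_def strict_mono_on_def)
  have mem: "\<theta> s \<in> {0..T}" if "s \<in> {0..T}" for s using im that by blast
  obtain s where s: "s \<in> {0..T}" "\<theta> s = 0" using im assms(2) by (metis atLeastAtMost_iff imageE less_imp_le order_refl)
  have "s = 0" using mono[of 0 s] mem[of 0] s assms(2) by force
  with s show "\<theta> 0 = 0" by simp
  obtain s where s: "s \<in> {0..T}" "\<theta> s = T" using im assms(2) by (metis atLeastAtMost_iff imageE less_imp_le order_refl)
  have "s = T" using mono[of s T] mem[of T] s assms(2) by force
  with s show "\<theta> T = T" by simp
qed

text \<open>The time change is inverted: \<open>s\<close> is the preimage of \<open>t\<close>. An
  increasing bijection of the interval fixes both endpoints, so at times 0 and \<open>T\<close> the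
  pairings are compared without a shift.\<close>

lemma skorokhod_ball_time_shift:
  assumes "\<beta> \<in> skorokhod_ball T \<alpha> F e" "T > 0" "t \<in> {0..T}"
  obtains s where "s \<in> {0..T}" "\<bar>t - s\<bar> < e" "\<And>\<phi>. \<phi> \<in> F \<Longrightarrow> \<bar>pairing (\<beta> t) \<phi> - pairing (\<alpha> s) \<phi>\<bar> < e"
    "t = 0 \<or> t = T \<Longrightarrow> s = t"
proof -
  obtain \<theta> where \<theta>: "\<theta> \<in> time_changes T" "\<And>t. t \<in> {0..T} \<Longrightarrow> \<bar>\<theta> t - t\<bar> < e"
    "\<And>t \<phi>. t \<in> {0..T} \<Longrightarrow> \<phi> \<in> F \<Longrightarrow> \<bar>pairing (\<beta> (\<theta> t)) \<phi> - pairing (\<alpha> t) \<phi>\<bar> < e"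
    using assms(1) unfolding skorokhod_ball_def by blast
  have im: "\<theta> ` {0..T} = {0..T}" and inj: "inj_on \<theta> {0..T}"
    using \<theta>(1) strict_mono_on_imp_inj_on by (auto simp: time_changes_def)
  obtain s where s: "s \<in> {0..T}" "\<theta> s = t" using im assms(3) by (metis imageE)
  have "s = t" if "t = 0 \<or> t = T"
    using inj_onD[OF inj, of s t] time_change_endpoints[OF \<theta>(1) assms(2)] that s assms(3) by auto
  then show thesis
    using \<theta>(2)[OF s(1)] \<theta>(3)[OF s(1)] s by (intro that[of s]) (auto simp: s(2))
qed

text \<open>The balls need not be open: a supremum of differences below \<open>e\<close> may equal \<open>e\<close>.\<close>

lemma skorokhod_ball_interior:
  assumes "\<alpha> \<in> skorokhod_space T" "finite F" "F \<subseteq> continuous_V" "e > 0" "T > 0"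
  obtains U where "openin (skorokhod_topology T) U" "\<alpha> \<in> U" "U \<subseteq> skorokhod_ball T \<alpha> F e"
proof -
  define U where "U = {\<beta>. \<exists>d<e. \<beta> \<in> skorokhod_ball T \<alpha> F d}"
  have "\<alpha> \<in> skorokhod_ball T \<alpha> F (e / 2)"
    unfolding skorokhod_ball_def using assms
    by (auto intro!: bexI[of _ "\<lambda>t. t"] simp: time_changes_def strict_mono_on_def)
  then have "\<alpha> \<in> U" using \<open>e > 0\<close> unfolding U_def by (auto intro!: exI[of _ "e / 2"])
  moreover have "U \<subseteq> skorokhod_ball T \<alpha> F e"
    using skorokhod_ball_mono[OF subset_refl] unfolding U_def by (blast intro: less_imp_le)
  moreover have "skorokhod_open T U"
    unfolding skorokhod_open_def
  proof (intro conjI ballI)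
    show "U \<subseteq> skorokhod_space T" by (auto simp: U_def skorokhod_ball_def)
    fix \<beta> assume "\<beta> \<in> U"
    then obtain d \<theta> where d: "d < e" and \<theta>: "\<theta> \<in> time_changes T" "\<And>t. t \<in> {0..T} \<Longrightarrow> \<bar>\<theta> t - t\<bar> < d"
      "\<And>t \<phi>. t \<in> {0..T} \<Longrightarrow> \<phi> \<in> F \<Longrightarrow> \<bar>pairing (\<beta> (\<theta> t)) \<phi> - pairing (\<alpha> t) \<phi>\<bar> < d"
      unfolding U_def skorokhod_ball_def by blast
    \<comment> \<open>Half of the slack: composing the time changes adds the radii, and
      \<open>d + d'\<close> is still below \<open>e\<close>.\<close>
    define d' where "d' = (e - d) / 2"
    have "skorokhod_ball T \<beta> F d' \<subseteq> skorokhod_ball T \<alpha> F (d + d')"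
    proof
      fix \<gamma> assume "\<gamma> \<in> skorokhod_ball T \<beta> F d'"
      then obtain \<theta>' where \<gamma>: "\<gamma> \<in> skorokhod_space T" and \<theta>': "\<theta>' \<in> time_changes T"
        "\<And>t. t \<in> {0..T} \<Longrightarrow> \<bar>\<theta>' t - t\<bar> < d'"
        "\<And>t \<phi>. t \<in> {0..T} \<Longrightarrow> \<phi> \<in> F \<Longrightarrow> \<bar>pairing (\<gamma> (\<theta>' t)) \<phi> - pairing (\<beta> t) \<phi>\<bar> < d'"
        unfolding skorokhod_ball_def by blast
      have mem: "\<theta> t \<in> {0..T}" if "t \<in> {0..T}" for t
        using \<theta>(1) that by (auto simp: time_changes_def)
      have "(\<theta>' \<circ> \<theta>) ` {0..T} = \<theta>' ` (\<theta> ` {0..T})"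
        by (rule image_comp[symmetric])
      then have "\<theta>' \<circ> \<theta> \<in> time_changes T"
        using \<theta>(1) \<theta>'(1) mem unfolding time_changes_def strict_mono_on_def by simp
      moreover have "\<bar>(\<theta>' \<circ> \<theta>) t - t\<bar> < d + d'" if "t \<in> {0..T}" for t
        using \<theta>(2)[OF that] \<theta>'(2)[OF mem[OF that]] by simp
      moreover have "\<bar>pairing (\<gamma> ((\<theta>' \<circ> \<theta>) t)) \<phi> - pairing (\<alpha> t) \<phi>\<bar> < d + d'"
        if "t \<in> {0..T}" "\<phi> \<in> F" for t \<phi>
        using \<theta>(3)[OF that] \<theta>'(3)[OF mem[OF that(1)] that(2)] by simp
      ultimately show "\<gamma> \<in> skorokhod_ball T \<alpha> F (d + d')"
        unfolding skorokhod_ball_def using \<gamma> by blast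
    qed
    also have "\<dots> \<subseteq> U" using d unfolding U_def d'_def by (auto intro!: exI[of _ "d + (e - d) / 2"] simp: field_simps)
    finally show "\<exists>F e. finite F \<and> F \<subseteq> continuous_V \<and> e > 0 \<and> skorokhod_ball T \<beta> F e \<subseteq> U"
      using assms d by (intro exI[of _ F] exI[of _ d']) (auto simp: d'_def)
  qed
  ultimately show thesis using that by (simp add: openin_skorokhod_topology)
qed

text \<open>The counterexamples \<open>\<beta> n\<close> are taken from balls whose finite families
  exhaust \<open>\<Phi>\<close> and whose radii shrink. Such a path at time \<open>t\<close> is
  close to \<open>\<alpha>\<close> at a nearby time \<open>s n t\<close>. This gives convergence
  wherever the pairing along \<open>\<alpha>\<close> is continuous, and at the endpoints, where time
  is not shifted at all.\<close>

lemma skorokhod_sequence: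
  assumes \<alpha>: "\<alpha> \<in> skorokhod_space T" and T: "T > 0"
    and \<Phi>: "countable \<Phi>" "\<Phi> \<subseteq> continuous_V"
    and no: "\<forall>F e. finite F \<and> F \<subseteq> continuous_V \<and> e > 0 \<longrightarrow> (\<exists>\<beta>\<in>skorokhod_ball T \<alpha> F e. \<not> P \<beta>)"
  obtains \<beta> where "\<And>n. \<beta> n \<in> skorokhod_space T" "\<And>n. \<not> P (\<beta> n)"
    "\<And>n t. t \<in> {0..T} \<Longrightarrow> \<exists>s\<in>{0..T}. \<bar>mass (\<beta> n t) - mass (\<alpha> s)\<bar> < 1"
    "\<And>\<psi> t. \<psi> \<in> \<Phi> \<Longrightarrow> t \<in> {0..T} \<Longrightarrow> t = 0 \<or> t = T \<or> continuous (at t within {0..T}) (\<lambda>s. pairing (\<alpha> s) \<psi>)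
      \<Longrightarrow> (\<lambda>n. pairing (\<beta> n t) \<psi>) \<longlonglongrightarrow> pairing (\<alpha> t) \<psi>"
proof -
  \<comment> \<open>Adding the constant 1 makes the enumerated set nonempty, as
    \<open>from_nat_into\<close> requires.\<close>
  define f where "f = from_nat_into (insert (\<lambda>_. 1) \<Phi>)"
  have f: "f n \<in> continuous_V" for n
    using from_nat_into[of "insert (\<lambda>_. 1) \<Phi>" n] \<Phi>(2) by (auto simp: f_def)
  \<comment> \<open>The constant 1 belongs to every \<open>F n\<close>, so the masses are controlled
    for all \<open>n\<close> and not just eventually.\<close>
  define F where "F n = insert (\<lambda>_. 1) (f ` {..n})" for n
  have F: "finite (F n)" "F n \<subseteq> continuous_V" for n using f by (auto simp: F_def)
  have "\<exists>\<beta>\<in>skorokhod_ball T \<alpha> (F n) (inverse (real (Suc n))). \<not> P \<beta>" for n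
    using F no by simp
  then obtain \<beta> where \<beta>: "\<And>n. \<beta> n \<in> skorokhod_ball T \<alpha> (F n) (inverse (real (Suc n)))" "\<And>n. \<not> P (\<beta> n)"
    by metis
  \<comment> \<open>The time \<open>s\<close> is chosen once for each \<open>n\<close> and
    \<open>t\<close>; it serves all test functions in \<open>F n\<close> simultaneously.\<close>
  define Q where "Q n t s \<longleftrightarrow> s \<in> {0..T} \<and> \<bar>t - s\<bar> < inverse (real (Suc n)) \<and> (t = 0 \<or> t = T \<longrightarrow> s = t) \<and>
      (\<forall>\<phi>\<in>F n. \<bar>pairing (\<beta> n t) \<phi> - pairing (\<alpha> s) \<phi>\<bar> < inverse (real (Suc n)))" for n t s
  have Q: "\<exists>s. Q n t s" if "t \<in> {0..T}" for n t
    unfolding Q_def by (rule skorokhod_ball_time_shift[OF \<beta>(1) T that]) blast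
  define s where "s n t = (SOME s. Q n t s)" for n t
  have "Q n t (s n t)" if "t \<in> {0..T}" for n t
    using someI_ex[OF Q[OF that]] by (simp add: s_def)
  then have s: "\<And>n t. t \<in> {0..T} \<Longrightarrow> s n t \<in> {0..T}"
    "\<And>n t. t \<in> {0..T} \<Longrightarrow> \<bar>t - s n t\<bar> < inverse (real (Suc n))"
    "\<And>n t. t \<in> {0..T} \<Longrightarrow> t = 0 \<or> t = T \<Longrightarrow> s n t = t"
    "\<And>n t \<phi>. t \<in> {0..T} \<Longrightarrow> \<phi> \<in> F n \<Longrightarrow> \<bar>pairing (\<beta> n t) \<phi> - pairing (\<alpha> (s n t)) \<phi>\<bar> < inverse (real (Suc n))"
    unfolding Q_def by blast+
  show thesis
  proof (rule that[of \<beta>])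
    show "\<beta> n \<in> skorokhod_space T" for n using \<beta>(1)[of n] by (simp add: skorokhod_ball_def)
    show "\<not> P (\<beta> n)" for n by (rule \<beta>(2))
    show "\<exists>s\<in>{0..T}. \<bar>mass (\<beta> n t) - mass (\<alpha> s)\<bar> < 1" if "t \<in> {0..T}" for n t
    proof (rule bexI[OF _ s(1)[OF that]])
      have "\<bar>mass (\<beta> n t) - mass (\<alpha> (s n t))\<bar> < inverse (real (Suc n))"
        by (intro s(4) that) (simp add: F_def)
      also have "\<dots> \<le> 1" by (simp add: inverse_eq_divide)
      finally show "\<bar>mass (\<beta> n t) - mass (\<alpha> (s n t))\<bar> < 1" .
    qed
    fix \<psi> t assume \<psi>: "\<psi> \<in> \<Phi>" and t: "t \<in> {0..T}"
      and cont: "t = 0 \<or> t = T \<or> continuous (at t within {0..T}) (\<lambda>s. pairing (\<alpha> s) \<psi>)"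
    obtain k where k: "f k = \<psi>"
      using from_nat_into_surj[of "insert (\<lambda>_. 1) \<Phi>" \<psi>] \<Phi>(1) \<psi> by (auto simp: f_def)
    have "(\<lambda>n. s n t) \<longlonglongrightarrow> t"
      by (rule LIM_zero_cancel[OF LIMSEQ_norm_0])
        (use s(2)[OF t] in \<open>simp add: abs_minus_commute inverse_eq_divide\<close>)
    then have "(\<lambda>n. pairing (\<alpha> (s n t)) \<psi>) \<longlonglongrightarrow> pairing (\<alpha> t) \<psi>"
      using cont continuous_within_tendsto_compose'[of t "{0..T}" "\<lambda>s. pairing (\<alpha> s) \<psi>" "\<lambda>n. s n t"]
        s(1,3)[OF t] by auto
    moreover have "(\<lambda>n. pairing (\<beta> n t) \<psi> - pairing (\<alpha> (s n t)) \<psi>) \<longlonglongrightarrow> 0"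
    proof (rule Lim_null_comparison[OF _ LIMSEQ_inverse_real_of_nat])
      show "\<forall>\<^sub>F n in sequentially. norm (pairing (\<beta> n t) \<psi> - pairing (\<alpha> (s n t)) \<psi>) \<le> inverse (real (Suc n))"
        using eventually_ge_at_top[of k]
      proof eventually_elim
        case (elim n)
        then have "\<psi> \<in> F n" using k by (auto simp: F_def)
        then show ?case using s(4)[OF t] by (auto intro: less_imp_le)
      qed
    qed
    ultimately show "(\<lambda>n. pairing (\<beta> n t) \<psi>) \<longlonglongrightarrow> pairing (\<alpha> t) \<psi>"
      using tendsto_add by fastforce
  qed
qed

context flip_rates
begin

lemma right_continuous_flip_pairing:
  assumes \<alpha>: "\<alpha> \<in> skorokhod_space T" and w: "w \<in> continuous_TV T" and T: "T > 0"
  shows "right_continuous T (\<lambda>t. flip_pairing (\<alpha> t) (w t))"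
  unfolding right_continuous_def
proof
  fix s assume s: "s \<in> {0..T}"
  have ev: "\<forall>\<^sub>F t in at s within {s..T}. t \<in> {0..T}"
    using eventually_at_within_mem by (rule eventually_mono) (use s in auto)
  note lim = skorokhod_right_tendsto[OF \<alpha> _ T s]
  obtain C where C: "\<And>t x \<sigma>. t \<in> {0..T} \<Longrightarrow> x \<in> {-1..2} \<Longrightarrow> \<sigma> \<in> spins \<Longrightarrow> \<bar>w t (x, \<sigma>)\<bar> \<le> C"
    using continuous_TV_bounded[OF w] by metis
  show "continuous (at s within {s..T}) (\<lambda>t. flip_pairing (\<alpha> t) (w t))"
    unfolding continuous_within
  proof (rule flip_pairing_tendsto[OF _ _ _ _ _ lim[OF const_continuous_V] lim[OF spin_continuous_V]])
    show "\<forall>\<^sub>F t in at s within {s..T}. \<alpha> t \<in> measures_V"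
      using ev by eventually_elim (rule skorokhod_space_measures[OF \<alpha>])
    show "\<alpha> s \<in> measures_V" by (rule skorokhod_space_measures[OF \<alpha> s])
    show "\<forall>\<^sub>F t in at s within {s..T}. w t \<in> continuous_V"
      using ev by eventually_elim (rule continuous_TV_slice[OF w])
    show "w s \<in> continuous_V" by (rule continuous_TV_slice[OF w s])
    show "\<forall>\<^sub>F t in at s within {s..T}. \<forall>v\<in>V. \<bar>w t v\<bar> \<le> C"
      using ev by eventually_elim (auto simp: V_def intro!: C)
    show "((\<lambda>t. pairing (\<alpha> t) (spin_part \<tau> (w t))) \<longlongrightarrow> pairing (\<alpha> s) (spin_part \<tau> (w s))) (at s within {s..T})" for \<tau>
      using right_continuous_pairing[OF \<alpha> spin_part_continuous_TV[OF w] T] s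
      unfolding right_continuous_def continuous_within by blast
  qed
qed

text \<open>For \<open>\<phi>\<^sub>0 = \<phi> - G 0\<close>, \<open>\<phi>\<^sub>T = G T\<close>,
  \<open>u = transport T G\<close> and \<open>w = flip_weight G\<close> this is the pairing of the
  initial measure with \<open>\<phi>\<close> plus the functional maximised in
  \<open>rate_transport\<close>. The four functions are kept independent because semicontinuity
  rests on their continuity alone.\<close>

definition path_functional where
  "path_functional T \<phi>\<^sub>0 \<phi>\<^sub>T u w \<alpha> = pairing (\<alpha> 0) \<phi>\<^sub>0 + pairing (\<alpha> T) \<phi>\<^sub>T
     - (LBINT t:{0..T}. pairing (\<alpha> t) (u t)) - (LBINT t:{0..T}. flip_pairing (\<alpha> t) (w t))"

lemma continuous_TV_rational_dense:
  assumes "u \<in> continuous_TV T" "T > 0" "t \<in> {0..T}" "e > 0"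
  obtains s where "s \<in> \<rat> \<inter> {0..T}" "\<And>v. v \<in> V \<Longrightarrow> \<bar>u s v - u t v\<bar> \<le> e"
proof -
  obtain d where d: "d > 0"
    "\<And>s t v. s \<in> {0..T} \<Longrightarrow> t \<in> {0..T} \<Longrightarrow> \<bar>s - t\<bar> < d \<Longrightarrow> v \<in> V \<Longrightarrow> \<bar>u s v - u t v\<bar> \<le> e"
    using continuous_TV_uniform[OF assms(1,4)] by metis
  have "max 0 (t - d) < min T (t + d)" using assms d(1) by auto
  then obtain s where "s \<in> \<rat>" "max 0 (t - d) < s" "s < min T (t + d)"
    using Rats_dense_in_real by blast
  then show thesis using d(2)[of s t] assms(3) by (intro that[of s]) auto
qed

text \<open>Along the extracted sequence the functional even converges, by dominated convergence in
  both time integrals. The bound on the mass provides the domination; it is part of the conclusion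
  because it later limits the number of particles.\<close>

lemma path_functional_lower_semicontinuous:
  assumes \<alpha>: "\<alpha> \<in> skorokhod_space T" and T: "T > 0"
    and \<phi>: "\<phi>\<^sub>0 \<in> continuous_V" "\<phi>\<^sub>T \<in> continuous_V"
    and u: "u \<in> continuous_TV T" and w: "w \<in> continuous_TV T"
    and r: "r < path_functional T \<phi>\<^sub>0 \<phi>\<^sub>T u w \<alpha>"
  obtains U B where "openin (skorokhod_topology T) U" "\<alpha> \<in> U" "U \<subseteq> skorokhod_space T"
    "\<And>\<beta>. \<beta> \<in> U \<Longrightarrow> r < path_functional T \<phi>\<^sub>0 \<phi>\<^sub>T u w \<beta>"
    "\<And>\<beta> t. \<beta> \<in> U \<Longrightarrow> t \<in> {0..T} \<Longrightarrow> mass (\<beta> t) \<le> B"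
proof -
  obtain B where B: "\<And>t. t \<in> {0..T} \<Longrightarrow> \<bar>mass (\<alpha> t)\<bar> \<le> B"
    using skorokhod_bounded[OF \<alpha> const_continuous_V T] by blast
  \<comment> \<open>Both properties of the neighbourhood are combined, so that one sequence of
    counterexamples treats them together. The bound \<open>B + 1\<close> cannot fail, since the
    balls move the mass by less than 1.\<close>
  define P where "P \<beta> \<longleftrightarrow> r < path_functional T \<phi>\<^sub>0 \<phi>\<^sub>T u w \<beta> \<and>
    (\<forall>t\<in>{0..T}. mass (\<beta> t) \<le> B + 1)" for \<beta>
  define D where "D = \<rat> \<inter> {0..T}"
  \<comment> \<open>The constant 1 and \<open>spin\<close> give convergence of the magnetization;
    the spin parts of \<open>w\<close> are listed separately because the flip rate is a scalar only
    on each spin component.\<close>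
  define \<Phi> where "\<Phi> = {\<phi>\<^sub>0, \<phi>\<^sub>T, \<lambda>_. 1, spin} \<union> u ` D \<union> (\<lambda>s. spin_part 1 (w s)) ` D \<union> (\<lambda>s. spin_part (-1) (w s)) ` D"
  have "countable D" unfolding D_def using countable_rat by blast
  then have \<Phi>c: "countable \<Phi>" by (auto simp: \<Phi>_def)
  have \<Phi>: "\<Phi> \<subseteq> continuous_V"
    using \<phi> spin_continuous_V continuous_TV_slice[OF u] continuous_TV_slice[OF w]
    by (auto simp: \<Phi>_def D_def intro!: spin_part_continuous_V)
  have "\<exists>F e. finite F \<and> F \<subseteq> continuous_V \<and> e > 0 \<and> (\<forall>\<beta>\<in>skorokhod_ball T \<alpha> F e. P \<beta>)"
  proof (rule ccontr)
    assume "\<not> ?thesis"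
    then have no: "\<forall>F e. finite F \<and> F \<subseteq> continuous_V \<and> e > 0 \<longrightarrow> (\<exists>\<beta>\<in>skorokhod_ball T \<alpha> F e. \<not> P \<beta>)"
      by blast
    obtain \<beta> where \<beta>: "\<And>n. \<beta> n \<in> skorokhod_space T" "\<And>n. \<not> P (\<beta> n)"
      "\<And>n t. t \<in> {0..T} \<Longrightarrow> \<exists>s\<in>{0..T}. \<bar>mass (\<beta> n t) - mass (\<alpha> s)\<bar> < 1"
      "\<And>\<psi> t. \<psi> \<in> \<Phi> \<Longrightarrow> t \<in> {0..T} \<Longrightarrow> t = 0 \<or> t = T \<or> continuous (at t within {0..T}) (\<lambda>s. pairing (\<alpha> s) \<psi>)
        \<Longrightarrow> (\<lambda>n. pairing (\<beta> n t) \<psi>) \<longlonglongrightarrow> pairing (\<alpha> t) \<psi>"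
      by (rule skorokhod_sequence[OF \<alpha> T \<Phi>c \<Phi> no]) (rule that)
    have mass: "mass (\<beta> n t) \<le> B + 1" if "t \<in> {0..T}" for n t
      using \<beta>(3)[OF that, of n] B by force
    define N where "N = (\<Union>\<psi>\<in>\<Phi>. {t \<in> {0..T}. \<not> continuous (at t within {0..T}) (\<lambda>s. pairing (\<alpha> s) \<psi>)})"
    have N: "countable N"
      unfolding N_def using \<Phi>c skorokhod_countable_discontinuities[OF \<alpha> _ T] \<Phi>
      by (intro countable_UN) auto
    have \<beta>m: "\<beta> n t \<in> measures_V" if "t \<in> {0..T}" for n t
      using skorokhod_space_measures[OF \<beta>(1) that] .
    have lim: "(\<lambda>n. pairing (\<beta> n t) \<psi>) \<longlonglongrightarrow> pairing (\<alpha> t) \<psi>" if "\<psi> \<in> \<Phi>" "t \<in> {0..T}" "t \<notin> N" for \<psi> t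
      using that by (intro \<beta>(4)) (auto simp: N_def)
    have dense: "(\<lambda>n. pairing (\<beta> n t) (x t)) \<longlonglongrightarrow> pairing (\<alpha> t) (x t)"
      if x: "x \<in> continuous_TV T" "x ` D \<subseteq> \<Phi>" and t: "t \<in> {0..T}" "t \<notin> N" for x t
    proof (rule pairing_tendsto_dense)
      show "\<forall>\<^sub>F n in sequentially. \<beta> n t \<in> measures_V" using \<beta>m[OF t(1)] by simp
      show "\<alpha> t \<in> measures_V" using skorokhod_space_measures[OF \<alpha> t(1)] .
      show "x t \<in> continuous_V" using continuous_TV_slice[OF x(1) t(1)] .
      show "(\<lambda>n. mass (\<beta> n t)) \<longlonglongrightarrow> mass (\<alpha> t)"
        using t by (intro lim) (auto simp: \<Phi>_def)
      fix e :: real assume "e > 0"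
      obtain s where s: "s \<in> D" "\<And>v. v \<in> V \<Longrightarrow> \<bar>x s v - x t v\<bar> \<le> e"
        using continuous_TV_rational_dense[OF x(1) T t(1) \<open>e > 0\<close>] unfolding D_def by blast
      show "\<exists>\<psi>\<in>continuous_V. (\<forall>v\<in>V. \<bar>\<psi> v - x t v\<bar> \<le> e) \<and>
          (\<lambda>n. pairing (\<beta> n t) \<psi>) \<longlonglongrightarrow> pairing (\<alpha> t) \<psi>"
        using s x \<Phi> lim[OF _ t] by (intro bexI[of _ "x s"]) auto
    qed
    obtain Cu where Cu: "Cu \<ge> 0" "\<forall>\<beta>\<in>measures_V. \<forall>t\<in>{0..T}. \<bar>pairing \<beta> (u t)\<bar> \<le> Cu * mass \<beta>"
      by (rule pairing_TV_abs_le[OF u])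
    obtain Cw where Cw: "Cw \<ge> 0" "\<forall>\<beta>\<in>measures_V. \<forall>t\<in>{0..T}. \<bar>flip_pairing \<beta> (w t)\<bar> \<le> Cw * mass \<beta>"
      by (rule flip_pairing_TV_abs_le[OF w])
    have 1: "(\<lambda>n. LBINT t:{0..T}. pairing (\<beta> n t) (u t)) \<longlonglongrightarrow> (LBINT t:{0..T}. pairing (\<alpha> t) (u t))"
    proof (rule LBINT_tendsto_of_right_continuous[OF T _ _ _ N])
      show "right_continuous T (\<lambda>t. pairing (\<beta> n t) (u t))" for n
        by (rule right_continuous_pairing[OF \<beta>(1) u T])
      show "right_continuous T (\<lambda>t. pairing (\<alpha> t) (u t))"
        by (rule right_continuous_pairing[OF \<alpha> u T])
      show "\<bar>pairing (\<beta> n t) (u t)\<bar> \<le> Cu * (B + 1)" if "t \<in> {0..T}" for n t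
        using Cu(2) \<beta>m[OF that] that mult_left_mono[OF mass[OF that] Cu(1)] by (blast intro: order_trans)
      show "(\<lambda>n. pairing (\<beta> n t) (u t)) \<longlonglongrightarrow> pairing (\<alpha> t) (u t)" if "t \<in> {0..T}" "t \<notin> N" for t
        by (rule dense[OF u _ that]) (auto simp: \<Phi>_def)
    qed
    have 2: "(\<lambda>n. LBINT t:{0..T}. flip_pairing (\<beta> n t) (w t)) \<longlonglongrightarrow> (LBINT t:{0..T}. flip_pairing (\<alpha> t) (w t))"
    proof (rule LBINT_tendsto_of_right_continuous[OF T _ _ _ N])
      show "right_continuous T (\<lambda>t. flip_pairing (\<beta> n t) (w t))" for n
        by (rule right_continuous_flip_pairing[OF \<beta>(1) w T])
      show "right_continuous T (\<lambda>t. flip_pairing (\<alpha> t) (w t))"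
        by (rule right_continuous_flip_pairing[OF \<alpha> w T])
      show "\<bar>flip_pairing (\<beta> n t) (w t)\<bar> \<le> Cw * (B + 1)" if "t \<in> {0..T}" for n t
        using Cw(2) \<beta>m[OF that] that mult_left_mono[OF mass[OF that] Cw(1)] by (blast intro: order_trans)
      show "(\<lambda>n. flip_pairing (\<beta> n t) (w t)) \<longlonglongrightarrow> flip_pairing (\<alpha> t) (w t)" if t: "t \<in> {0..T}" "t \<notin> N" for t
      proof -
        obtain Cv where Cv: "\<And>v. v \<in> V \<Longrightarrow> \<bar>w t v\<bar> \<le> Cv"
          using continuous_V_bounded[OF continuous_TV_slice[OF w t(1)]] by blast
        show ?thesis
        proof (rule flip_pairing_tendsto)
        show "\<forall>\<^sub>F n in sequentially. \<beta> n t \<in> measures_V" using \<beta>m[OF t(1)] by simp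
        show "\<alpha> t \<in> measures_V" using skorokhod_space_measures[OF \<alpha> t(1)] .
        show "w t \<in> continuous_V" using continuous_TV_slice[OF w t(1)] .
        then show "\<forall>\<^sub>F n in sequentially. w t \<in> continuous_V" by simp
        show "\<forall>\<^sub>F n in sequentially. \<forall>v\<in>V. \<bar>w t v\<bar> \<le> Cv" using Cv by (intro always_eventually) simp
        show "(\<lambda>n. mass (\<beta> n t)) \<longlonglongrightarrow> mass (\<alpha> t)"
          "(\<lambda>n. pairing (\<beta> n t) spin) \<longlonglongrightarrow> pairing (\<alpha> t) spin"
          using t by (intro lim; auto simp: \<Phi>_def)+
        show "(\<lambda>n. pairing (\<beta> n t) (spin_part \<tau> (w t))) \<longlonglongrightarrow> pairing (\<alpha> t) (spin_part \<tau> (w t))"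
          if "\<tau> \<in> spins" for \<tau>
          using that by (intro dense[OF spin_part_continuous_TV[OF w] _ t]) (auto simp: \<Phi>_def spins_cases)
        qed
      qed
    qed
    have "(\<lambda>n. path_functional T \<phi>\<^sub>0 \<phi>\<^sub>T u w (\<beta> n)) \<longlonglongrightarrow> path_functional T \<phi>\<^sub>0 \<phi>\<^sub>T u w \<alpha>"
      unfolding path_functional_def using T by (intro tendsto_intros 1 2 \<beta>(4)) (auto simp: \<Phi>_def)
    then have "\<forall>\<^sub>F n in sequentially. r < path_functional T \<phi>\<^sub>0 \<phi>\<^sub>T u w (\<beta> n)"
      using r by (rule order_tendstoD)
    then obtain n where "r < path_functional T \<phi>\<^sub>0 \<phi>\<^sub>T u w (\<beta> n)"
      using eventually_happens by (metis sequentially_bot)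
    then show False using \<beta>(2)[of n] mass by (auto simp: P_def)
  qed
  then obtain F e where F: "finite F" "F \<subseteq> continuous_V" "e > 0" "\<forall>\<beta>\<in>skorokhod_ball T \<alpha> F e. P \<beta>"
    by blast
  obtain U where U: "openin (skorokhod_topology T) U" "\<alpha> \<in> U" "U \<subseteq> skorokhod_ball T \<alpha> F e"
    using skorokhod_ball_interior[OF \<alpha> F(1-3) T] by blast
  show thesis
    using U F(4) by (intro that[of U "B + 1"]) (auto simp: P_def skorokhod_ball_def)
qed

end

section \<open>Exponential moments of the particle system\<close>

text \<open>Moves conserve the number of particles, so this finite set is closed under the dynamics,
  and every function is bounded on it.\<close>

definition configs_le :: "nat \<Rightarrow> nat \<Rightarrow> config set" where
  "configs_le N m = {\<xi> \<in> configs N. (\<Sum>v\<in>sites N. \<xi> v) \<le> m}"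

lemma finite_configs_le: "finite (configs_le N m)"
proof -
  have "configs_le N m = (\<Union>n\<in>{..m}. {\<xi> \<in> configs N. (\<Sum>v\<in>sites N. \<xi> v) = n})"
    by (auto simp: configs_le_def)
  then show ?thesis using finite_configs_mass by simp
qed

lemma move_configs_le:
  "\<xi> \<in> configs_le N m \<Longrightarrow> v \<in> sites N \<Longrightarrow> w \<in> sites N \<Longrightarrow> \<xi> v > 0 \<Longrightarrow> move \<xi> v w \<in> configs_le N m"
  by (simp add: configs_le_def sum_move move_configs)

lemma sites_jump: "(x, \<sigma>) \<in> sites N \<Longrightarrow> ((x + \<sigma>) mod int N, \<sigma>) \<in> sites N"
  and sites_flip: "(x, \<sigma>) \<in> sites N \<Longrightarrow> (x, -\<sigma>) \<in> sites N"
  by (auto simp: sites_def spins_def)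

lemma sites_spins: "(x, \<sigma>) \<in> sites N \<Longrightarrow> \<sigma> \<in> spins"
  by (simp add: sites_def)

lemma sites_div_mem: "(x, \<sigma>) \<in> sites N \<Longrightarrow> real_of_int x / real N \<in> {0..<1}"
  by (auto simp: sites_def divide_simps)

lemma sites_V: "(x, \<sigma>) \<in> sites N \<Longrightarrow> (real_of_int x / real N, \<sigma>) \<in> V"
  using sites_div_mem sites_spins by (force simp: V_def)

lemma sum_configs_le: "\<xi> \<in> configs_le N m \<Longrightarrow> (\<Sum>v\<in>sites N. real (\<xi> v)) \<le> real m"
  by (simp add: configs_le_def flip: of_nat_sum)

lemma generator_diff:
  "generator c N (\<lambda>\<xi>. f \<xi> - g \<xi>) \<xi> = generator c N f \<xi> - generator c N g \<xi>"
  unfolding generator_def case_prod_unfold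
  by (simp add: sum_subtractf[symmetric] algebra_simps sum.distrib[symmetric] sum_distrib_left)

lemma magnetization_N_mem: "magnetization_N N \<xi> \<in> {-1..1}"
proof -
  let ?m = "\<Sum>x\<in>{0..<int N}. real (\<xi> (x, 1)) - real (\<xi> (x, -1))"
  have s: "real (\<Sum>v\<in>sites N. \<xi> v) = (\<Sum>x\<in>{0..<int N}. real (\<xi> (x, 1)) + real (\<xi> (x, -1)))"
    using sum.cartesian_product[of "\<lambda>x \<sigma>. real (\<xi> (x, \<sigma>))" spins "{0..<int N}"]
    by (simp add: sites_def spins_def case_prod_unfold add.commute)
  have "\<bar>?m\<bar> \<le> (\<Sum>x\<in>{0..<int N}. \<bar>real (\<xi> (x, 1)) - real (\<xi> (x, -1))\<bar>)"
    by (rule sum_abs)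
  also have "\<dots> \<le> real (\<Sum>v\<in>sites N. \<xi> v)"
    unfolding s by (intro sum_mono) auto
  finally have "\<bar>?m\<bar> \<le> real (\<Sum>v\<in>sites N. \<xi> v)" .
  moreover have "\<bar>?m / s\<bar> \<le> 1" if "\<bar>?m\<bar> \<le> s" for s
    using that by (cases "s = 0") (auto simp: divide_le_eq_1)
  ultimately have "\<bar>?m / real (\<Sum>v\<in>sites N. \<xi> v)\<bar> \<le> 1" by blast
  then show ?thesis unfolding magnetization_N_def atLeastAtMost_iff by linarith
qed

text \<open>For negative \<open>y\<close> the bound combines \<open>exp (-y) \<ge> 1 - y\<close>
  with \<open>(1 - y) * (1 + y + y\<^sup>2) = 1 - y ^ 3 \<ge> 1\<close>.\<close>

lemma exp_le_quadratic: "\<bar>y\<bar> \<le> 1 \<Longrightarrow> exp y \<le> 1 + y + y\<^sup>2" for y :: real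
proof (cases "y \<ge> 0")
  case False
  assume "\<bar>y\<bar> \<le> 1"
  have "(1 - y) * (1 + y + y\<^sup>2) = 1 - y * y\<^sup>2" by (simp add: algebra_simps power2_eq_square)
  also have "\<dots> \<ge> 1" using False by (simp add: mult_nonpos_nonneg)
  finally have "1 / (1 - y) \<le> 1 + y + y\<^sup>2" using False by (simp add: divide_le_eq mult.commute)
  moreover have "exp y \<le> 1 / (1 - y)"
    using exp_ge_add_one_self[of "-y"] False by (simp add: exp_minus field_simps)
  ultimately show ?thesis by linarith
qed (use exp_bound in auto)

lemma abs_exp_minus_one_le: "\<bar>y\<bar> \<le> 1 \<Longrightarrow> \<bar>exp y - 1\<bar> \<le> 2 * \<bar>y\<bar>" for y :: real
proof -
  assume y: "\<bar>y\<bar> \<le> 1"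
  have "y\<^sup>2 \<le> \<bar>y\<bar>" using y mult_left_le[of "\<bar>y\<bar>" "\<bar>y\<bar>"] by (simp add: power2_eq_square flip: abs_mult)
  with exp_le_quadratic[OF y] exp_ge_add_one_self[of y] show ?thesis by linarith
qed

context flip_rates
begin

text \<open>Each of at most \<open>m\<close> particles jumps at rate \<open>N\<close> and flips at
  rate at most \<open>b\<close>, and a single move changes \<open>g\<close> by at most
  \<open>2 * B\<close>.\<close>

lemma generator_bound:
  assumes g: "\<And>\<zeta>. \<zeta> \<in> configs_le N m \<Longrightarrow> \<bar>g \<zeta>\<bar> \<le> B" and \<xi>: "\<xi> \<in> configs_le N m"
  shows "\<bar>generator c N g \<xi>\<bar> \<le> B * (2 * (real N + b) * real m)"
proof -
  have B: "B \<ge> 0" using g[OF \<xi>] by linarith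
  have d: "real (\<xi> v) * \<bar>g (move \<xi> v w) - g \<xi>\<bar> \<le> real (\<xi> v) * (2 * B)"
    if "v \<in> sites N" "w \<in> sites N" for v w
  proof (cases "\<xi> v = 0")
    case False
    then have "\<bar>g (move \<xi> v w)\<bar> \<le> B" using g[OF move_configs_le[OF \<xi> that]] by simp
    then show ?thesis using g[OF \<xi>] by (intro mult_left_mono) auto
  qed simp
  let ?S = "\<Sum>v\<in>sites N. real (\<xi> v) * (2 * B)"
  have 1: "\<bar>\<Sum>(x, \<sigma>)\<in>sites N. real (\<xi> (x, \<sigma>)) * (g (move \<xi> (x, \<sigma>) ((x + \<sigma>) mod int N, \<sigma>)) - g \<xi>)\<bar> \<le> ?S"
  proof (rule order_trans[OF sum_abs], rule sum_mono, clarify)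
    fix x \<sigma> assume v: "(x, \<sigma>) \<in> sites N"
    from d[OF v sites_jump[OF v]]
    show "\<bar>real (\<xi> (x, \<sigma>)) * (g (move \<xi> (x, \<sigma>) ((x + \<sigma>) mod int N, \<sigma>)) - g \<xi>)\<bar>
        \<le> real (\<xi> (x, \<sigma>)) * (2 * B)" by (simp add: abs_mult)
  qed
  have 2: "\<bar>\<Sum>(x, \<sigma>)\<in>sites N. c \<sigma> (magnetization_N N \<xi>) * real (\<xi> (x, \<sigma>)) *
        (g (move \<xi> (x, \<sigma>) (x, -\<sigma>)) - g \<xi>)\<bar> \<le> b * ?S"
    unfolding sum_distrib_left
  proof (rule order_trans[OF sum_abs], rule sum_mono, clarify)
    fix x \<sigma> assume v: "(x, \<sigma>) \<in> sites N"
    have "\<bar>c \<sigma> (magnetization_N N \<xi>)\<bar> * (real (\<xi> (x, \<sigma>)) * \<bar>g (move \<xi> (x, \<sigma>) (x, -\<sigma>)) - g \<xi>\<bar>)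
        \<le> b * (real (\<xi> (x, \<sigma>)) * (2 * B))"
      using c_nonneg[OF sites_spins[OF v] magnetization_N_mem, of N \<xi>]
        c_le[OF sites_spins[OF v] magnetization_N_mem, of N \<xi>]
      by (intro mult_mono[OF _ d[OF v sites_flip[OF v]]]) (simp_all add: b_nonneg)
    then show "\<bar>c \<sigma> (magnetization_N N \<xi>) * real (\<xi> (x, \<sigma>)) * (g (move \<xi> (x, \<sigma>) (x, -\<sigma>)) - g \<xi>)\<bar>
        \<le> b * (real (\<xi> (x, \<sigma>)) * (2 * B))" by (simp add: abs_mult mult.assoc)
  qed
  have "\<bar>generator c N g \<xi>\<bar> \<le> real N * ?S + b * ?S"
    unfolding generator_def
    using mult_left_mono[OF 1, of "real N"] 2
    by (intro order_trans[OF abs_triangle_ineq] add_mono) (simp_all add: abs_mult)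
  also have "\<dots> = (real N + b) * (2 * B) * (\<Sum>v\<in>sites N. real (\<xi> v))"
    unfolding sum_distrib_right[symmetric] by (simp add: algebra_simps)
  also have "\<dots> \<le> (real N + b) * (2 * B) * real m"
    using sum_configs_le[OF \<xi>] B b_nonneg by (intro mult_left_mono) auto
  finally show ?thesis by (simp add: algebra_simps)
qed

text \<open>Iterating the bound on the generator gives \<open>B * C ^ k\<close> for its
  \<open>k\<close>-th power, so the tail of the series is dominated by
  \<open>B * (exp (C * t) - 1 - C * t)\<close>. This is at most \<open>B * (C * t)\<^sup>2\<close>
  as long as \<open>C * t \<le> 1\<close>.\<close>

lemma semigroup_N_second_order:
  fixes N m :: nat
  defines "C \<equiv> 2 * (real N + b) * real m"
  assumes f: "\<And>\<zeta>. \<zeta> \<in> configs_le N m \<Longrightarrow> \<bar>f \<zeta>\<bar> \<le> B" and \<xi>: "\<xi> \<in> configs_le N m"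
    and t: "t \<ge> 0" "C * t \<le> 1"
  shows "\<bar>semigroup_N c N t f \<xi> - (f \<xi> + t * generator c N f \<xi>)\<bar> \<le> B * (C * t)\<^sup>2"
proof -
  have B: "B \<ge> 0" using f[OF \<xi>] by linarith
  have C: "C \<ge> 0" using b_nonneg by (simp add: C_def)
  have bound: "\<forall>\<zeta>\<in>configs_le N m. \<bar>(generator c N ^^ k) f \<zeta>\<bar> \<le> B * C ^ k" for k
  proof (induction k)
    case (Suc k)
    then have "\<forall>\<zeta>\<in>configs_le N m. \<bar>generator c N ((generator c N ^^ k) f) \<zeta>\<bar> \<le> B * C ^ k * C"
      unfolding C_def by (intro ballI generator_bound) auto
    then show ?case by (simp add: mult.commute mult.left_commute)
  qed (use f in auto)
  let ?a = "\<lambda>k. t ^ k / fact k * ((generator c N ^^ k) f) \<xi>"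
  let ?e = "\<lambda>k. (C * t) ^ k /\<^sub>R fact k"
  have sa: "summable ?a"
    using \<xi> by (intro summable_semigroup_N) (simp add: configs_le_def)
  have se: "summable ?e" by (rule summable_exp_generic)
  have ab: "\<bar>?a k\<bar> \<le> B * ?e k" for k
    using mult_left_mono[OF bspec[OF bound[of k] \<xi>], of "t ^ k / fact k"] t(1)
    by (simp add: abs_mult power_mult_distrib divide_simps mult_ac)
  have "semigroup_N c N t f \<xi> = (\<Sum>k. ?a (k + 2)) + (\<Sum>k<2. ?a k)"
    unfolding semigroup_N_def by (rule suminf_split_initial_segment[OF sa])
  then have "semigroup_N c N t f \<xi> - (f \<xi> + t * generator c N f \<xi>) = (\<Sum>k. ?a (k + 2))"
    by (simp add: numeral_2_eq_2)
  also have "\<bar>\<dots>\<bar> \<le> (\<Sum>k. B * ?e (k + 2))"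
  proof -
    have s: "summable (\<lambda>k. B * ?e (k + 2))"
      using se by (intro summable_mult) (subst summable_iff_shift)
    have sa': "summable (\<lambda>k. \<bar>?a (k + 2)\<bar>)"
      by (rule summable_comparison_test'[where N = 0, OF s]) (simp only: real_norm_def abs_abs ab)
    have "\<bar>\<Sum>k. ?a (k + 2)\<bar> \<le> (\<Sum>k. \<bar>?a (k + 2)\<bar>)"
      by (rule summable_rabs[OF sa'])
    also have "\<dots> \<le> (\<Sum>k. B * ?e (k + 2))"
      using sa' s by (intro suminf_le ab)
    finally show ?thesis .
  qed
  also have "\<dots> = B * (exp (C * t) - (1 + C * t))"
  proof -
    have "exp (C * t) = (\<Sum>k. ?e (k + 2)) + (\<Sum>k<2. ?e k)"
      unfolding exp_def by (rule suminf_split_initial_segment[OF se])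
    moreover have "(\<Sum>k. B * ?e (k + 2)) = B * (\<Sum>k. ?e (k + 2))"
      using se by (intro suminf_mult) (subst summable_iff_shift)
    ultimately show ?thesis by (simp add: numeral_2_eq_2)
  qed
  also have "\<dots> \<le> B * (C * t)\<^sup>2"
    using exp_bound[of "C * t"] t C B by (intro mult_left_mono) auto
  finally show ?thesis .
qed

text \<open>One step of the exponential supermartingale. \<open>V\<close> is the relative growth
  rate of \<open>exp H\<close> under the generator and is subtracted at the end of the step, so the
  terms of first order in \<open>\<delta>\<close> cancel. \<open>K\<close> and
  \<open>\<delta>\<^sub>0\<close> precede \<open>H\<close> and \<open>V\<close> in the quantifiers
  because \<open>H\<close> and \<open>V\<close> will change with the grid point while their bounds
  do not.\<close>

lemma semigroup_N_exp_le:
  fixes h v :: real and N m :: nat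
  shows "\<exists>K. \<exists>\<delta>\<^sub>0>0. \<forall>H V \<delta> \<xi>.
    (\<forall>\<zeta>\<in>configs_le N m. \<bar>H \<zeta>\<bar> \<le> h \<and> \<bar>V \<zeta>\<bar> \<le> v \<and>
       generator c N (\<lambda>\<xi>. exp (H \<xi>)) \<zeta> = V \<zeta> * exp (H \<zeta>)) \<longrightarrow>
    0 \<le> \<delta> \<longrightarrow> \<delta> \<le> \<delta>\<^sub>0 \<longrightarrow> \<xi> \<in> configs_le N m \<longrightarrow>
    semigroup_N c N \<delta> (\<lambda>\<xi>. indicator (configs_le N m) \<xi> * exp (H \<xi> - \<delta> * V \<xi>)) \<xi> \<le> exp (H \<xi> + K * \<delta>\<^sup>2)"
proof -
  define C where "C = 2 * (real N + b) * real m"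
  \<comment> \<open>The three second-order errors, each divided by \<open>\<delta>\<^sup>2\<close>:
    from expanding \<open>exp (- (\<delta> * V \<xi>))\<close>, from applying the generator to
    \<open>f\<close> in place of \<open>exp H\<close>, and from the remainder of the
    semigroup.\<close>
  define X where "X = exp h * v\<^sup>2 + exp h * (2 * \<bar>v\<bar>) * C + exp (h + 1) * C\<^sup>2"
  \<comment> \<open>Chosen so that \<open>C * \<delta> + \<delta> * v \<le> 1\<close>; the absolute
    values keep it positive for every \<open>v\<close>.\<close>
  define \<delta>\<^sub>0 where "\<delta>\<^sub>0 = 1 / (\<bar>C\<bar> + \<bar>v\<bar> + 1)"
  have C: "C \<ge> 0" using b_nonneg by (simp add: C_def)
  have "semigroup_N c N \<delta> (\<lambda>\<xi>. indicator (configs_le N m) \<xi> * exp (H \<xi> - \<delta> * V \<xi>)) \<xi>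
      \<le> exp (H \<xi> + (exp h * X) * \<delta>\<^sup>2)"
    if H: "\<And>\<zeta>. \<zeta> \<in> configs_le N m \<Longrightarrow> \<bar>H \<zeta>\<bar> \<le> h"
      and V: "\<And>\<zeta>. \<zeta> \<in> configs_le N m \<Longrightarrow> \<bar>V \<zeta>\<bar> \<le> v"
      and gen: "\<And>\<zeta>. \<zeta> \<in> configs_le N m \<Longrightarrow> generator c N (\<lambda>\<xi>. exp (H \<xi>)) \<zeta> = V \<zeta> * exp (H \<zeta>)"
      and \<delta>: "0 \<le> \<delta>" "\<delta> \<le> \<delta>\<^sub>0" and \<xi>: "\<xi> \<in> configs_le N m" for H V \<delta> \<xi>
  proof -
    let ?A = "configs_le N m"
    define f where "f \<xi> = indicator ?A \<xi> * exp (H \<xi> - \<delta> * V \<xi>)" for \<xi>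
    have v: "v \<ge> 0" using V[OF \<xi>] by linarith
    have "\<delta> * (C + v + 1) \<le> 1"
      using \<delta> C v mult_right_mono[OF \<delta>(2), of "C + v + 1"] by (simp add: \<delta>\<^sub>0_def)
    then have \<delta>1: "C * \<delta> + \<delta> * v \<le> 1" using \<delta>(1) by (simp add: algebra_simps)
    have C\<delta>: "C * \<delta> \<le> 1" and v\<delta>: "\<delta> * v \<le> 1"
      using \<delta>1 mult_nonneg_nonneg[OF C \<delta>(1)] mult_nonneg_nonneg[OF \<delta>(1) v] by linarith+
    have \<delta>V: "\<bar>\<delta> * V \<zeta>\<bar> \<le> \<delta> * v" if "\<zeta> \<in> ?A" for \<zeta>
      using mult_left_mono[OF V[OF that] \<delta>(1)] \<delta>(1) by (simp add: abs_mult)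
    have fle: "\<bar>f \<zeta>\<bar> \<le> exp (h + 1)" if "\<zeta> \<in> ?A" for \<zeta>
      using H[OF that] \<delta>V[OF that] v\<delta> that by (auto simp: f_def)
    have fd: "\<bar>f \<zeta> - exp (H \<zeta>)\<bar> \<le> exp h * (2 * (\<delta> * v))" if "\<zeta> \<in> ?A" for \<zeta>
    proof -
      have "f \<zeta> - exp (H \<zeta>) = exp (H \<zeta>) * (exp (- (\<delta> * V \<zeta>)) - 1)"
        using that by (simp add: f_def algebra_simps flip: exp_add)
      then have "\<bar>f \<zeta> - exp (H \<zeta>)\<bar> = exp (H \<zeta>) * \<bar>exp (- (\<delta> * V \<zeta>)) - 1\<bar>" by (simp add: abs_mult)
      also have "\<dots> \<le> exp h * (2 * (\<delta> * v))"
        using abs_exp_minus_one_le[of "- (\<delta> * V \<zeta>)"] \<delta>V[OF that] v\<delta> H[OF that]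
        by (intro mult_mono) auto
      finally show ?thesis .
    qed
    have f1: "f \<xi> \<le> exp (H \<xi>) - \<delta> * V \<xi> * exp (H \<xi>) + exp h * (\<delta> * v)\<^sup>2"
    proof -
      have "f \<xi> = exp (H \<xi>) * exp (- (\<delta> * V \<xi>))" using \<xi> by (simp add: f_def exp_diff exp_minus divide_inverse)
      also have "\<dots> \<le> exp (H \<xi>) * (1 + - (\<delta> * V \<xi>) + (- (\<delta> * V \<xi>))\<^sup>2)"
        using \<delta>V[OF \<xi>] v\<delta> by (intro mult_left_mono exp_le_quadratic) auto
      also have "\<dots> = exp (H \<xi>) - \<delta> * V \<xi> * exp (H \<xi>) + exp (H \<xi>) * (\<delta> * V \<xi>)\<^sup>2"
        by (simp add: algebra_simps)
      also have "exp (H \<xi>) * (\<delta> * V \<xi>)\<^sup>2 \<le> exp h * (\<delta> * v)\<^sup>2"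
        using H[OF \<xi>] \<delta>V[OF \<xi>] power_mono[OF \<delta>V[OF \<xi>] abs_ge_zero, of 2] by (intro mult_mono) auto
      finally show ?thesis by simp
    qed
    have "generator c N f \<xi> - V \<xi> * exp (H \<xi>) = generator c N (\<lambda>\<xi>. f \<xi> - exp (H \<xi>)) \<xi>"
      by (simp add: generator_diff gen[OF \<xi>])
    also have "\<dots> \<le> exp h * (2 * (\<delta> * v)) * C"
      using generator_bound[of N m "\<lambda>\<xi>. f \<xi> - exp (H \<xi>)", OF fd \<xi>] unfolding C_def by linarith
    finally have "\<delta> * generator c N f \<xi> \<le> \<delta> * (V \<xi> * exp (H \<xi>) + exp h * (2 * (\<delta> * v)) * C)"
      using \<delta>(1) by (intro mult_left_mono) auto
    moreover have "semigroup_N c N \<delta> f \<xi> \<le> f \<xi> + \<delta> * generator c N f \<xi> + exp (h + 1) * (C * \<delta>)\<^sup>2"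
      using semigroup_N_second_order[of N m f, OF fle \<xi> \<delta>(1)] C\<delta> unfolding C_def by linarith
    ultimately have "semigroup_N c N \<delta> f \<xi> \<le> exp (H \<xi>) - \<delta> * V \<xi> * exp (H \<xi>) + exp h * (\<delta> * v)\<^sup>2
        + \<delta> * (V \<xi> * exp (H \<xi>) + exp h * (2 * (\<delta> * v)) * C) + exp (h + 1) * (C * \<delta>)\<^sup>2"
      using f1 by linarith
    also have "\<dots> = exp (H \<xi>) + X * \<delta>\<^sup>2"
      using v by (simp add: X_def algebra_simps power2_eq_square)
    also have "\<dots> \<le> exp (H \<xi>) + exp (H \<xi>) * (exp h * X * \<delta>\<^sup>2)"
    proof -
      \<comment> \<open>The lower bound \<open>H \<ge> -h\<close> turns the additive error
        \<open>X * \<delta>\<^sup>2\<close> into a factor, at the cost of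
        \<open>exp h\<close>.\<close>
      have "1 \<le> exp (H \<xi>) * exp h" using H[OF \<xi>] by (simp flip: exp_add)
      moreover have "X * \<delta>\<^sup>2 \<ge> 0" using C by (simp add: X_def)
      ultimately have "1 * (X * \<delta>\<^sup>2) \<le> exp (H \<xi>) * exp h * (X * \<delta>\<^sup>2)" by (intro mult_right_mono)
      then show ?thesis by (simp add: mult_ac)
    qed
    also have "\<dots> = exp (H \<xi>) * (1 + exp h * X * \<delta>\<^sup>2)" by (simp add: algebra_simps)
    also have "\<dots> \<le> exp (H \<xi>) * exp (exp h * X * \<delta>\<^sup>2)"
      by (intro mult_left_mono exp_ge_add_one_self) auto
    finally show ?thesis unfolding f_def exp_add by (simp add: mult.assoc)
  qed
  moreover have "\<delta>\<^sub>0 > 0" by (simp add: \<delta>\<^sub>0_def add_nonneg_pos)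
  ultimately show ?thesis by blast
qed

end

section \<open>Chaining the steps by the Markov property\<close>

lemma
  assumes "particle_process c T N M \<eta>" "s \<le> T"
  shows past_subalgebra: "subalgebra M (past M \<eta> s)"
    and past_measurable: "u \<in> {0..s} \<Longrightarrow> \<eta> u \<in> past M \<eta> s \<rightarrow>\<^sub>M count_space UNIV"
proof -
  have meas: "\<eta> u \<in> M \<rightarrow>\<^sub>M count_space UNIV" if "u \<in> {0..s}" for u
    using assms that by (auto simp: particle_process_def)
  have sp: "{\<eta> u -` A \<inter> space M | u A. u \<in> {0..s}} \<subseteq> Pow (space M)" by auto
  have sets: "sets (past M \<eta> s) = sigma_sets (space M) {\<eta> u -` A \<inter> space M | u A. u \<in> {0..s}}"
    unfolding past_def using sp by (rule sets_measure_of)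
  have space: "space (past M \<eta> s) = space M"
    unfolding past_def using sp by (rule space_measure_of)
  have "sets (past M \<eta> s) \<subseteq> sets M"
    unfolding sets
  proof (rule sets.sigma_sets_subset, clarify)
    fix u and A :: "config set" assume "u \<in> {0..s}"
    then show "\<eta> u -` A \<inter> space M \<in> sets M" using measurable_sets[OF meas] by simp
  qed
  then show "subalgebra M (past M \<eta> s)"
    using space by (simp add: subalgebra_def)
  show "\<eta> u \<in> past M \<eta> s \<rightarrow>\<^sub>M count_space UNIV" if "u \<in> {0..s}"
  proof (rule measurableI)
    fix A :: "config set"
    show "\<eta> u -` A \<inter> space (past M \<eta> s) \<in> sets (past M \<eta> s)"
      unfolding sets space using that by (intro sigma_sets.Basic) blast
  qed simp
qed

lemma finite_support_bounded:
  fixes f :: "'a \<Rightarrow> real"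
  assumes "finite A" "\<And>\<xi>. \<xi> \<notin> A \<Longrightarrow> f \<xi> = 0"
  shows "bounded (range f)"
proof -
  have "range f \<subseteq> insert 0 (f ` A)" using assms(2) by auto
  then show ?thesis using assms(1) by (meson bounded_subset finite_imageI finite_imp_bounded finite_insert)
qed

text \<open>Conditioning on the past at the last grid time but one replaces the last factor
  \<open>f k\<close> by the semigroup applied to it, which \<open>E k\<close> compensates; induction
  removes all factors. Finiteness of \<open>A\<close> keeps every function bounded, as the Markov
  property in \<open>particle_process\<close> is stated for bounded functions.\<close>

lemma particle_process_markov_product:
  fixes f E :: "nat \<Rightarrow> config \<Rightarrow> real" and g :: "config \<Rightarrow> real"
  assumes pp: "particle_process c T N M \<eta>" and A: "finite A"
    and d: "d \<ge> 0" "real n * d \<le> T"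
    and f: "\<And>j \<xi>. f j \<xi> \<ge> 0" "\<And>j \<xi>. \<xi> \<notin> A \<Longrightarrow> f j \<xi> = 0"
    and g: "\<And>\<xi>. g \<xi> \<ge> 0" "\<And>\<xi>. \<xi> \<notin> A \<Longrightarrow> g \<xi> = 0"
    and E: "\<And>j \<xi>. E j \<xi> > 0"
    and step: "\<And>j \<xi>. j < n \<Longrightarrow> \<xi> \<in> A \<Longrightarrow> semigroup_N c N d (f j) \<xi> \<le> E j \<xi>"
  shows "(\<integral>\<^sup>+\<omega>. ennreal (g (\<eta> 0 \<omega>) * (\<Prod>j<n. f j (\<eta> (real (Suc j) * d) \<omega>) / E j (\<eta> (real j * d) \<omega>))) \<partial>M)
    \<le> (\<integral>\<^sup>+\<omega>. ennreal (g (\<eta> 0 \<omega>)) \<partial>M)"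
proof -
  interpret prob_space M using pp by (simp add: particle_process_def)
  have meas: "\<eta> u \<in> M \<rightarrow>\<^sub>M count_space UNIV" if "u \<in> {0..T}" for u
    using pp that by (auto simp: particle_process_def)
  have T: "0 \<le> T" using d by (meson mult_nonneg_nonneg of_nat_0_le_iff order_trans)
  define Y where "Y k \<omega> = g (\<eta> 0 \<omega>) * (\<Prod>j<k. f j (\<eta> (real (Suc j) * d) \<omega>) / E j (\<eta> (real j * d) \<omega>))" for k \<omega>
  have time: "real j * d \<in> {0..T}" "real j * d \<in> {0..real k * d}" if "j \<le> k" "k \<le> n" for j k
  proof -
    have "real j * d \<le> real k * d" "real k * d \<le> real n * d"
      using that d(1) by (auto intro!: mult_right_mono)
    then show "real j * d \<in> {0..T}" "real j * d \<in> {0..real k * d}" using d by auto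
  qed
  have Ypast: "Y k \<in> borel_measurable (past M \<eta> (real k * d))" if "k \<le> n" for k
  proof -
    have kT: "real k * d \<le> T" using time(1)[OF order_refl that] by simp
    have m: "(\<lambda>\<omega>. x (\<eta> u \<omega>)) \<in> borel_measurable (past M \<eta> (real k * d))"
      if "u \<in> {0..real k * d}" for u and x :: "config \<Rightarrow> real"
      by (rule measurable_compose[OF past_measurable[OF pp kT that]]) simp
    show ?thesis
      unfolding Y_def
    proof (intro borel_measurable_times borel_measurable_prod borel_measurable_divide m)
      show "0 \<in> {0..real k * d}" using d(1) by simp
      fix j assume "j \<in> {..<k}"
      then show "real (Suc j) * d \<in> {0..real k * d}" "real j * d \<in> {0..real k * d}"
        using time(2)[of "Suc j" k] time(2)[of j k] that by auto
    qed
  qed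
  have Ynn: "Y k \<omega> \<ge> 0" for k \<omega>
    unfolding Y_def using f g E by (intro mult_nonneg_nonneg prod_nonneg divide_nonneg_pos) auto
  \<comment> \<open>The configuration at the last time enters through a function vanishing off
    \<open>A\<close>: the last \<open>f\<close>, or \<open>g\<close> if there is no factor
    yet.\<close>
  have Ysup: "Y k \<omega> = 0" if "\<eta> (real k * d) \<omega> \<notin> A" for k \<omega>
    using that f(2) g(2) unfolding Y_def by (cases k) auto
  have fb: "\<exists>B. \<forall>\<xi>. \<bar>f j \<xi>\<bar> \<le> B" for j
    using finite_support_bounded[OF A f(2)] by (auto simp: bounded_real)
  \<comment> \<open>\<open>1 / E j\<close> may be unbounded on all configurations. Cut off to
    \<open>A\<close> it is bounded, and the products stay the same because \<open>Y k\<close>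
    vanishes when the configuration leaves \<open>A\<close>.\<close>
  define q where "q j \<xi> = indicator A \<xi> / E j \<xi>" for j \<xi>
  have qb: "\<exists>B. \<forall>\<xi>. \<bar>q j \<xi>\<bar> \<le> B" for j
    using finite_support_bounded[OF A, of "q j"] by (auto simp: bounded_real q_def)
  have YSuc: "Y (Suc k) \<omega> = Y k \<omega> * q k (\<eta> (real k * d) \<omega>) * f k (\<eta> (real (Suc k) * d) \<omega>)" for k \<omega>
    using Ysup[of k \<omega>] by (cases "\<eta> (real k * d) \<omega> \<in> A") (auto simp: q_def Y_def)
  have Yb: "\<exists>B. \<forall>\<omega>. \<bar>Y k \<omega>\<bar> \<le> B" for k
  proof (induction k)
    case 0
    have "bounded (range g)" using g(2) by (intro finite_support_bounded[OF A])
    then show ?case by (auto simp: bounded_real Y_def)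
  next
    case (Suc k)
    obtain B1 B2 B3 where B: "\<forall>\<omega>. \<bar>Y k \<omega>\<bar> \<le> B1" "\<forall>\<xi>. \<bar>q k \<xi>\<bar> \<le> B2" "\<forall>\<xi>. \<bar>f k \<xi>\<bar> \<le> B3"
      using Suc qb fb by metis
    then have "0 \<le> B1" "0 \<le> B2" by (meson abs_ge_zero order_trans)+
    then have "\<bar>Y (Suc k) \<omega>\<bar> \<le> B1 * B2 * B3" for \<omega>
      unfolding YSuc abs_mult using B by (intro mult_mono) auto
    then show ?case by blast
  qed
  have Yint: "integrable M (Y k)" if "k \<le> n" for k
  proof -
    have "Y k \<in> borel_measurable M"
      using time(1)[OF order_refl that]
      by (intro measurable_from_subalg[OF past_subalgebra[OF pp] Ypast[OF that]]) simp
    moreover obtain B where "\<forall>\<omega>. \<bar>Y k \<omega>\<bar> \<le> B" using Yb by blast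
    ultimately show ?thesis by (intro integrable_const_bound[where B = B]) auto
  qed
  have "expectation (Y k) \<le> expectation (Y 0)" if "k \<le> n" for k
    using that
  proof (induction k)
    case (Suc k)
    let ?s = "real k * d"
    let ?F = "past M \<eta> ?s"
    have k: "k \<le> n" "?s \<le> T" using Suc time(1)[OF order_refl, of k] by auto
    have sub: "subalgebra M ?F" by (rule past_subalgebra[OF pp k(2)])
    interpret finite_measure_subalgebra M ?F by unfold_locales (rule sub)
    have s0: "?s \<ge> 0" using d(1) by simp
    have sd: "?s + d = real (Suc k) * d" by (simp add: algebra_simps)
    have sdT: "?s + d \<in> {0..T}" unfolding sd using time(1)[OF order_refl Suc.prems] .
    have ce: "AE \<omega> in M. real_cond_exp M ?F (\<lambda>\<omega>'. f k (\<eta> (?s + d) \<omega>')) \<omega> = semigroup_N c N d (f k) (\<eta> ?s \<omega>)"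
      using pp s0 d(1) sdT finite_support_bounded[OF A f(2)] unfolding particle_process_def by simp
    define X where "X \<omega> = Y k \<omega> * q k (\<eta> ?s \<omega>)" for \<omega>
    have X: "X \<in> borel_measurable ?F"
      unfolding X_def using s0
      by (intro borel_measurable_times Ypast[OF k(1)] measurable_compose[OF past_measurable[OF pp k(2)]]) auto
    have fm: "(\<lambda>\<omega>. f k (\<eta> (?s + d) \<omega>)) \<in> borel_measurable M"
      by (rule measurable_compose[OF meas[OF sdT]]) simp
    have YX: "Y (Suc k) = (\<lambda>\<omega>. X \<omega> * f k (\<eta> (?s + d) \<omega>))"
      unfolding YSuc X_def sd ..
    have int: "integrable M (\<lambda>\<omega>. X \<omega> * f k (\<eta> (?s + d) \<omega>))"
      using Yint[OF Suc.prems] unfolding YX .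
    \<comment> \<open>\<open>X\<close> depends on the past only, so it can be pulled out of the
      conditional expectation.\<close>
    note ceI = real_cond_exp_intg[OF int X fm]
    have "expectation (Y (Suc k)) = (\<integral>\<omega>. X \<omega> * real_cond_exp M ?F (\<lambda>\<omega>'. f k (\<eta> (?s + d) \<omega>')) \<omega> \<partial>M)"
      unfolding YX using ceI(2) by simp
    also have "\<dots> \<le> expectation (Y k)"
    proof (rule integral_mono_AE[OF ceI(1) Yint[OF k(1)]])
      show "AE \<omega> in M. X \<omega> * real_cond_exp M ?F (\<lambda>\<omega>'. f k (\<eta> (?s + d) \<omega>')) \<omega> \<le> Y k \<omega>"
        using ce
      proof eventually_elim
        case (elim \<omega>)
        show ?case
        proof (cases "\<eta> ?s \<omega> \<in> A")
          case True
          have "semigroup_N c N d (f k) (\<eta> ?s \<omega>) / E k (\<eta> ?s \<omega>) \<le> 1"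
            using step[of k, OF _ True] E[of k "\<eta> ?s \<omega>"] Suc.prems by simp
          from mult_left_mono[OF this Ynn[of k \<omega>]] show ?thesis
            using True by (simp add: elim X_def q_def)
        qed (simp add: X_def Ysup)
      qed
    qed
    also have "\<dots> \<le> expectation (Y 0)" using Suc by simp
    finally show ?case .
  qed simp
  from this[of n] have "expectation (Y n) \<le> expectation (Y 0)" by simp
  then have "ennreal (expectation (Y n)) \<le> ennreal (expectation (Y 0))" by (rule ennreal_leI)
  then have "(\<integral>\<^sup>+\<omega>. ennreal (Y n \<omega>) \<partial>M) \<le> (\<integral>\<^sup>+\<omega>. ennreal (Y 0 \<omega>) \<partial>M)"
    using Yint Ynn by (simp add: nn_integral_eq_integral)
  then show ?thesis by (simp add: Y_def)
qed

section \<open>The tilted generator\<close>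

definition energy :: "nat \<Rightarrow> (real \<times> int \<Rightarrow> real) \<Rightarrow> config \<Rightarrow> real" where
  "energy N \<psi> \<xi> = (\<Sum>(x, \<sigma>)\<in>sites N. real (\<xi> (x, \<sigma>)) * \<psi> (x / real N, \<sigma>))"

text \<open>With \<open>H = energy N \<psi>\<close> this is \<open>exp (-H)\<close> times the
  generator applied to \<open>exp H\<close>, written out: the drift that the exponential martingale
  has to compensate.\<close>

definition tilt :: "(int \<Rightarrow> real \<Rightarrow> real) \<Rightarrow> nat \<Rightarrow> (real \<times> int \<Rightarrow> real) \<Rightarrow> config \<Rightarrow> real" where
  "tilt c N \<psi> \<xi> =
     real N * (\<Sum>(x, \<sigma>)\<in>sites N. real (\<xi> (x, \<sigma>)) *
       (exp (\<psi> (real_of_int ((x + \<sigma>) mod int N) / real N, \<sigma>) - \<psi> (x / real N, \<sigma>)) - 1)) +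
     (\<Sum>(x, \<sigma>)\<in>sites N. c \<sigma> (magnetization_N N \<xi>) * real (\<xi> (x, \<sigma>)) *
       (exp (\<psi> (x / real N, -\<sigma>) - \<psi> (x / real N, \<sigma>)) - 1))"

lemma pairing_empirical_energy:
  "N \<ge> 1 \<Longrightarrow> \<phi> \<in> continuous_V \<Longrightarrow> real N * pairing (empirical_measure N \<xi>) \<phi> = energy N \<phi> \<xi>"
  by (simp add: pairing_empirical_measure continuous_V_measurable energy_def)

lemma energy_move:
  assumes "v \<in> sites N" "w \<in> sites N" "\<xi> v > 0"
  shows "energy N \<psi> (move \<xi> v w) = energy N \<psi> \<xi>
    - \<psi> (real_of_int (fst v) / real N, snd v) + \<psi> (real_of_int (fst w) / real N, snd w)"
proof -
  let ?p = "\<lambda>v. \<psi> (real_of_int (fst v) / real N, snd v)"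
  \<comment> \<open>The removed and the added particle are booked on opposite sides, so that the
    sums match term by term, including when \<open>v = w\<close>.\<close>
  have "energy N \<psi> (move \<xi> v w) + (\<Sum>u\<in>sites N. of_bool (u = v) * ?p u)
      = energy N \<psi> \<xi> + (\<Sum>u\<in>sites N. of_bool (u = w) * ?p u)"
    unfolding energy_def case_prod_unfold sum.distrib[symmetric] using assms(3)
    by (intro sum.cong) (auto simp: move_def of_nat_diff algebra_simps)
  then show ?thesis
    using assms(1,2) finite_sites[of N] by (simp add: of_bool_def if_distrib[of "\<lambda>x. x * _"] sum.delta cong: if_cong)
qed

lemma generator_exp_energy:
  "generator c N (\<lambda>\<xi>. exp (energy N \<psi> \<xi>)) \<xi> = tilt c N \<psi> \<xi> * exp (energy N \<psi> \<xi>)"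
proof -
  have move: "real (\<xi> v) * (exp (energy N \<psi> (move \<xi> v w)) - exp (energy N \<psi> \<xi>))
      = real (\<xi> v) * (exp (\<psi> (real_of_int (fst w) / real N, snd w) - \<psi> (real_of_int (fst v) / real N, snd v)) - 1)
        * exp (energy N \<psi> \<xi>)" if "v \<in> sites N" "w \<in> sites N" for v w
  proof (cases "\<xi> v = 0")
    case False
    then have "exp (energy N \<psi> (move \<xi> v w)) = exp (energy N \<psi> \<xi>) *
        exp (\<psi> (real_of_int (fst w) / real N, snd w) - \<psi> (real_of_int (fst v) / real N, snd v))"
      using that by (simp add: energy_move flip: exp_add)
    then show ?thesis by (simp add: algebra_simps)
  qed simp
  have 1: "(\<Sum>(x, \<sigma>)\<in>sites N. real (\<xi> (x, \<sigma>)) *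
      (exp (energy N \<psi> (move \<xi> (x, \<sigma>) ((x + \<sigma>) mod int N, \<sigma>))) - exp (energy N \<psi> \<xi>)))
    = (\<Sum>(x, \<sigma>)\<in>sites N. real (\<xi> (x, \<sigma>)) *
       (exp (\<psi> (real_of_int ((x + \<sigma>) mod int N) / real N, \<sigma>) - \<psi> (x / real N, \<sigma>)) - 1))
      * exp (energy N \<psi> \<xi>)"
    unfolding sum_distrib_right by (intro sum.cong refl) (auto simp: move sites_jump)
  have 2: "(\<Sum>(x, \<sigma>)\<in>sites N. c \<sigma> (magnetization_N N \<xi>) * real (\<xi> (x, \<sigma>)) *
      (exp (energy N \<psi> (move \<xi> (x, \<sigma>) (x, -\<sigma>))) - exp (energy N \<psi> \<xi>)))
    = (\<Sum>(x, \<sigma>)\<in>sites N. c \<sigma> (magnetization_N N \<xi>) * real (\<xi> (x, \<sigma>)) *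
       (exp (\<psi> (x / real N, -\<sigma>) - \<psi> (x / real N, \<sigma>)) - 1))
      * exp (energy N \<psi> \<xi>)"
    unfolding sum_distrib_right by (intro sum.cong refl) (auto simp: move sites_flip mult.assoc)
  show ?thesis unfolding generator_def tilt_def 1 2 by (simp add: algebra_simps)
qed

lemma energy_bound:
  assumes "\<xi> \<in> configs_le N m" "\<And>v. v \<in> V \<Longrightarrow> \<bar>\<psi> v\<bar> \<le> C" "C \<ge> 0"
  shows "\<bar>energy N \<psi> \<xi>\<bar> \<le> C * real m"
proof -
  have "\<bar>energy N \<psi> \<xi>\<bar> \<le> (\<Sum>v\<in>sites N. real (\<xi> v) * C)"
    unfolding energy_def
  proof (rule order_trans[OF sum_abs], rule sum_mono, clarify)
    fix x \<sigma> assume "(x, \<sigma>) \<in> sites N"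
    then show "\<bar>real (\<xi> (x, \<sigma>)) * \<psi> (x / real N, \<sigma>)\<bar> \<le> real (\<xi> (x, \<sigma>)) * C"
      using assms(2)[OF sites_V] by (simp add: abs_mult mult_left_mono)
  qed
  also have "\<dots> \<le> C * real m"
    using mult_right_mono[OF sum_configs_le[OF assms(1)] assms(3)]
    unfolding sum_distrib_right[symmetric] by (simp add: mult.commute)
  finally show ?thesis .
qed

context flip_rates
begin

text \<open>The bound on the generator applied to \<open>exp H\<close>, divided by
  \<open>exp H\<close>. It is exponential in \<open>m\<close>, which is enough: it is used at fixed
  \<open>N\<close> and \<open>m\<close>, as a dominating constant and in the choice of the
  mesh.\<close>

lemma tilt_bound:
  assumes "\<xi> \<in> configs_le N m" "\<And>v. v \<in> V \<Longrightarrow> \<bar>\<psi> v\<bar> \<le> C" "C \<ge> 0"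
  shows "\<bar>tilt c N \<psi> \<xi>\<bar> \<le> exp (C * real m) * (2 * (real N + b) * real m) * exp (C * real m)"
proof -
  have *: "\<bar>exp (energy N \<psi> \<zeta>)\<bar> \<le> exp (C * real m)" if "\<zeta> \<in> configs_le N m" for \<zeta>
    using energy_bound[OF that, of \<psi> C] assms(2,3) by (simp add: abs_le_iff)
  have 1: "\<bar>tilt c N \<psi> \<xi>\<bar> * exp (energy N \<psi> \<xi>) \<le> exp (C * real m) * (2 * (real N + b) * real m)"
    using generator_bound[of N m "\<lambda>\<xi>. exp (energy N \<psi> \<xi>)", OF * assms(1)]
    by (simp add: generator_exp_energy abs_mult)
  have 2: "exp (- energy N \<psi> \<xi>) \<le> exp (C * real m)"
    using energy_bound[OF assms(1), of \<psi> C] assms(2,3) by (simp add: abs_le_iff)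
  have "\<bar>tilt c N \<psi> \<xi>\<bar> * exp (energy N \<psi> \<xi>) * exp (- energy N \<psi> \<xi>)
      \<le> exp (C * real m) * (2 * (real N + b) * real m) * exp (C * real m)"
    by (rule mult_mono[OF 1 2]) (use b_nonneg in auto)
  moreover have "\<bar>tilt c N \<psi> \<xi>\<bar> * exp (energy N \<psi> \<xi>) * exp (- energy N \<psi> \<xi>) = \<bar>tilt c N \<psi> \<xi>\<bar>"
    by (simp add: mult.assoc flip: exp_add)
  ultimately show ?thesis by simp
qed

end

section \<open>The path functional along the particle system\<close>

lemma smooth_TV_derivatives:
  assumes G: "G \<in> smooth_TV T" and T: "T > 0"
  obtains Gt Gx Gxx where "Gt \<in> continuous_TV T" "Gx \<in> continuous_TV T" "Gxx \<in> continuous_TV T"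
    "\<And>t x \<sigma>. t \<in> {0..T} \<Longrightarrow> \<sigma> \<in> spins \<Longrightarrow>
      ((\<lambda>s. G s (x, \<sigma>)) has_real_derivative Gt t (x, \<sigma>)) (at t within {0..T})"
    "\<And>t x \<sigma>. t \<in> {0..T} \<Longrightarrow> \<sigma> \<in> spins \<Longrightarrow> ((\<lambda>y. G t (y, \<sigma>)) has_real_derivative Gx t (x, \<sigma>)) (at x)"
    "\<And>t x \<sigma>. t \<in> {0..T} \<Longrightarrow> \<sigma> \<in> spins \<Longrightarrow> ((\<lambda>y. Gx t (y, \<sigma>)) has_real_derivative Gxx t (x, \<sigma>)) (at x)"
    "\<And>t x \<sigma>. t \<in> {0..T} \<Longrightarrow> \<sigma> \<in> spins \<Longrightarrow> transport T G t (x, \<sigma>) = Gt t (x, \<sigma>) + real_of_int \<sigma> * Gx t (x, \<sigma>)"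
proof -
  have per: "G t (x + 1, \<sigma>) = G t (x, \<sigma>)" if "t \<in> {0..T}" "\<sigma> \<in> spins" for t x \<sigma>
    using G that by (simp add: smooth_TV_def)
  obtain D where D0: "\<And>\<sigma> t x. \<sigma> \<in> spins \<Longrightarrow> t \<in> {0..T} \<Longrightarrow> D \<sigma> 0 0 t x = G t (x, \<sigma>)"
    and Dc: "\<And>\<sigma> i j. \<sigma> \<in> spins \<Longrightarrow> continuous_on ({0..T} \<times> UNIV) (\<lambda>(t, x). D \<sigma> i j t x)"
    and Dt: "\<And>\<sigma> i j t x. \<sigma> \<in> spins \<Longrightarrow> t \<in> {0..T} \<Longrightarrow>
      ((\<lambda>s. D \<sigma> i j s x) has_real_derivative D \<sigma> (Suc i) j t x) (at t within {0..T})"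
    and Dx: "\<And>\<sigma> i j t x. \<sigma> \<in> spins \<Longrightarrow> t \<in> {0..T} \<Longrightarrow> (D \<sigma> i j t has_real_derivative D \<sigma> i (Suc j) t x) (at x)"
  proof -
    let ?Q = "\<lambda>\<sigma> D :: nat \<Rightarrow> nat \<Rightarrow> real \<Rightarrow> real \<Rightarrow> real. (\<forall>t\<in>{0..T}. \<forall>x. D 0 0 t x = G t (x, \<sigma>)) \<and>
        (\<forall>i j. continuous_on ({0..T} \<times> UNIV) (\<lambda>(t, x). D i j t x) \<and>
          (\<forall>t\<in>{0..T}. \<forall>x.
             ((\<lambda>s. D i j s x) has_real_derivative D (Suc i) j t x) (at t within {0..T}) \<and>
             (D i j t has_real_derivative D i (Suc j) t x) (at x)))"
    have "\<forall>\<sigma>\<in>spins. \<exists>D. ?Q \<sigma> D"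
      using G by (simp add: smooth_TV_def)
    from bchoice[OF this] obtain D where "\<forall>\<sigma>\<in>spins. ?Q \<sigma> (D \<sigma>)" ..
    then show thesis by (intro that[of D]) blast+
  qed
  \<comment> \<open>The time derivative at position \<open>x\<close> may be read off at any
    \<open>y\<close> with the same trajectory; taking positions one period apart yields periodicity
    of the time derivative.\<close>
  have Gt: "((\<lambda>s. G s (x, \<sigma>)) has_real_derivative D \<sigma> 1 0 t y) (at t within {0..T})"
    if "t \<in> {0..T}" "\<sigma> \<in> spins" "\<And>s. s \<in> {0..T} \<Longrightarrow> G s (y, \<sigma>) = G s (x, \<sigma>)" for t x y \<sigma>
    unfolding has_field_derivative_def
  proof (rule has_derivative_transform[OF that(1)])
    show "((\<lambda>s. D \<sigma> 0 0 s y) has_derivative (*) (D \<sigma> 1 0 t y)) (at t within {0..T})"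
      using Dt[of \<sigma> t 0 0 y] that by (simp add: has_field_derivative_def)
  qed (use D0 that in auto)
  have vd: "vector_derivative (\<lambda>s. G s (x, \<sigma>)) (at t within {0..T}) = D \<sigma> 1 0 t y"
    if "t \<in> {0..T}" "\<sigma> \<in> spins" "\<And>s. s \<in> {0..T} \<Longrightarrow> G s (y, \<sigma>) = G s (x, \<sigma>)" for t x y \<sigma>
    using Gt[OF that] T that(1)
    by (intro vector_derivative_within_closed_interval) (auto simp: has_real_derivative_iff_has_vector_derivative)
  have D00: "D \<sigma> 0 0 t = (\<lambda>y. G t (y, \<sigma>))" if "t \<in> {0..T}" "\<sigma> \<in> spins" for t \<sigma>
    using D0 that by auto
  \<comment> \<open>The family \<open>D\<close> is tied to \<open>G\<close> only at order zero;
    periodicity climbs from one spatial order to the next by uniqueness of derivatives.\<close>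
  have perx: "D \<sigma> 0 (Suc j) t (x + 1) = D \<sigma> 0 (Suc j) t x"
    if "t \<in> {0..T}" "\<sigma> \<in> spins" "\<And>x. D \<sigma> 0 j t (x + 1) = D \<sigma> 0 j t x" for t \<sigma> j x
  proof -
    have "((\<lambda>y. D \<sigma> 0 j t (y + 1)) has_real_derivative D \<sigma> 0 (Suc j) t (x + 1)) (at x)"
      using Dx[OF that(2,1), of 0 j "x + 1"] DERIV_shift by blast
    then show ?thesis using Dx[OF that(2,1), of 0 j x] that(3) DERIV_unique by simp
  qed
  have per1: "D \<sigma> 0 1 t (x + 1) = D \<sigma> 0 1 t x" if "t \<in> {0..T}" "\<sigma> \<in> spins" for t \<sigma> x
    using perx[OF that, of 0] per[OF that] D00[OF that] by simp
  have per2: "D \<sigma> 0 2 t (x + 1) = D \<sigma> 0 2 t x" if "t \<in> {0..T}" "\<sigma> \<in> spins" for t \<sigma> x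
    using perx[OF that, of 1] per1[OF that] by (simp add: numeral_2_eq_2)
  have pert: "D \<sigma> 1 0 t (x + 1) = D \<sigma> 1 0 t x" if "t \<in> {0..T}" "\<sigma> \<in> spins" for t \<sigma> x
    using vd[OF that, of "x + 1" x] vd[OF that, of x x] per that(2) by simp
  show thesis
  proof (rule that[of "\<lambda>t (x, \<sigma>). D \<sigma> 1 0 t x" "\<lambda>t (x, \<sigma>). D \<sigma> 0 1 t x" "\<lambda>t (x, \<sigma>). D \<sigma> 0 2 t x"])
    show "(\<lambda>t (x, \<sigma>). D \<sigma> 1 0 t x) \<in> continuous_TV T" "(\<lambda>t (x, \<sigma>). D \<sigma> 0 1 t x) \<in> continuous_TV T"
      "(\<lambda>t (x, \<sigma>). D \<sigma> 0 2 t x) \<in> continuous_TV T"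
      using Dc pert per1 per2 by (simp_all add: continuous_TV_def)
    fix t x \<sigma> assume t: "t \<in> {0..T}" and \<sigma>: "\<sigma> \<in> spins"
    show "((\<lambda>s. G s (x, \<sigma>)) has_real_derivative (\<lambda>t (x, \<sigma>). D \<sigma> 1 0 t x) t (x, \<sigma>)) (at t within {0..T})"
      using Gt[OF t \<sigma>, of x x] by simp
    show gx: "((\<lambda>y. G t (y, \<sigma>)) has_real_derivative (\<lambda>t (x, \<sigma>). D \<sigma> 0 1 t x) t (x, \<sigma>)) (at x)"
      using Dx[OF \<sigma> t, of 0 0 x] D00[OF t \<sigma>] by simp
    show "((\<lambda>y. (\<lambda>t (x, \<sigma>). D \<sigma> 0 1 t x) t (y, \<sigma>)) has_real_derivative (\<lambda>t (x, \<sigma>). D \<sigma> 0 2 t x) t (x, \<sigma>)) (at x)"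
      using Dx[OF \<sigma> t, of 0 1 x] by (simp add: numeral_2_eq_2)
    show "transport T G t (x, \<sigma>) = (\<lambda>t (x, \<sigma>). D \<sigma> 1 0 t x) t (x, \<sigma>)
        + real_of_int \<sigma> * (\<lambda>t (x, \<sigma>). D \<sigma> 0 1 t x) t (x, \<sigma>)"
      using vd[OF t \<sigma>, of x x] DERIV_imp_deriv[OF gx] by (simp add: transport_def)
  qed
qed

lemma smooth_TV_continuous:
  assumes "G \<in> smooth_TV T"
  shows "G \<in> continuous_TV T"
  unfolding continuous_TV_def
proof (clarify, intro conjI ballI allI)
  fix \<sigma> assume \<sigma>: "\<sigma> \<in> spins"
  show "G t (x + 1, \<sigma>) = G t (x, \<sigma>)" if "t \<in> {0..T}" for t x
    using assms that \<sigma> by (simp add: smooth_TV_def)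
  obtain D :: "nat \<Rightarrow> nat \<Rightarrow> real \<Rightarrow> real \<Rightarrow> real"
    where D: "\<forall>t\<in>{0..T}. \<forall>x. D 0 0 t x = G t (x, \<sigma>)" "continuous_on ({0..T} \<times> UNIV) (\<lambda>(t, x). D 0 0 t x)"
    using assms \<sigma> unfolding smooth_TV_def by blast
  show "continuous_on ({0..T} \<times> UNIV) (\<lambda>(t, x). G t (x, \<sigma>))"
    by (rule iffD1[OF continuous_on_cong D(2)]) (use D(1) in auto)
qed

lemma transport_continuous:
  assumes "G \<in> smooth_TV T" "T > 0"
  shows "transport T G \<in> continuous_TV T"
proof -
  obtain Gt Gx where G: "Gt \<in> continuous_TV T" "Gx \<in> continuous_TV T"
    "\<And>t x \<sigma>. t \<in> {0..T} \<Longrightarrow> \<sigma> \<in> spins \<Longrightarrow> transport T G t (x, \<sigma>) = Gt t (x, \<sigma>) + real_of_int \<sigma> * Gx t (x, \<sigma>)"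
    using smooth_TV_derivatives[OF assms] by metis
  show ?thesis
    unfolding continuous_TV_def
  proof (clarify, intro conjI ballI allI)
    fix \<sigma> assume \<sigma>: "\<sigma> \<in> spins"
    show "transport T G t (x + 1, \<sigma>) = transport T G t (x, \<sigma>)" if "t \<in> {0..T}" for t x
      using G that \<sigma> by (simp add: continuous_TV_def)
    have "continuous_on ({0..T} \<times> UNIV) (\<lambda>(t, x). Gt t (x, \<sigma>) + real_of_int \<sigma> * Gx t (x, \<sigma>))"
      using G(1,2) \<sigma> by (auto simp: continuous_TV_def case_prod_unfold intro!: continuous_intros)
    then show "continuous_on ({0..T} \<times> UNIV) (\<lambda>(t, x). transport T G t (x, \<sigma>))"
      by (rule iffD2[OF continuous_on_cong, rotated 2]) (use G(3)[OF _ \<sigma>] in auto)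
  qed
qed

text \<open>For a spin \<open>\<sigma>\<close> the exponent is
  \<open>G t (x, -\<sigma>) - G t (x, \<sigma>)\<close>, the change of \<open>G\<close> when a
  particle flips.\<close>

definition flip_weight :: "(real \<Rightarrow> real \<times> int \<Rightarrow> real) \<Rightarrow> real \<Rightarrow> real \<times> int \<Rightarrow> real" where
  "flip_weight G t = (\<lambda>(x, \<sigma>). exp (- real_of_int \<sigma> * (G t (x, 1) - G t (x, -1))) - 1)"

lemma flip_weight_continuous: "G \<in> continuous_TV T \<Longrightarrow> flip_weight G \<in> continuous_TV T"
  by (auto simp: continuous_TV_def flip_weight_def case_prod_unfold spins_def intro!: continuous_intros)

section \<open>Integrals of functions frozen on the cells of a grid\<close>

lemma grid_mem: "T > 0 \<Longrightarrow> n \<ge> 1 \<Longrightarrow> j \<le> n \<Longrightarrow> real j * T / real n \<in> {0..T}"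
  by (auto simp: field_simps)

lemma grid_up_eq:
  assumes "T > 0" "n \<ge> 1" "real j * T / real n < s" "s \<le> real (Suc j) * T / real n"
  shows "grid_up T n s = real (Suc j) * T / real n"
proof -
  have "\<lceil>real n * s / T\<rceil> = int (Suc j)"
    using assms by (intro ceiling_unique) (auto simp: field_simps)
  then show ?thesis by (simp add: grid_up_def mult.commute)
qed

text \<open>The first argument of \<open>P\<close> carries the grid point, which is constant on each
  cell except at its left end. There \<open>grid_up\<close> may take another value, but a single
  point does not affect the integral.\<close>

lemma has_integral_grid:
  fixes P :: "real \<Rightarrow> real \<Rightarrow> real"
  assumes T: "T > 0" and n: "n \<ge> 1"
    and P: "\<And>j. j < n \<Longrightarrow> (P (real (Suc j) * T / real n) has_integral q j) {real j * T / real n..real (Suc j) * T / real n}"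
  shows "((\<lambda>s. P (grid_up T n s) s) has_integral (\<Sum>j<n. q j)) {0..T}"
proof -
  have "((\<lambda>s. P (grid_up T n s) s) has_integral (\<Sum>j<k. q j)) {0..real k * T / real n}" if "k \<le> n" for k
    using that
  proof (induction k)
    case (Suc k)
    have "((\<lambda>s. P (grid_up T n s) s) has_integral q k) {real k * T / real n..real (Suc k) * T / real n}"
    proof (rule has_integral_spike_finite[OF _ _ P[of k]])
      show "finite {real k * T / real n}" by simp
      fix s assume "s \<in> {real k * T / real n..real (Suc k) * T / real n} - {real k * T / real n}"
      then show "P (grid_up T n s) s = P (real (Suc k) * T / real n) s"
        using grid_up_eq[OF T n, of k s] by simp
    qed (use Suc in simp)
    then have "((\<lambda>s. P (grid_up T n s) s) has_integral (\<Sum>j<k. q j) + q k) {0..real (Suc k) * T / real n}"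
      using Suc T by (intro has_integral_combine[where c = "real k * T / real n"]) (auto simp: field_simps)
    then show ?case by simp
  qed (simp add: has_integral_refl)
  from this[of n] show ?thesis using n by simp
qed

lemma eventually_grid_up:
  assumes "T > 0" "s \<in> {0..T}" "s < T \<Longrightarrow> \<forall>\<^sub>F y in at_right s. P y" "P s"
  shows "\<forall>\<^sub>F n in sequentially. P (grid_up T (Suc n) s)"
proof (cases "s < T")
  case True
  then obtain b where b: "b > s" "\<And>y. s < y \<Longrightarrow> y < b \<Longrightarrow> P y"
    using assms(3) by (auto simp: eventually_at_right_field)
  have "\<forall>\<^sub>F n in sequentially. grid_up T (Suc n) s < b"
    using grid_up_tendsto[OF assms(1)] b(1) by (rule order_tendstoD)
  then show ?thesis
  proof eventually_elim
    case (elim n)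
    have "s \<le> grid_up T (Suc n) s" using grid_up_ge[OF assms(1), of "Suc n" s] by simp
    then show ?case using b(2) elim assms(4) by (cases "grid_up T (Suc n) s = s") auto
  qed
next
  case False
  then have s: "s = T" using assms(2) by simp
  have "grid_up T (Suc n) T = T" for n
    using grid_up_mem[OF assms(1), of "Suc n" T] assms(1) by simp
  then show ?thesis using assms(4) s by simp
qed

lemma energy_add: "energy N (\<lambda>v. \<phi> v + \<psi> v) \<xi> = energy N \<phi> \<xi> + energy N \<psi> \<xi>"
  by (simp add: energy_def case_prod_unfold sum.distrib algebra_simps)

lemma energy_diff: "energy N (\<lambda>v. \<phi> v - \<psi> v) \<xi> = energy N \<phi> \<xi> - energy N \<psi> \<xi>"
  by (simp add: energy_def case_prod_unfold sum_subtractf algebra_simps)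

lemma energy_cong: "(\<And>v. v \<in> V \<Longrightarrow> \<phi> v = \<psi> v) \<Longrightarrow> energy N \<phi> \<xi> = energy N \<psi> \<xi>"
  unfolding energy_def using sites_V by (intro sum.cong) auto

text \<open>The discretised logarithm of the exponential martingale; the configuration is always taken at
  the right endpoint of a grid interval, so that right continuity of the paths suffices.\<close>

definition log_mart :: "(int \<Rightarrow> real \<Rightarrow> real) \<Rightarrow> nat \<Rightarrow> real \<Rightarrow> (real \<Rightarrow> real \<times> int \<Rightarrow> real) \<Rightarrow> nat \<Rightarrow> (real \<Rightarrow> config) \<Rightarrow> real" where
  "log_mart c N T G n \<zeta> = (\<Sum>j<n. energy N (G (real j * T / real n)) (\<zeta> (real (Suc j) * T / real n))
     - T / real n * tilt c N (G (real j * T / real n)) (\<zeta> (real (Suc j) * T / real n))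
     - energy N (G (real j * T / real n)) (\<zeta> (real j * T / real n)))"

text \<open>Summation by parts: the energy differences in \<open>log_mart\<close> are a telescoping
  sum minus the increments of \<open>G\<close> over each cell with the configuration frozen at the
  right end (\<open>qe\<close>), and the fundamental theorem of calculus writes these as integrals
  of the energy of \<open>Gt\<close>. A path that is constant just to the right of \<open>s\<close>
  agrees with its grid value there for fine grids, so the integrands converge pointwise and
  dominated convergence applies.\<close>

lemma (in flip_rates) log_mart_tendsto:
  assumes T: "T > 0" and G: "G \<in> continuous_TV T" and Gt: "Gt \<in> continuous_TV T"
    and deriv: "\<And>t x \<sigma>. t \<in> {0..T} \<Longrightarrow> \<sigma> \<in> spins \<Longrightarrow>
      ((\<lambda>s. G s (x, \<sigma>)) has_real_derivative Gt t (x, \<sigma>)) (at t within {0..T})"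
    and \<zeta>: "\<And>t. t \<in> {0..T} \<Longrightarrow> \<zeta> t \<in> configs_le N m"
      "\<And>t. t \<in> {0..<T} \<Longrightarrow> \<forall>\<^sub>F s in at_right t. \<zeta> s = \<zeta> t"
  shows "(\<lambda>s. energy N (Gt s) (\<zeta> s)) integrable_on {0..T}"
    and "(\<lambda>s. tilt c N (G s) (\<zeta> s)) integrable_on {0..T}"
    and "(\<lambda>n. log_mart c N T G (Suc n) \<zeta>) \<longlonglongrightarrow> energy N (G T) (\<zeta> T) - energy N (G 0) (\<zeta> 0)
      - integral {0..T} (\<lambda>s. energy N (Gt s) (\<zeta> s)) - integral {0..T} (\<lambda>s. tilt c N (G s) (\<zeta> s))"
proof -
  have gu: "grid_up T (Suc n) s \<in> {s..T}" if "s \<in> {0..T}" for n s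
    using grid_up_mem[OF T _ that, of "Suc n"] by simp
  have ev: "\<forall>\<^sub>F n in sequentially. \<zeta> (grid_up T (Suc n) s) = \<zeta> s" if "s \<in> {0..T}" for s
    using T that \<zeta>(2)[of s] that by (intro eventually_grid_up) auto
  obtain Ct where Ct: "Ct \<ge> 0" "\<And>t x \<sigma>. t \<in> {0..T} \<Longrightarrow> x \<in> {-1..2} \<Longrightarrow> \<sigma> \<in> spins \<Longrightarrow> \<bar>Gt t (x, \<sigma>)\<bar> \<le> Ct"
    using continuous_TV_bounded[OF Gt] by metis
  obtain C where C: "C \<ge> 0" "\<And>t x \<sigma>. t \<in> {0..T} \<Longrightarrow> x \<in> {-1..2} \<Longrightarrow> \<sigma> \<in> spins \<Longrightarrow> \<bar>G t (x, \<sigma>)\<bar> \<le> C"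
    using continuous_TV_bounded[OF G] by metis
  define Pe where "Pe t s = energy N (Gt s) (\<zeta> t)" for t s
  \<comment> \<open>\<open>t - T / n\<close> recovers the left end of a cell from its right end
    \<open>t\<close>. At \<open>s = 0\<close> the grid point is 0 itself, and \<open>max\<close>
    keeps the time in the interval.\<close>
  define Pt where "Pt n t s = tilt c N (G (max 0 (t - T / real n))) (\<zeta> t)" for n t and s :: real
  define qe where "qe n j = energy N (G (real (Suc j) * T / real n)) (\<zeta> (real (Suc j) * T / real n))
    - energy N (G (real j * T / real n)) (\<zeta> (real (Suc j) * T / real n))" for n j
  define qt where "qt n j = T / real n * tilt c N (G (real j * T / real n)) (\<zeta> (real (Suc j) * T / real n))" for n j
  have e: "((\<lambda>s. Pe (grid_up T (Suc n) s) s) has_integral (\<Sum>j<Suc n. qe (Suc n) j)) {0..T}" for n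
  proof (rule has_integral_grid[OF T])
    fix j assume j: "j < Suc n"
    let ?a = "real j * T / real (Suc n)" and ?b = "real (Suc j) * T / real (Suc n)"
    have ab: "?a \<in> {0..T}" "?b \<in> {0..T}" using grid_mem[OF T, of "Suc n" j] grid_mem[OF T, of "Suc n" "Suc j"] j by auto
    show "(Pe ?b has_integral qe (Suc n) j) {?a..?b}"
      unfolding Pe_def qe_def
    proof (rule fundamental_theorem_of_calculus)
      show "?a \<le> ?b" using T by (simp add: divide_right_mono mult_right_mono)
      fix s assume s: "s \<in> {?a..?b}"
      have sub: "{?a..?b} \<subseteq> {0..T}" using ab by auto
      have "((\<lambda>s. real (\<zeta> ?b (x, \<sigma>)) * G s (real_of_int x / real N, \<sigma>)) has_real_derivative
          real (\<zeta> ?b (x, \<sigma>)) * Gt s (real_of_int x / real N, \<sigma>)) (at s within {?a..?b})"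
        if "(x, \<sigma>) \<in> sites N" for x \<sigma>
        using has_field_derivative_subset[OF deriv[OF _ sites_spins[OF that]] sub] s sub
        by (intro DERIV_cmult) auto
      then have "((\<lambda>s. energy N (G s) (\<zeta> ?b)) has_real_derivative energy N (Gt s) (\<zeta> ?b)) (at s within {?a..?b})"
        unfolding energy_def case_prod_unfold by (intro DERIV_sum) auto
      then show "((\<lambda>s. energy N (G s) (\<zeta> ?b)) has_vector_derivative energy N (Gt s) (\<zeta> ?b)) (at s within {?a..?b})"
        by (simp add: has_real_derivative_iff_has_vector_derivative)
    qed
  qed simp
  have t: "((\<lambda>s. Pt (Suc n) (grid_up T (Suc n) s) s) has_integral (\<Sum>j<Suc n. qt (Suc n) j)) {0..T}" for n
  proof (rule has_integral_grid[OF T])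
    fix j assume j: "j < Suc n"
    let ?a = "real j * T / real (Suc n)" and ?b = "real (Suc j) * T / real (Suc n)"
    have ba: "?b - ?a = T / real (Suc n)"
      unfolding diff_divide_distrib[symmetric] by (simp add: distrib_right)
    have a0: "?a \<ge> 0" using T by simp
    have "((\<lambda>s. tilt c N (G ?a) (\<zeta> ?b)) has_integral (?b - ?a) * tilt c N (G ?a) (\<zeta> ?b)) {?a..?b}"
      using has_integral_const_real[of "tilt c N (G ?a) (\<zeta> ?b)" ?a ?b] T by (simp add: divide_right_mono mult_right_mono)
    moreover have "max 0 (?b - T / real (Suc n)) = ?a" using ba a0 by linarith
    ultimately show "(Pt (Suc n) ?b has_integral qt (Suc n) j) {?a..?b}"
      unfolding Pt_def qt_def ba by simp
  qed simp
  have le: "\<bar>Pe (grid_up T (Suc n) s) s\<bar> \<le> Ct * real m" if "s \<in> {0..T}" for n s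
    unfolding Pe_def using gu[OF that, of n] that
    by (intro energy_bound \<zeta> Ct(1)) (auto simp: V_def intro!: Ct(2))
  have lt: "\<bar>Pt (Suc n) (grid_up T (Suc n) s) s\<bar> \<le> exp (C * real m) * (2 * (real N + b) * real m) * exp (C * real m)"
    if "s \<in> {0..T}" for n s
  proof -
    have "max 0 (grid_up T (Suc n) s - T / real (Suc n)) \<in> {0..T}"
      using gu[OF that, of n] T by auto (smt (verit) divide_nonneg_nonneg of_nat_0_le_iff)
    then show ?thesis
      unfolding Pt_def using gu[OF that, of n] that
      by (intro tilt_bound \<zeta> C(1)) (auto simp: V_def intro!: C(2))
  qed
  have ce: "(\<lambda>n. Pe (grid_up T (Suc n) s) s) \<longlonglongrightarrow> energy N (Gt s) (\<zeta> s)" if "s \<in> {0..T}" for s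
    by (rule tendsto_eventually) (use ev[OF that] in \<open>auto elim!: eventually_mono simp: Pe_def\<close>)
  have ct: "(\<lambda>n. Pt (Suc n) (grid_up T (Suc n) s) s) \<longlonglongrightarrow> tilt c N (G s) (\<zeta> s)" if s: "s \<in> {0..T}" for s
  proof -
    have "continuous_on {0..T} (\<lambda>t. tilt c N (G t) (\<zeta> s))"
      unfolding tilt_def case_prod_unfold
      using continuous_TV_time[OF G] sites_spins sites_flip[THEN sites_spins]
      by (intro continuous_intros) auto
    moreover have "(\<lambda>n. max 0 (grid_up T (Suc n) s - T / real (Suc n))) \<longlonglongrightarrow> s"
    proof -
      have "(\<lambda>n. max 0 (grid_up T (Suc n) s - T / real (Suc n))) \<longlonglongrightarrow> max 0 (s - 0)"
        by (intro tendsto_intros grid_up_tendsto[OF T] LIMSEQ_Suc[OF lim_const_over_n])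
      then show ?thesis using s by simp
    qed
    moreover have "max 0 (grid_up T (Suc n) s - T / real (Suc n)) \<in> {0..T}" for n
      using gu[OF that, of n] T by auto (smt (verit) divide_nonneg_nonneg of_nat_0_le_iff)
    ultimately have "(\<lambda>n. tilt c N (G (max 0 (grid_up T (Suc n) s - T / real (Suc n)))) (\<zeta> s)) \<longlonglongrightarrow> tilt c N (G s) (\<zeta> s)"
      using s by (intro continuous_on_tendsto_compose[of "{0..T}" "\<lambda>t. tilt c N (G t) (\<zeta> s)"]) auto
    then show ?thesis
      by (rule Lim_transform_eventually) (use ev[OF s] in \<open>auto elim!: eventually_mono simp: Pt_def\<close>)
  qed
  have hc: "(\<lambda>_. x) integrable_on {0..T}" for x :: real by (rule integrable_const_ivl)
  note DE = dominated_convergence[of "\<lambda>n s. Pe (grid_up T (Suc n) s) s" "{0..T}" "\<lambda>_. Ct * real m" "\<lambda>s. energy N (Gt s) (\<zeta> s)",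
      OF has_integral_integrable[OF e] hc, simplified real_norm_def, OF le ce]
  note DT = dominated_convergence[of "\<lambda>n s. Pt (Suc n) (grid_up T (Suc n) s) s" "{0..T}"
      "\<lambda>_. exp (C * real m) * (2 * (real N + b) * real m) * exp (C * real m)" "\<lambda>s. tilt c N (G s) (\<zeta> s)",
      OF has_integral_integrable[OF t] hc, simplified real_norm_def, OF lt ct]
  show "(\<lambda>s. energy N (Gt s) (\<zeta> s)) integrable_on {0..T}" by (rule DE(1))
  show "(\<lambda>s. tilt c N (G s) (\<zeta> s)) integrable_on {0..T}" by (rule DT(1))
  have eq: "log_mart c N T G (Suc n) \<zeta> = energy N (G T) (\<zeta> T) - energy N (G 0) (\<zeta> 0)
      - integral {0..T} (\<lambda>s. Pe (grid_up T (Suc n) s) s) - integral {0..T} (\<lambda>s. Pt (Suc n) (grid_up T (Suc n) s) s)" for n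
  proof -
    let ?H = "\<lambda>j. energy N (G (real j * T / real (Suc n))) (\<zeta> (real j * T / real (Suc n)))"
    have "log_mart c N T G (Suc n) \<zeta> = (\<Sum>j<Suc n. ?H (Suc j) - ?H j) - (\<Sum>j<Suc n. qe (Suc n) j) - (\<Sum>j<Suc n. qt (Suc n) j)"
      unfolding log_mart_def qe_def qt_def sum_subtractf[symmetric] by (intro sum.cong) auto
    also have "(\<Sum>j<Suc n. ?H (Suc j) - ?H j) = ?H (Suc n) - ?H 0"
      by (rule sum_lessThan_telescope)
    finally show ?thesis using integral_unique[OF e[of n]] integral_unique[OF t[of n]] by (simp del: of_nat_Suc)
  qed
  show "(\<lambda>n. log_mart c N T G (Suc n) \<zeta>) \<longlonglongrightarrow> energy N (G T) (\<zeta> T) - energy N (G 0) (\<zeta> 0)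
      - integral {0..T} (\<lambda>s. energy N (Gt s) (\<zeta> s)) - integral {0..T} (\<lambda>s. tilt c N (G s) (\<zeta> s))"
    unfolding eq by (intro tendsto_diff tendsto_const DE(2) DT(2))
qed

section \<open>From the tilted generator to the path functional\<close>

lemma magnetization_empirical_measure:
  assumes "N \<ge> 1"
  shows "magnetization (empirical_measure N \<xi>) = magnetization_N N \<xi>"
proof -
  have s: "(\<Sum>(x, \<sigma>)\<in>sites N. real (\<xi> (x, \<sigma>)) * (of_bool (\<sigma> = 1) - of_bool (\<sigma> = -1)))
      = (\<Sum>x\<in>{0..<int N}. real (\<xi> (x, 1)) - real (\<xi> (x, -1)))"
    using sum.cartesian_product[of "\<lambda>x \<sigma>. real (\<xi> (x, \<sigma>)) * (of_bool (\<sigma> = 1) - of_bool (\<sigma> = -1))" spins "{0..<int N}"]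
    by (simp add: sites_def spins_def)
  have "pairing (empirical_measure N \<xi>) spin = 1 / real N * (\<Sum>x\<in>{0..<int N}. real (\<xi> (x, 1)) - real (\<xi> (x, -1)))"
    using s by (simp add: pairing_empirical_measure[OF assms continuous_V_measurable[OF spin_continuous_V]])
  moreover have "mass (empirical_measure N \<xi>) = 1 / real N * real (\<Sum>v\<in>sites N. \<xi> v)"
    by (simp add: pairing_empirical_measure[OF assms] case_prod_unfold)
  ultimately show ?thesis
    using assms unfolding magnetization_def magnetization_N_def by simp
qed

lemma (in flip_rates) flip_pairing_empirical_measure:
  assumes "N \<ge> 1" "w \<in> continuous_V"
  shows "real N * flip_pairing (empirical_measure N \<xi>) w
    = (\<Sum>(x, \<sigma>)\<in>sites N. c \<sigma> (magnetization_N N \<xi>) * real (\<xi> (x, \<sigma>)) * w (x / real N, \<sigma>))"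
  unfolding flip_pairing_def magnetization_empirical_measure[OF assms(1)]
    pairing_empirical_energy[OF assms(1) flip_test_continuous_V[OF assms(2)]] energy_def
  by (simp add: case_prod_unfold mult_ac)

text \<open>Second-order Taylor expansion in the jump \<open>\<sigma> / N\<close>, followed by
  \<open>exp u \<le> 1 + u + u\<^sup>2\<close>; the condition on \<open>N\<close> ensures
  \<open>\<bar>u\<bar> \<le> 1\<close>. Multiplied by the jump rate \<open>N\<close>, the
  first-order term becomes a derivative and the second-order terms are of order
  \<open>1 / N\<close>.\<close>

lemma jump_exponent_le:
  fixes g g' g'' :: "real \<Rightarrow> real"
  assumes g: "\<And>x. (g has_real_derivative g' x) (at x)" "\<And>x. (g' has_real_derivative g'' x) (at x)"
    and C: "\<And>x. x \<in> {-1..2} \<Longrightarrow> \<bar>g' x\<bar> \<le> C1" "\<And>x. x \<in> {-1..2} \<Longrightarrow> \<bar>g'' x\<bar> \<le> C2"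
    and N: "N \<ge> 1" "real N \<ge> C1 + C2" and y: "y \<in> {0..1}" and \<sigma>: "\<bar>\<sigma>\<bar> = 1"
  shows "real N * (exp (g (y + \<sigma> / real N) - g y) - 1) \<le> \<sigma> * g' y + (C2 + (C1 + C2)\<^sup>2) / real N"
proof -
  define h where "h = \<sigma> / real N"
  have h: "\<bar>h\<bar> = 1 / real N" "h \<noteq> 0" "\<bar>h\<bar> \<le> 1" "real N * h = \<sigma>" using \<sigma> N by (auto simp: h_def abs_divide)
  have mem: "y + h \<in> {-1..2}" using y h(3) by auto
  define D where "D m = (if m = 0 then g else if m = 1 then g' else g'')" for m :: nat
  have D0: "D 0 = g" by (simp add: D_def)
  have Dd: "\<forall>m t. m < 2 \<and> -1 \<le> t \<and> t \<le> 2 \<longrightarrow> (D m has_real_derivative D (Suc m) t) (at t)"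
    using g by (auto simp: D_def less_2_cases_iff)
  obtain t where t: "if y + h < y then y + h < t \<and> t < y else y < t \<and> t < y + h"
    "g (y + h) = (\<Sum>m<2. (D m y / fact m) * (y + h - y)^m) + (D 2 t / fact 2) * (y + h - y)^2"
    using Taylor[of 2 D g "-1" 2 y "y + h"] Dd mem y h(2) D0 by auto
  define u where "u = g (y + h) - g y"
  have u: "u = g' y * h + g'' t / 2 * h\<^sup>2"
    using t(2) by (simp add: u_def D_def numeral_2_eq_2)
  have "t \<in> {-1..2}" using t(1) mem y by (auto split: if_splits)
  then have g2: "\<bar>g'' t\<bar> \<le> C2" and g1: "\<bar>g' y\<bar> \<le> C1" using C y by auto
  have h2: "h\<^sup>2 \<le> \<bar>h\<bar>" using h(3) mult_left_le[of "\<bar>h\<bar>" "\<bar>h\<bar>"] by (simp add: power2_eq_square flip: abs_mult)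
  have q: "\<bar>g'' t / 2 * h\<^sup>2\<bar> \<le> C2 * h\<^sup>2"
  proof -
    have "\<bar>g'' t\<bar> / 2 \<le> C2" using g2 by linarith
    from mult_right_mono[OF this, of "h\<^sup>2"] show ?thesis by (simp add: abs_mult)
  qed
  have "\<bar>u\<bar> \<le> \<bar>g' y\<bar> * \<bar>h\<bar> + C2 * h\<^sup>2"
    unfolding u using q by (intro order_trans[OF abs_triangle_ineq]) (simp add: abs_mult)
  also have "\<dots> \<le> C1 * \<bar>h\<bar> + C2 * \<bar>h\<bar>"
    using g1 g2 h2 by (intro add_mono mult_mono) auto
  finally have uh: "\<bar>u\<bar> \<le> (C1 + C2) * \<bar>h\<bar>" by (simp add: algebra_simps)
  also have "\<dots> \<le> 1" unfolding h(1) using N by (simp add: pos_divide_le_eq)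
  finally have "exp u \<le> 1 + u + u\<^sup>2" by (rule exp_le_quadratic)
  moreover have "u\<^sup>2 \<le> (C1 + C2)\<^sup>2 * h\<^sup>2"
    using power_mono[OF uh abs_ge_zero, of 2] by (simp add: power_mult_distrib)
  ultimately have "exp u - 1 \<le> g' y * h + (C2 + (C1 + C2)\<^sup>2) * h\<^sup>2"
    using q unfolding u by (simp add: algebra_simps abs_le_iff)
  then have "real N * (exp u - 1) \<le> real N * (g' y * h + (C2 + (C1 + C2)\<^sup>2) * h\<^sup>2)"
    by (intro mult_left_mono) auto
  also have "\<dots> = (real N * h) * g' y + (C2 + (C1 + C2)\<^sup>2) * (real N * h\<^sup>2)"
    by (simp add: algebra_simps)
  also have "real N * h\<^sup>2 = 1 / real N"
  proof -
    have "h\<^sup>2 = (1 / real N)\<^sup>2" by (simp flip: h(1))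
    then show ?thesis using N by (simp add: power2_eq_square)
  qed
  finally show ?thesis unfolding h(4) by (simp add: u_def h_def)
qed

text \<open>The accelerated jumps produce the drift \<open>\<sigma> * \<psi>'\<close> with an error
  of order \<open>1 / N\<close> per particle, hence a multiple of the mass without a factor
  \<open>N\<close>. The flip part is reproduced exactly. An upper bound is the useful direction
  because the tilt enters the martingale with a minus sign.\<close>

lemma (in flip_rates) tilt_le:
  fixes \<psi> :: "real \<times> int \<Rightarrow> real"
  assumes \<psi>: "\<And>x \<sigma>. \<sigma> \<in> spins \<Longrightarrow> \<psi> (x + 1, \<sigma>) = \<psi> (x, \<sigma>)"
    and g: "\<And>x \<sigma>. \<sigma> \<in> spins \<Longrightarrow> ((\<lambda>y. \<psi> (y, \<sigma>)) has_real_derivative \<psi>' (x, \<sigma>)) (at x)"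
      "\<And>x \<sigma>. \<sigma> \<in> spins \<Longrightarrow> ((\<lambda>y. \<psi>' (y, \<sigma>)) has_real_derivative \<psi>'' (x, \<sigma>)) (at x)"
    and C: "\<And>x \<sigma>. x \<in> {-1..2} \<Longrightarrow> \<sigma> \<in> spins \<Longrightarrow> \<bar>\<psi>' (x, \<sigma>)\<bar> \<le> C1"
      "\<And>x \<sigma>. x \<in> {-1..2} \<Longrightarrow> \<sigma> \<in> spins \<Longrightarrow> \<bar>\<psi>'' (x, \<sigma>)\<bar> \<le> C2"
    and N: "N \<ge> 1" "real N \<ge> C1 + C2"
    and w: "w \<in> continuous_V" "\<And>x \<sigma>. w (x, \<sigma>) = exp (- real_of_int \<sigma> * (\<psi> (x, 1) - \<psi> (x, -1))) - 1"
  shows "tilt c N \<psi> \<xi> \<le> energy N (\<lambda>(x, \<sigma>). real_of_int \<sigma> * \<psi>' (x, \<sigma>)) \<xi>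
    + (C2 + (C1 + C2)\<^sup>2) * mass (empirical_measure N \<xi>)
    + real N * flip_pairing (empirical_measure N \<xi>) w"
proof -
  \<comment> \<open>A jump can leave the fundamental domain at either end; periodicity of
    \<open>\<psi>\<close> absorbs the reduction modulo \<open>N\<close>.\<close>
  have jump: "\<psi> (real_of_int ((x + \<sigma>) mod int N) / real N, \<sigma>) = \<psi> (x / real N + real_of_int \<sigma> / real N, \<sigma>)"
    if v: "(x, \<sigma>) \<in> sites N" for x \<sigma>
  proof -
    have \<sigma>: "\<sigma> \<in> spins" using sites_spins[OF v] .
    consider "0 \<le> x + \<sigma>" "x + \<sigma> < int N" | "x + \<sigma> = int N" | "x + \<sigma> = -1"
    proof -
      have "\<sigma> = 1 \<or> \<sigma> = -1" "0 \<le> x" "x < int N" using v by (auto simp: sites_def spins_def)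
      then show thesis using that by linarith
    qed
    then show ?thesis
    proof cases
      case 1
      then show ?thesis by (simp add: add_divide_distrib)
    next
      case 2
      then have "x / real N + real_of_int \<sigma> / real N = 0 + 1"
        using N(1) by (simp flip: add_divide_distrib of_int_add)
      then show ?thesis using \<psi>[OF \<sigma>, of 0] 2 by simp
    next
      case 3
      have "(x + \<sigma>) mod int N = int N - 1"
        unfolding 3 using N(1) by (simp add: zmod_minus1)
      moreover have "real_of_int (int N - 1) / real N = (x / real N + real_of_int \<sigma> / real N) + 1"
        using N(1) by (simp add: 3 diff_divide_distrib flip: add_divide_distrib of_int_add)
      ultimately show ?thesis using \<psi>[OF \<sigma>] by metis
    qed
  qed
  let ?K = "C2 + (C1 + C2)\<^sup>2"
  let ?j = "\<lambda>x \<sigma>. exp (\<psi> (real_of_int ((x + \<sigma>) mod int N) / real N, \<sigma>) - \<psi> (x / real N, \<sigma>)) - 1"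
  let ?S = "\<Sum>(x, \<sigma>)\<in>sites N. real (\<xi> (x, \<sigma>)) * ?j x \<sigma>"
  have "real N * ?S
    \<le> (\<Sum>(x, \<sigma>)\<in>sites N. real (\<xi> (x, \<sigma>)) * (real_of_int \<sigma> * \<psi>' (x / real N, \<sigma>) + ?K / real N))"
    unfolding sum_distrib_left
  proof (rule sum_mono, clarify)
    fix x \<sigma> assume v: "(x, \<sigma>) \<in> sites N"
    have \<sigma>: "\<sigma> \<in> spins" using sites_spins[OF v] .
    have "real N * (exp (\<psi> (x / real N + real_of_int \<sigma> / real N, \<sigma>) - \<psi> (x / real N, \<sigma>)) - 1)
        \<le> real_of_int \<sigma> * \<psi>' (x / real N, \<sigma>) + ?K / real N"
      using sites_div_mem[OF v] \<sigma>
      by (intro jump_exponent_le[of "\<lambda>y. \<psi> (y, \<sigma>)" "\<lambda>y. \<psi>' (y, \<sigma>)" "\<lambda>y. \<psi>'' (y, \<sigma>)"] g C N) (auto simp: spins_def)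
    from mult_left_mono[OF this, of "real (\<xi> (x, \<sigma>))"]
    show "real N * (real (\<xi> (x, \<sigma>)) * ?j x \<sigma>)
        \<le> real (\<xi> (x, \<sigma>)) * (real_of_int \<sigma> * \<psi>' (x / real N, \<sigma>) + ?K / real N)"
      unfolding jump[OF v] by (simp add: mult.left_commute)
  qed
  also have "\<dots> = energy N (\<lambda>(x, \<sigma>). real_of_int \<sigma> * \<psi>' (x, \<sigma>)) \<xi> + ?K * mass (empirical_measure N \<xi>)"
    using N(1) by (simp add: pairing_empirical_measure energy_def case_prod_unfold distrib_left sum.distrib sum_distrib_left
      sum_divide_distrib add_divide_distrib mult_ac)
  also note 1 = calculation
  have 2: "(\<Sum>(x, \<sigma>)\<in>sites N. c \<sigma> (magnetization_N N \<xi>) * real (\<xi> (x, \<sigma>)) *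
       (exp (\<psi> (x / real N, -\<sigma>) - \<psi> (x / real N, \<sigma>)) - 1))
    = real N * flip_pairing (empirical_measure N \<xi>) w"
    unfolding flip_pairing_empirical_measure[OF N(1) w(1)]
    by (intro sum.cong refl) (auto simp: w(2) dest!: sites_spins simp: spins_def)
  show ?thesis unfolding tilt_def 2 using 1 by linarith
qed

text \<open>The energy of \<open>Gt s\<close> and the drift contained in the tilt add up to
  \<open>N\<close> times the pairing with \<open>transport T G\<close>. \<open>C\<close> and
  \<open>N\<^sub>0\<close> are fixed before \<open>N\<close>, \<open>m\<close> and the path, so the
  loss \<open>C * B\<close> disappears on dividing by \<open>N\<close>.\<close>

lemma (in flip_rates) log_mart_limit_ge:
  assumes T: "T > 0" and G: "G \<in> smooth_TV T" and \<phi>: "\<phi> \<in> continuous_V"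
  shows "\<exists>C N\<^sub>0. \<forall>N m \<zeta> B.
    N\<^sub>0 \<le> N \<and> 1 \<le> N \<and> (\<forall>t\<in>{0..T}. \<zeta> t \<in> configs_le N m) \<and> (\<forall>t\<in>{0..<T}. \<forall>\<^sub>F s in at_right t. \<zeta> s = \<zeta> t) \<and>
     (\<lambda>t\<in>{0..T}. empirical_measure N (\<zeta> t)) \<in> skorokhod_space T \<and>
     (\<forall>t\<in>{0..T}. mass (empirical_measure N (\<zeta> t)) \<le> B) \<longrightarrow>
    (\<exists>L. (\<lambda>n. log_mart c N T G (Suc n) \<zeta>) \<longlonglongrightarrow> L \<and>
      real N * path_functional T (\<lambda>v. \<phi> v - G 0 v) (G T) (transport T G) (flip_weight G) (\<lambda>t\<in>{0..T}. empirical_measure N (\<zeta> t))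
        - C * B \<le> energy N \<phi> (\<zeta> 0) + L)"
proof -
  obtain Gt Gx Gxx where Gc: "Gt \<in> continuous_TV T" "Gx \<in> continuous_TV T" "Gxx \<in> continuous_TV T"
    and dt: "\<And>t x \<sigma>. t \<in> {0..T} \<Longrightarrow> \<sigma> \<in> spins \<Longrightarrow>
      ((\<lambda>s. G s (x, \<sigma>)) has_real_derivative Gt t (x, \<sigma>)) (at t within {0..T})"
    and dx: "\<And>t x \<sigma>. t \<in> {0..T} \<Longrightarrow> \<sigma> \<in> spins \<Longrightarrow> ((\<lambda>y. G t (y, \<sigma>)) has_real_derivative Gx t (x, \<sigma>)) (at x)"
      "\<And>t x \<sigma>. t \<in> {0..T} \<Longrightarrow> \<sigma> \<in> spins \<Longrightarrow> ((\<lambda>y. Gx t (y, \<sigma>)) has_real_derivative Gxx t (x, \<sigma>)) (at x)"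
    and tr: "\<And>t x \<sigma>. t \<in> {0..T} \<Longrightarrow> \<sigma> \<in> spins \<Longrightarrow> transport T G t (x, \<sigma>) = Gt t (x, \<sigma>) + real_of_int \<sigma> * Gx t (x, \<sigma>)"
    by (rule smooth_TV_derivatives[OF G T]) (rule that)
  have Gcont: "G \<in> continuous_TV T" by (rule smooth_TV_continuous[OF G])
  obtain C1 where C1: "C1 \<ge> 0" "\<And>t x \<sigma>. t \<in> {0..T} \<Longrightarrow> x \<in> {-1..2} \<Longrightarrow> \<sigma> \<in> spins \<Longrightarrow> \<bar>Gx t (x, \<sigma>)\<bar> \<le> C1"
    using continuous_TV_bounded[OF Gc(2)] by metis
  obtain C2 where C2: "C2 \<ge> 0" "\<And>t x \<sigma>. t \<in> {0..T} \<Longrightarrow> x \<in> {-1..2} \<Longrightarrow> \<sigma> \<in> spins \<Longrightarrow> \<bar>Gxx t (x, \<sigma>)\<bar> \<le> C2"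
    using continuous_TV_bounded[OF Gc(3)] by metis
  have u: "transport T G \<in> continuous_TV T" by (rule transport_continuous[OF G T])
  have w: "flip_weight G \<in> continuous_TV T" by (rule flip_weight_continuous[OF Gcont])
  define K where "K = C2 + (C1 + C2)\<^sup>2"
  have K: "K \<ge> 0" using C2(1) by (simp add: K_def)
  obtain Cu where Cu: "Cu \<ge> 0" "\<forall>\<beta>\<in>measures_V. \<forall>t\<in>{0..T}. \<bar>pairing \<beta> (transport T G t)\<bar> \<le> Cu * mass \<beta>"
    by (rule pairing_TV_abs_le[OF u])
  obtain Cw where Cw: "Cw \<ge> 0" "\<forall>\<beta>\<in>measures_V. \<forall>t\<in>{0..T}. \<bar>flip_pairing \<beta> (flip_weight G t)\<bar> \<le> Cw * mass \<beta>"
    by (rule flip_pairing_TV_abs_le[OF w])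
  show ?thesis
  proof (rule exI[of _ "K * T"], rule exI[of _ "nat \<lceil>C1 + C2\<rceil>"], intro allI impI, elim conjE)
    fix N m \<zeta> B
    assume N0: "nat \<lceil>C1 + C2\<rceil> \<le> N" and N: "1 \<le> N"
      and \<zeta>0: "\<forall>t\<in>{0..T}. \<zeta> t \<in> configs_le N m" "\<forall>t\<in>{0..<T}. \<forall>\<^sub>F s in at_right t. \<zeta> s = \<zeta> t"
      and \<alpha>S: "(\<lambda>t\<in>{0..T}. empirical_measure N (\<zeta> t)) \<in> skorokhod_space T"
      and B0: "\<forall>t\<in>{0..T}. mass (empirical_measure N (\<zeta> t)) \<le> B"
    note \<zeta> = bspec[OF \<zeta>0(1)] bspec[OF \<zeta>0(2)] and B = bspec[OF B0]
    define \<alpha> where "\<alpha> = (\<lambda>t\<in>{0..T}. empirical_measure N (\<zeta> t))"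
    have \<alpha>: "\<alpha> \<in> skorokhod_space T" using \<alpha>S by (simp add: \<alpha>_def)
    have \<alpha>t: "\<alpha> t = empirical_measure N (\<zeta> t)" if "t \<in> {0..T}" for t using that by (simp add: \<alpha>_def)
    have \<alpha>B: "mass (\<alpha> t) \<le> B" if "t \<in> {0..T}" for t using B[OF that] \<alpha>t[OF that] by simp
    note \<alpha>m = skorokhod_space_measures[OF \<alpha>]
    have NC: "real N \<ge> C1 + C2" using N0 by linarith
    note lm = log_mart_tendsto[where G = G and Gt = Gt and m = m, OF T Gcont Gc(1) dt \<zeta>]
    have i1: "set_integrable lborel {0..T} (\<lambda>t. pairing (\<alpha> t) (transport T G t))"
      by (rule right_continuous_set_integrable[OF T right_continuous_pairing[OF \<alpha> u T]])
        (use Cu(2) \<alpha>m mult_left_mono[OF \<alpha>B Cu(1)] in \<open>blast intro: order_trans\<close>)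
    have i2: "set_integrable lborel {0..T} (\<lambda>t. flip_pairing (\<alpha> t) (flip_weight G t))"
      by (rule right_continuous_set_integrable[OF T right_continuous_flip_pairing[OF \<alpha> w T]])
        (use Cw(2) \<alpha>m mult_left_mono[OF \<alpha>B Cw(1)] in \<open>blast intro: order_trans\<close>)
    note h1 = set_borel_integral_eq_integral[OF i1] and h2 = set_borel_integral_eq_integral[OF i2]
    let ?R = "\<lambda>s. real N * pairing (\<alpha> s) (transport T G s) + real N * flip_pairing (\<alpha> s) (flip_weight G s) + K * B"
    have le: "energy N (Gt s) (\<zeta> s) + tilt c N (G s) (\<zeta> s) \<le> ?R s" if s: "s \<in> {0..T}" for s
    proof -
      have "tilt c N (G s) (\<zeta> s) \<le> energy N (\<lambda>(x, \<sigma>). real_of_int \<sigma> * Gx s (x, \<sigma>)) (\<zeta> s)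
          + K * mass (empirical_measure N (\<zeta> s))
          + real N * flip_pairing (empirical_measure N (\<zeta> s)) (flip_weight G s)"
        unfolding K_def
      proof (rule tilt_le[where \<psi>'' = "Gxx s"])
        show "G s (x + 1, \<sigma>) = G s (x, \<sigma>)" if "\<sigma> \<in> spins" for x \<sigma>
          using Gcont that s by (simp add: continuous_TV_def)
        show "flip_weight G s \<in> continuous_V" by (rule continuous_TV_slice[OF w s])
      qed (use dx[OF s] C1(2)[OF s] C2(2)[OF s] N NC in \<open>auto simp: flip_weight_def\<close>)
      moreover have "real N * pairing (empirical_measure N (\<zeta> s)) (transport T G s)
          = energy N (Gt s) (\<zeta> s) + energy N (\<lambda>(x, \<sigma>). real_of_int \<sigma> * Gx s (x, \<sigma>)) (\<zeta> s)"
        unfolding pairing_empirical_energy[OF N continuous_TV_slice[OF u s]] energy_add[symmetric]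
        by (rule energy_cong) (auto simp: V_def tr[OF s])
      moreover have "K * mass (empirical_measure N (\<zeta> s)) \<le> K * B"
        by (intro mult_left_mono B s K)
      ultimately show ?thesis by (simp add: \<alpha>t[OF s])
    qed
    let ?I1 = "LBINT t:{0..T}. pairing (\<alpha> t) (transport T G t)"
    let ?I2 = "LBINT t:{0..T}. flip_pairing (\<alpha> t) (flip_weight G t)"
    have "((\<lambda>t. pairing (\<alpha> t) (transport T G t)) has_integral ?I1) {0..T}"
      "((\<lambda>t. flip_pairing (\<alpha> t) (flip_weight G t)) has_integral ?I2) {0..T}"
      unfolding h1(2) h2(2) using h1(1) h2(1) by (blast intro: integrable_integral)+
    then have R: "(?R has_integral (real N * ?I1 + real N * ?I2 + T * (K * B))) {0..T}"
      using has_integral_const_real[of "K * B" 0 T] T by (intro has_integral_add has_integral_mult_right) simp_all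
    have L: "((\<lambda>s. energy N (Gt s) (\<zeta> s) + tilt c N (G s) (\<zeta> s)) has_integral
        (integral {0..T} (\<lambda>s. energy N (Gt s) (\<zeta> s)) + integral {0..T} (\<lambda>s. tilt c N (G s) (\<zeta> s)))) {0..T}"
      by (rule has_integral_add; rule integrable_integral; use lm(1,2) in blast)
    have int: "integral {0..T} (\<lambda>s. energy N (Gt s) (\<zeta> s)) + integral {0..T} (\<lambda>s. tilt c N (G s) (\<zeta> s))
        \<le> real N * ?I1 + real N * ?I2 + K * B * T"
      using has_integral_le[OF L R le] by (simp add: mult_ac)
    have T0: "0 \<in> {0..T}" "T \<in> {0..T}" using T by auto
    have G0: "G 0 \<in> continuous_V" "G T \<in> continuous_V" using continuous_TV_slice[OF Gcont] T0 by auto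
    have \<phi>0: "(\<lambda>v. \<phi> v - G 0 v) \<in> continuous_V"
      using \<phi> G0(1) by (auto simp: continuous_V_def intro!: continuous_intros)
    let ?J = "path_functional T (\<lambda>v. \<phi> v - G 0 v) (G T) (transport T G) (flip_weight G)"
    have "real N * ?J \<alpha>
      = energy N \<phi> (\<zeta> 0) - energy N (G 0) (\<zeta> 0) + energy N (G T) (\<zeta> T)
        - real N * (LBINT t:{0..T}. pairing (\<alpha> t) (transport T G t))
        - real N * (LBINT t:{0..T}. flip_pairing (\<alpha> t) (flip_weight G t))"
      unfolding path_functional_def right_diff_distrib distrib_left \<alpha>t[OF T0(1)] \<alpha>t[OF T0(2)]
        pairing_empirical_energy[OF N \<phi>0] pairing_empirical_energy[OF N G0(2)] energy_diff by simp
    then have "real N * ?J \<alpha> - K * T * B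
        \<le> energy N \<phi> (\<zeta> 0) + (energy N (G T) (\<zeta> T) - energy N (G 0) (\<zeta> 0)
      - integral {0..T} (\<lambda>s. energy N (Gt s) (\<zeta> s)) - integral {0..T} (\<lambda>s. tilt c N (G s) (\<zeta> s)))"
      using int by (simp add: mult_ac)
    moreover have "(\<lambda>n. log_mart c N T G (Suc n) \<zeta>) \<longlonglongrightarrow> energy N (G T) (\<zeta> T) - energy N (G 0) (\<zeta> 0)
      - integral {0..T} (\<lambda>s. energy N (Gt s) (\<zeta> s)) - integral {0..T} (\<lambda>s. tilt c N (G s) (\<zeta> s))"
      using lm(3) by blast
    ultimately show "\<exists>L. (\<lambda>n. log_mart c N T G (Suc n) \<zeta>) \<longlonglongrightarrow> L \<and>
      real N * ?J (\<lambda>t\<in>{0..T}. empirical_measure N (\<zeta> t))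
        - K * T * B \<le> energy N \<phi> (\<zeta> 0) + L"
      unfolding \<alpha>_def by blast
  qed
qed

text \<open>The exponential of \<open>log_mart\<close>, cut off to at most \<open>m\<close>
  particles at the grid times. The term \<open>K / real (Suc n)\<close> pays for the second-order
  errors of \<open>n + 1\<close> steps of length \<open>T / (n + 1)\<close>.\<close>

definition grid_mart where
  "grid_mart c N m T G F K n \<zeta> = indicator (configs_le N m) (\<zeta> 0) *
     (\<Prod>j<Suc n. indicator (configs_le N m) (\<zeta> (real (Suc j) * T / real (Suc n)))) *
     exp (F (\<zeta> 0) + log_mart c N T G (Suc n) \<zeta> - K / real (Suc n))"

context flip_rates
begin

text \<open>\<open>grid_mart\<close> is the product in
  \<open>particle_process_markov_product\<close>, and \<open>semigroup_N_exp_le\<close> bounds each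
  step, with \<open>H\<close> and \<open>V\<close> the energy and the tilt for the test function at
  the left end of the cell. The inequality holds once the mesh is below
  \<open>\<delta>\<^sub>0\<close>; \<open>K\<close> may depend on \<open>N\<close> and
  \<open>m\<close>, which stay fixed as the mesh shrinks.\<close>

lemma exponential_supermartingale:
  assumes pp: "particle_process c T N M \<eta>" and T: "T > 0" and G: "G \<in> continuous_TV T"
  obtains K where "\<And>F. \<forall>\<^sub>F n in sequentially.
    (\<integral>\<^sup>+\<omega>. ennreal (grid_mart c N m T G F K n (\<lambda>t. \<eta> t \<omega>)) \<partial>M)
    \<le> (\<integral>\<^sup>+\<omega>. ennreal (exp (F (\<eta> 0 \<omega>))) \<partial>M)"
proof -
  let ?A = "configs_le N m"
  obtain C where C: "C \<ge> 0" "\<And>t x \<sigma>. t \<in> {0..T} \<Longrightarrow> x \<in> {-1..2} \<Longrightarrow> \<sigma> \<in> spins \<Longrightarrow> \<bar>G t (x, \<sigma>)\<bar> \<le> C"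
    using continuous_TV_bounded[OF G] by metis
  have CV: "\<bar>G t v\<bar> \<le> C" if "t \<in> {0..T}" "v \<in> V" for t v
    using that by (auto simp: V_def intro!: C)
  \<comment> \<open>The bound from \<open>tilt_bound\<close>, uniform over all grid times.\<close>
  define v where "v = exp (C * real m) * (2 * (real N + b) * real m) * exp (C * real m)"
  obtain K \<delta>\<^sub>0 where \<delta>0: "\<delta>\<^sub>0 > 0" and K: "\<And>H V \<delta> \<xi>.
    \<forall>\<zeta>\<in>?A. \<bar>H \<zeta>\<bar> \<le> C * real m \<and> \<bar>V \<zeta>\<bar> \<le> v \<and> generator c N (\<lambda>\<xi>. exp (H \<xi>)) \<zeta> = V \<zeta> * exp (H \<zeta>) \<Longrightarrow>
    0 \<le> \<delta> \<Longrightarrow> \<delta> \<le> \<delta>\<^sub>0 \<Longrightarrow> \<xi> \<in> ?A \<Longrightarrow>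
    semigroup_N c N \<delta> (\<lambda>\<xi>. indicator ?A \<xi> * exp (H \<xi> - \<delta> * V \<xi>)) \<xi> \<le> exp (H \<xi> + K * \<delta>\<^sup>2)"
    using semigroup_N_exp_le[of N m "C * real m" v] by blast
  have "\<forall>\<^sub>F n in sequentially.
    (\<integral>\<^sup>+\<omega>. ennreal (grid_mart c N m T G F (K * T\<^sup>2) n (\<lambda>t. \<eta> t \<omega>)) \<partial>M)
    \<le> (\<integral>\<^sup>+\<omega>. ennreal (exp (F (\<eta> 0 \<omega>))) \<partial>M)" for F
  proof -
    have "\<forall>\<^sub>F n in sequentially. T / real (Suc n) < \<delta>\<^sub>0"
      using LIMSEQ_Suc[OF lim_const_over_n[of T]] \<delta>0 by (rule order_tendstoD)
    then show ?thesis
    proof eventually_elim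
      case (elim n)
      define d where "d = T / real (Suc n)"
      have d: "d \<ge> 0" "real (Suc n) * d = T" "d \<le> \<delta>\<^sub>0"
        using T elim by (auto simp: d_def)
      have td: "real j * d = real j * T / real (Suc n)" for j by (simp add: d_def)
      define H where "H j = energy N (G (real j * d))" for j
      define W where "W j = tilt c N (G (real j * d))" for j
      define f where "f j \<xi> = indicator ?A \<xi> * exp (H j \<xi> - d * W j \<xi>)" for j \<xi>
      define E where "E j \<xi> = exp (H j \<xi> + K * d\<^sup>2)" for j \<xi>
      define g where "g \<xi> = indicator ?A \<xi> * exp (F \<xi>)" for \<xi>
      have step: "semigroup_N c N d (f j) \<xi> \<le> E j \<xi>" if "j < Suc n" "\<xi> \<in> ?A" for j \<xi>
      proof -
        have "real j * d \<le> real (Suc n) * d" using that(1) d(1) by (intro mult_right_mono) auto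
        then have j: "real j * d \<in> {0..T}" using d(1,2) by simp
        show ?thesis
          unfolding f_def E_def
        proof (rule K[OF _ d(1,3) that(2)], intro ballI conjI)
          fix \<zeta> assume \<zeta>: "\<zeta> \<in> ?A"
          show "\<bar>H j \<zeta>\<bar> \<le> C * real m"
            unfolding H_def using \<zeta> CV[OF j] C(1) by (rule energy_bound)
          show "\<bar>W j \<zeta>\<bar> \<le> v"
            unfolding W_def v_def using \<zeta> CV[OF j] C(1) by (rule tilt_bound)
          show "generator c N (\<lambda>\<xi>. exp (H j \<xi>)) \<zeta> = W j \<zeta> * exp (H j \<zeta>)"
            unfolding H_def W_def by (rule generator_exp_energy)
        qed
      qed
      have "(\<integral>\<^sup>+\<omega>. ennreal (g (\<eta> 0 \<omega>) * (\<Prod>j<Suc n. f j (\<eta> (real (Suc j) * d) \<omega>) / E j (\<eta> (real j * d) \<omega>))) \<partial>M)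
          \<le> (\<integral>\<^sup>+\<omega>. ennreal (g (\<eta> 0 \<omega>)) \<partial>M)"
        by (rule particle_process_markov_product[OF pp finite_configs_le[of N m] d(1) _ _ _ _ _ _ step])
          (use d(2) in \<open>auto simp: f_def g_def E_def\<close>)
      also have "\<dots> \<le> (\<integral>\<^sup>+\<omega>. ennreal (exp (F (\<eta> 0 \<omega>))) \<partial>M)"
        by (intro nn_integral_mono ennreal_leI) (simp add: g_def indicator_def)
      also have "(\<lambda>\<omega>. g (\<eta> 0 \<omega>) * (\<Prod>j<Suc n. f j (\<eta> (real (Suc j) * d) \<omega>) / E j (\<eta> (real j * d) \<omega>)))
        = (\<lambda>\<omega>. grid_mart c N m T G F (K * T\<^sup>2) n (\<lambda>t. \<eta> t \<omega>))"
      proof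
        fix \<omega>
        let ?e = "\<lambda>j. H j (\<eta> (real (Suc j) * d) \<omega>) - d * W j (\<eta> (real (Suc j) * d) \<omega>) - H j (\<eta> (real j * d) \<omega>)"
        have "(\<Prod>j<Suc n. f j (\<eta> (real (Suc j) * d) \<omega>) / E j (\<eta> (real j * d) \<omega>))
          = (\<Prod>j<Suc n. indicator ?A (\<eta> (real (Suc j) * d) \<omega>) * exp (?e j - K * d\<^sup>2))"
        proof -
          have "i * exp x / exp (y + z) = i * exp (x - y - z)" for i x y z :: real
            by (simp add: exp_diff exp_add)
          then show ?thesis unfolding f_def E_def by simp
        qed
        also have "\<dots> = (\<Prod>j<Suc n. indicator ?A (\<eta> (real (Suc j) * d) \<omega>)) * exp (\<Sum>j<Suc n. ?e j - K * d\<^sup>2)"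
          by (simp only: prod.distrib exp_sum[OF finite_lessThan])
        also have "(\<Sum>j<Suc n. ?e j - K * d\<^sup>2) = (\<Sum>j<Suc n. ?e j) - real (Suc n) * (K * d\<^sup>2)"
          by (simp only: sum_subtractf sum_constant card_lessThan)
        also have "real (Suc n) * (K * d\<^sup>2) = K * T\<^sup>2 / real (Suc n)"
          by (simp add: d_def power2_eq_square)
        also have "(\<Sum>j<Suc n. ?e j) = log_mart c N T G (Suc n) (\<lambda>t. \<eta> t \<omega>)"
          unfolding log_mart_def H_def W_def td by (simp only: d_def)
        finally show "g (\<eta> 0 \<omega>) * (\<Prod>j<Suc n. f j (\<eta> (real (Suc j) * d) \<omega>) / E j (\<eta> (real j * d) \<omega>))
          = grid_mart c N m T G F (K * T\<^sup>2) n (\<lambda>t. \<eta> t \<omega>)"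
          unfolding g_def td grid_mart_def by (simp add: exp_add exp_diff mult_ac)
      qed
      finally show ?case .
    qed
  qed
  then show thesis by (rule that[of "K * T\<^sup>2"])
qed

text \<open>Fatou's lemma along the grids and Markov's inequality; the event need not be measurable.\<close>

lemma exponential_tail:
  assumes pp: "particle_process c T N M \<eta>" and T: "T > 0" and G: "G \<in> continuous_TV T"
  obtains S where "S \<in> sets M"
    "{\<omega> \<in> space M. (\<forall>t\<in>{0..T}. \<eta> t \<omega> \<in> configs_le N m) \<and>
      (\<exists>L. (\<lambda>n. log_mart c N T G (Suc n) (\<lambda>t. \<eta> t \<omega>)) \<longlonglongrightarrow> L \<and> y \<le> F (\<eta> 0 \<omega>) + L)} \<subseteq> S"
    "emeasure M S \<le> ennreal (exp (- y)) * (\<integral>\<^sup>+\<omega>. ennreal (exp (F (\<eta> 0 \<omega>))) \<partial>M)"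
proof -
  let ?A = "configs_le N m"
  obtain K where K: "\<And>F. \<forall>\<^sub>F n in sequentially.
    (\<integral>\<^sup>+\<omega>. ennreal (grid_mart c N m T G F K n (\<lambda>t. \<eta> t \<omega>)) \<partial>M)
    \<le> (\<integral>\<^sup>+\<omega>. ennreal (exp (F (\<eta> 0 \<omega>))) \<partial>M)"
    by (rule exponential_supermartingale[OF pp T G, of m]) (rule that)
  define Z where "Z n \<omega> = ennreal (grid_mart c N m T G F K n (\<lambda>t. \<eta> t \<omega>))" for n \<omega>
  have meas: "(\<lambda>\<omega>. x (\<eta> t \<omega>)) \<in> borel_measurable M" if "t \<in> {0..T}" for t and x :: "config \<Rightarrow> real"
  proof -
    have "\<eta> t \<in> M \<rightarrow>\<^sub>M count_space UNIV" using pp that unfolding particle_process_def by blast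
    from measurable_compose[OF this, of x borel] show ?thesis by simp
  qed
  have Zm: "Z n \<in> borel_measurable M" for n
  proof -
    have t: "real j * T / real (Suc n) \<in> {0..T}" if "j \<le> Suc n" for j
      using grid_mem[OF T _ that] by simp
    have m: "(\<lambda>\<omega>. x (\<eta> (real j * T / real (Suc n)) \<omega>)) \<in> borel_measurable M" if "j \<le> Suc n" for j and x :: "config \<Rightarrow> real"
      using meas[OF t[OF that]] .
    have "(\<lambda>\<omega>. log_mart c N T G (Suc n) (\<lambda>t. \<eta> t \<omega>)) \<in> borel_measurable M"
      unfolding log_mart_def
      by (intro borel_measurable_sum borel_measurable_diff borel_measurable_times borel_measurable_const m) auto
    moreover have "(\<lambda>\<omega>. \<Prod>j<Suc n. indicator ?A (\<eta> (real (Suc j) * T / real (Suc n)) \<omega>) :: real) \<in> borel_measurable M"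
      by (intro borel_measurable_prod m) auto
    moreover have "(\<lambda>\<omega>. x (\<eta> 0 \<omega>)) \<in> borel_measurable M" for x :: "config \<Rightarrow> real"
      using meas[of 0] T by simp
    ultimately show ?thesis
      unfolding Z_def grid_mart_def by measurable
  qed
  define R where "R = (\<integral>\<^sup>+\<omega>. ennreal (exp (F (\<eta> 0 \<omega>))) \<partial>M)"
  define l where "l \<omega> = liminf (\<lambda>n. Z n \<omega>)" for \<omega>
  have lm: "l \<in> borel_measurable M" unfolding l_def using Zm by (intro borel_measurable_liminf)
  have "(\<integral>\<^sup>+\<omega>. l \<omega> \<partial>M) \<le> liminf (\<lambda>n. \<integral>\<^sup>+\<omega>. Z n \<omega> \<partial>M)"
    unfolding l_def using Zm by (intro nn_integral_liminf)
  also have "\<dots> \<le> R"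
    unfolding R_def Z_def using K[of F] by (intro Liminf_le) auto
  finally have lR: "(\<integral>\<^sup>+\<omega>. l \<omega> \<partial>M) \<le> R" .
  \<comment> \<open>On the event in question \<open>l\<close> equals
    \<open>exp (F (\<eta> 0 \<omega>) + L) \<ge> exp y\<close>, so this superlevel set of a
    measurable function contains it.\<close>
  define S where "S = {\<omega> \<in> space M. 1 \<le> ennreal (exp (- y)) * l \<omega>}"
  show thesis
  proof (rule that[of S])
    show "S \<in> sets M" unfolding S_def using lm by measurable
    have "emeasure M S \<le> ennreal (exp (- y)) * (\<integral>\<^sup>+\<omega>. l \<omega> * indicator (space M) \<omega> \<partial>M)"
      unfolding S_def using lm by (intro nn_integral_Markov_inequality) auto
    also have "(\<integral>\<^sup>+\<omega>. l \<omega> * indicator (space M) \<omega> \<partial>M) = (\<integral>\<^sup>+\<omega>. l \<omega> \<partial>M)"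
      by (intro nn_integral_cong) auto
    also have "ennreal (exp (- y)) * \<dots> \<le> ennreal (exp (- y)) * R"
      using lR by (intro mult_left_mono) auto
    finally show "emeasure M S \<le> ennreal (exp (- y)) * (\<integral>\<^sup>+\<omega>. ennreal (exp (F (\<eta> 0 \<omega>))) \<partial>M)"
      by (simp add: R_def)
    show "{\<omega> \<in> space M. (\<forall>t\<in>{0..T}. \<eta> t \<omega> \<in> ?A) \<and>
      (\<exists>L. (\<lambda>n. log_mart c N T G (Suc n) (\<lambda>t. \<eta> t \<omega>)) \<longlonglongrightarrow> L \<and> y \<le> F (\<eta> 0 \<omega>) + L)} \<subseteq> S"
    proof clarify
      fix \<omega> L assume \<omega>: "\<omega> \<in> space M" and A: "\<forall>t\<in>{0..T}. \<eta> t \<omega> \<in> ?A"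
        and L: "(\<lambda>n. log_mart c N T G (Suc n) (\<lambda>t. \<eta> t \<omega>)) \<longlonglongrightarrow> L" "y \<le> F (\<eta> 0 \<omega>) + L"
      have t: "real (Suc j) * T / real (Suc n) \<in> {0..T}" if "j < Suc n" for j n
        using grid_mem[OF T, of "Suc n" "Suc j"] that by simp
      have Z: "Z n \<omega> = ennreal (exp (F (\<eta> 0 \<omega>) + log_mart c N T G (Suc n) (\<lambda>t. \<eta> t \<omega>) - K / real (Suc n)))" for n
      proof -
        have "(\<Prod>j<Suc n. indicator ?A (\<eta> (real (Suc j) * T / real (Suc n)) \<omega>)) = (1 :: real)"
          by (rule prod.neutral) (use A t in \<open>auto simp del: of_nat_Suc\<close>)
        moreover have "\<eta> 0 \<omega> \<in> ?A" using A T by auto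
        ultimately show ?thesis unfolding Z_def grid_mart_def by simp
      qed
      \<comment> \<open>The correction \<open>K / real (Suc n)\<close> vanishes with the mesh, which
        is why its dependence on \<open>N\<close> and \<open>m\<close> leaves no trace.\<close>
      have "(\<lambda>n. Z n \<omega>) \<longlonglongrightarrow> ennreal (exp (F (\<eta> 0 \<omega>) + L - 0))"
        unfolding Z by (intro tendsto_intros L(1) LIMSEQ_Suc[OF lim_const_over_n])
      then have "l \<omega> = ennreal (exp (F (\<eta> 0 \<omega>) + L))"
        unfolding l_def by (simp add: lim_imp_Liminf)
      then have "ennreal (exp (- y)) * l \<omega> = ennreal (exp (- y) * exp (F (\<eta> 0 \<omega>) + L))"
        by (simp only: ennreal_mult exp_ge_zero)
      also have "\<dots> = ennreal (exp (- y + (F (\<eta> 0 \<omega>) + L)))"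
        by (simp only: exp_add)
      also have "\<dots> \<ge> ennreal 1" using L(2) by (intro ennreal_leI) simp
      finally show "\<omega> \<in> S" using \<omega> by (simp add: S_def)
    qed
  qed
qed

end

section \<open>The initial distribution\<close>

lemma nn_integral_exp_poisson0:
  assumes "r \<ge> 0"
  shows "(\<integral>\<^sup>+k. ennreal (exp (real k * \<theta>)) \<partial>measure_pmf (poisson0_pmf r)) = ennreal (exp (r * (exp \<theta> - 1)))"
proof (cases "r > 0")
  case True
  have sums: "(\<lambda>k. r ^ k / fact k * exp (-r) * exp (real k * \<theta>)) sums (exp (r * exp \<theta>) * exp (-r))"
  proof -
    have "(\<lambda>k. (r * exp \<theta>) ^ k /\<^sub>R fact k * exp (-r)) sums (exp (r * exp \<theta>) * exp (-r))"
      by (intro sums_mult2 exp_converges)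
    then show ?thesis by (simp add: power_mult_distrib exp_of_nat2_mult exp_of_nat_mult divide_inverse mult_ac)
  qed
  have "(\<integral>\<^sup>+k. ennreal (exp (real k * \<theta>)) \<partial>measure_pmf (poisson0_pmf r))
      = (\<Sum>k. ennreal (r ^ k / fact k * exp (-r) * exp (real k * \<theta>)))"
    using True by (simp add: poisson0_pmf_def nn_integral_measure_pmf nn_integral_count_space_nat
        ennreal_mult[symmetric] mult.assoc)
  also have "\<dots> = ennreal (exp (r * exp \<theta>) * exp (-r))"
    using sums True by (intro suminf_ennreal_eq) auto
  finally show ?thesis by (simp add: algebra_simps exp_diff exp_minus divide_inverse)
qed (use assms in \<open>simp add: poisson0_pmf_def\<close>)

text \<open>The energy is a sum over independent sites, so the expectation factorises into Poisson
  exponential moments.\<close>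

lemma nn_integral_exp_energy_initial_law:
  assumes "\<And>v. v \<in> V \<Longrightarrow> \<rho> v \<ge> 0"
  shows "(\<integral>\<^sup>+\<xi>. ennreal (exp (energy N \<phi> \<xi>)) \<partial>measure_pmf (initial_law \<rho> N))
    = ennreal (exp (\<Sum>(x, \<sigma>)\<in>sites N. \<rho> (x / real N, \<sigma>) * (exp (\<phi> (x / real N, \<sigma>)) - 1)))"
proof -
  let ?p = "\<lambda>v. (real_of_int (fst v) / real N, snd v)"
  have "(\<integral>\<^sup>+\<xi>. ennreal (exp (energy N \<phi> \<xi>)) \<partial>measure_pmf (initial_law \<rho> N))
      = (\<integral>\<^sup>+\<xi>. (\<Prod>v\<in>sites N. ennreal (exp (real (\<xi> v) * \<phi> (?p v)))) \<partial>measure_pmf (initial_law \<rho> N))"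
    unfolding energy_def case_prod_unfold
    by (intro nn_integral_cong) (simp add: exp_sum[OF finite_sites] prod_ennreal)
  also have "\<dots> = (\<Prod>v\<in>sites N. \<integral>\<^sup>+k. ennreal (exp (real k * \<phi> (?p v))) \<partial>measure_pmf (poisson0_pmf (\<rho> (?p v))))"
    unfolding initial_law_def case_prod_unfold
    by (rule nn_integral_prod_Pi_pmf[OF finite_sites, where f = "\<lambda>v k. ennreal (exp (real k * \<phi> (?p v)))"])
  also have "\<dots> = (\<Prod>v\<in>sites N. ennreal (exp (\<rho> (?p v) * (exp (\<phi> (?p v)) - 1))))"
    using assms sites_V by (intro prod.cong refl nn_integral_exp_poisson0) (metis prod.collapse)
  also have "\<dots> = ennreal (exp (\<Sum>v\<in>sites N. \<rho> (?p v) * (exp (\<phi> (?p v)) - 1)))"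
    by (simp add: prod_ennreal exp_sum[OF finite_sites])
  finally show ?thesis by (simp add: case_prod_unfold)
qed

text \<open>Rounding up makes the right-endpoint sum the exact integral of a step function. Since
  \<open>f 1 = f 0\<close>, a telescoping sum shifts it to the left endpoints, which are the
  rescaled sites.\<close>

lemma periodic_riemann_sum:
  fixes f :: "real \<Rightarrow> real"
  assumes f: "continuous_on {0..1} f" and per: "f 1 = f 0"
  shows "(\<lambda>N. (\<Sum>x\<in>{0..<int (Suc N)}. f (real_of_int x / real (Suc N))) / real (Suc N)) \<longlonglongrightarrow> (LBINT x:{0..1}. f x)"
proof -
  have si: "set_integrable lborel {0..1} f" by (rule borel_integrable_atLeastAtMost'[OF f])
  obtain C where C: "\<And>x. x \<in> {0..1} \<Longrightarrow> \<bar>f x\<bar> \<le> C"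
    using compact_imp_bounded[OF compact_continuous_image[OF f compact_Icc]] unfolding bounded_real by blast
  have hi: "((\<lambda>s. f (grid_up 1 (Suc N) s)) has_integral (\<Sum>j<Suc N. f (real (Suc j) / real (Suc N)) / real (Suc N))) {0..1}" for N
  proof (rule has_integral_grid[where P = "\<lambda>t s. f t" and T = 1])
    fix j
    let ?a = "real j * 1 / real (Suc N)" and ?b = "real (Suc j) * 1 / real (Suc N)"
    have "?b - ?a = 1 / real (Suc N)" unfolding diff_divide_distrib[symmetric] by simp
    then show "((\<lambda>s. f ?b) has_integral f (real (Suc j) / real (Suc N)) / real (Suc N)) {?a..?b}"
      using has_integral_const_real[of "f ?b" ?a ?b] by (simp add: divide_right_mono)
  qed auto
  have gm: "grid_up 1 (Suc N) s \<in> {0..1}" if "s \<in> {0..1}" for N s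
    using grid_up_mem[of 1 "Suc N" s] that by auto
  have "(\<lambda>N. integral {0..1} (\<lambda>s. f (grid_up 1 (Suc N) s))) \<longlonglongrightarrow> integral {0..1} f"
  proof (rule dominated_convergence(2)[where h = "\<lambda>_. C"])
    show "(\<lambda>s. f (grid_up 1 (Suc k) s)) integrable_on {0..1}" for k using hi by (rule has_integral_integrable)
    show "(\<lambda>_. C) integrable_on {0..1::real}" by (rule integrable_const_ivl)
    show "norm (f (grid_up 1 (Suc k) x)) \<le> C" if "x \<in> {0..1}" for k x
      using C[OF gm[OF that]] by simp
    show "(\<lambda>k. f (grid_up 1 (Suc k) x)) \<longlonglongrightarrow> f x" if "x \<in> {0..1}" for x
      using f grid_up_tendsto[of 1 x] that gm[OF that]
      by (intro continuous_on_tendsto_compose[OF f]) auto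
  qed
  moreover have "integral {0..1} (\<lambda>s. f (grid_up 1 (Suc N) s))
      = (\<Sum>x\<in>{0..<int (Suc N)}. f (real_of_int x / real (Suc N))) / real (Suc N)" for N
  proof -
    have "(\<Sum>j<Suc N. f (real (Suc j) / real (Suc N)) - f (real j / real (Suc N))) = f (real (Suc N) / real (Suc N)) - f (real 0 / real (Suc N))"
      by (rule sum_lessThan_telescope)
    then have "(\<Sum>j<Suc N. f (real (Suc j) / real (Suc N))) = (\<Sum>j<Suc N. f (real j / real (Suc N)))"
      using per by (simp only: sum_subtractf) (simp del: of_nat_Suc)
    also have "\<dots> = (\<Sum>x\<in>{0..<int (Suc N)}. f (real_of_int x / real (Suc N)))"
      by (rule sum.reindex_bij_witness[of _ nat int]) auto
    finally show ?thesis using integral_unique[OF hi[of N]] unfolding sum_divide_distrib[symmetric] by simp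
  qed
  ultimately show ?thesis using set_borel_integral_eq_integral(2)[OF si] by simp
qed

lemma log_initial_moment_tendsto:
  assumes "\<rho> \<in> continuous_V" "\<phi> \<in> continuous_V"
  shows "(\<lambda>N. (\<Sum>(x, \<sigma>)\<in>sites (Suc N). \<rho> (real_of_int x / real (Suc N), \<sigma>) *
      (exp (\<phi> (real_of_int x / real (Suc N), \<sigma>)) - 1)) / real (Suc N)) \<longlonglongrightarrow> L2_V \<rho> (\<lambda>v. exp (\<phi> v) - 1)"
proof -
  let ?f = "\<lambda>\<sigma> x. \<rho> (x, \<sigma>) * (exp (\<phi> (x, \<sigma>)) - 1)"
  have "(\<lambda>N. (\<Sum>x\<in>{0..<int (Suc N)}. ?f \<sigma> (real_of_int x / real (Suc N))) / real (Suc N)) \<longlonglongrightarrow> (LBINT x:{0..1}. ?f \<sigma> x)"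
    if \<sigma>: "\<sigma> \<in> spins" for \<sigma>
  proof (rule periodic_riemann_sum)
    have "continuous_on UNIV (?f \<sigma>)"
      using assms \<sigma> by (auto simp: continuous_V_def intro!: continuous_intros)
    then show "continuous_on {0..1} (?f \<sigma>)" by (rule continuous_on_subset) simp
    have "\<rho> (0 + 1, \<sigma>) = \<rho> (0, \<sigma>)" "\<phi> (0 + 1, \<sigma>) = \<phi> (0, \<sigma>)"
      using assms \<sigma> unfolding continuous_V_def by blast+
    then show "?f \<sigma> 1 = ?f \<sigma> 0" by simp
  qed
  then have "(\<lambda>N. \<Sum>\<sigma>\<in>spins. (\<Sum>x\<in>{0..<int (Suc N)}. ?f \<sigma> (real_of_int x / real (Suc N))) / real (Suc N))
      \<longlonglongrightarrow> L2_V \<rho> (\<lambda>v. exp (\<phi> v) - 1)"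
    unfolding L2_V_def by (rule tendsto_sum)
  moreover have "(\<Sum>\<sigma>\<in>spins. (\<Sum>x\<in>{0..<int (Suc N)}. ?f \<sigma> (real_of_int x / real (Suc N))) / real (Suc N))
      = (\<Sum>(x, \<sigma>)\<in>sites (Suc N). ?f \<sigma> (real_of_int x / real (Suc N))) / real (Suc N)" for N
    unfolding sites_def sum.cartesian_product[symmetric] sum_divide_distrib[symmetric]
    by (subst sum.swap) simp
  ultimately show ?thesis by simp
qed

lemma smooth_V_continuous_V: "\<phi> \<in> smooth_V \<Longrightarrow> \<phi> \<in> continuous_V"
proof -
  assume \<phi>: "\<phi> \<in> smooth_V"
  have "isCont (\<lambda>x. \<phi> (x, \<sigma>)) x" if "\<sigma> \<in> spins" for \<sigma> x
  proof -
    have "((deriv ^^ 0) (\<lambda>y. \<phi> (y, \<sigma>))) differentiable (at x)"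
      using \<phi> that unfolding smooth_V_def by blast
    then show ?thesis using differentiable_imp_continuous_within by simp
  qed
  then show ?thesis using \<phi> by (auto simp: smooth_V_def continuous_V_def continuous_at_imp_continuous_on)
qed

text \<open>Zero is a competitor in the supremum: it makes the index set nonempty when a constant is
  moved inside.\<close>

lemma zero_smooth_V: "(\<lambda>_. 0) \<in> smooth_V"
proof -
  have "(deriv ^^ k) (\<lambda>_ :: real. 0 :: real) = (\<lambda>_. 0)" for k
    by (induction k) auto
  then show ?thesis by (simp add: smooth_V_def)
qed

lemma zero_smooth_TV: "(\<lambda>_ _. 0) \<in> smooth_TV T"
  unfolding smooth_TV_def by (auto intro!: exI[of _ "\<lambda>_ _ _ _. 0"])

text \<open>Exponential smallness of the outer measure: the events themselves are only covered by
  measurable sets.\<close>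

definition exp_small :: "(nat \<Rightarrow> 'w measure) \<Rightarrow> (nat \<Rightarrow> 'w set) \<Rightarrow> real \<Rightarrow> bool" where
  "exp_small M A r \<longleftrightarrow> (\<forall>\<^sub>F N in sequentially. \<exists>S\<in>sets (M N). A N \<subseteq> S \<and>
     emeasure (M N) S \<le> ennreal (exp (- (real N * r))))"

context flip_rates
begin

text \<open>The rate is a sum of two suprema, and each is resolved after moving the other summand
  inside. In \<open>ereal\<close> this is legitimate because the transport part is not
  \<open>-\<infinity>\<close>, as the choice \<open>G = 0\<close> shows.\<close>

lemma rate_function_witness:
  assumes \<alpha>: "\<alpha> \<in> skorokhod_space T" and T: "T > 0" and r: "ereal r < rate_function c \<rho> T \<alpha>"
  obtains \<phi> G where "\<phi> \<in> smooth_V" "G \<in> smooth_TV T"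
    "r < path_functional T (\<lambda>v. \<phi> v - G 0 v) (G T) (transport T G) (flip_weight G) \<alpha> - L2_V \<rho> (\<lambda>v. exp (\<phi> v) - 1)"
proof -
  define a where "a \<phi> = pairing (\<alpha> 0) \<phi> - L2_V \<rho> (\<lambda>v. exp (\<phi> v) - 1)" for \<phi>
  define I where "I G = ell T \<alpha> G - (LBINT t:{0..T}. flip_pairing (\<alpha> t) (flip_weight G t))" for G
  have h0: "rate_initial \<rho> (\<alpha> 0) = (SUP \<phi>\<in>smooth_V. ereal (a \<phi>))"
    by (simp add: rate_initial_def a_def)
  have tr: "rate_transport c T \<alpha> = (SUP G\<in>smooth_TV T. ereal (I G))"
    by (simp add: rate_transport_def I_def flip_pairing_def flip_weight_def)
  have "ereal (I (\<lambda>_ _. 0)) \<le> rate_transport c T \<alpha>"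
    unfolding tr by (rule SUP_upper[OF zero_smooth_TV])
  then have "rate_transport c T \<alpha> \<noteq> -\<infinity>" by auto
  then have "rate_function c \<rho> T \<alpha> = (SUP \<phi>\<in>smooth_V. ereal (a \<phi>) + rate_transport c T \<alpha>)"
    unfolding rate_function_def h0 using zero_smooth_V by (intro SUP_ereal_add_left[symmetric]) auto
  with r obtain \<phi> where \<phi>: "\<phi> \<in> smooth_V" "ereal r < ereal (a \<phi>) + rate_transport c T \<alpha>"
    by (auto simp: less_SUP_iff)
  have "ereal (a \<phi>) + rate_transport c T \<alpha> = (SUP G\<in>smooth_TV T. ereal (a \<phi>) + ereal (I G))"
    unfolding tr using zero_smooth_TV by (intro SUP_ereal_add_right[symmetric]) auto
  with \<phi>(2) obtain G where G: "G \<in> smooth_TV T" "ereal r < ereal (a \<phi>) + ereal (I G)"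
    by (auto simp: less_SUP_iff)
  have "0 \<in> {0..T}" using T by simp
  then have "pairing (\<alpha> 0) (\<lambda>v. \<phi> v - G 0 v) = pairing (\<alpha> 0) \<phi> - pairing (\<alpha> 0) (G 0)"
    using skorokhod_space_measures[OF \<alpha>] smooth_V_continuous_V[OF \<phi>(1)]
      continuous_TV_slice[OF smooth_TV_continuous[OF G(1)]] by (intro pairing_diff)
  then have "r < path_functional T (\<lambda>v. \<phi> v - G 0 v) (G T) (transport T G) (flip_weight G) \<alpha> - L2_V \<rho> (\<lambda>v. exp (\<phi> v) - 1)"
    using G(2) by (simp add: a_def I_def ell_def path_functional_def)
  with \<phi>(1) G(1) show thesis by (rule that)
qed

text \<open>On \<open>U\<close> the functional exceeds \<open>r' + l\<close>, where \<open>l\<close>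
  is the limit of the normalised logarithmic initial moments \<open>h N / N\<close>. The gap between
  \<open>r\<close> and \<open>r'\<close> absorbs, for large \<open>N\<close>, both the error in this
  limit and the loss \<open>C * B / N\<close>.\<close>

lemma local_upper_bound:
  fixes M :: "nat \<Rightarrow> 'w measure"
  assumes T: "T > 0" and \<rho>: "\<rho> \<in> smooth_V" "\<And>v. v \<in> V \<Longrightarrow> \<rho> v \<ge> 0"
    and pp: "\<And>N. N \<ge> 1 \<Longrightarrow> particle_process c T N (M N) (\<eta> N)"
    and init: "\<And>N. N \<ge> 1 \<Longrightarrow> distr (M N) (count_space UNIV) (\<eta> N 0) = measure_pmf (initial_law \<rho> N)"
    and \<alpha>: "\<alpha> \<in> skorokhod_space T" and r: "ereal r < rate_function c \<rho> T \<alpha>"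
  obtains U where "openin (skorokhod_topology T) U" "\<alpha> \<in> U"
    "exp_small M (\<lambda>N. {\<omega> \<in> space (M N). empirical_path T N (\<eta> N) \<omega> \<in> U}) r"
proof -
  obtain \<phi> G where \<phi>: "\<phi> \<in> smooth_V" and G: "G \<in> smooth_TV T"
    and r0: "r < path_functional T (\<lambda>v. \<phi> v - G 0 v) (G T) (transport T G) (flip_weight G) \<alpha> - L2_V \<rho> (\<lambda>v. exp (\<phi> v) - 1)"
    by (rule rate_function_witness[OF \<alpha> T r]) (rule that)
  define l where "l = L2_V \<rho> (\<lambda>v. exp (\<phi> v) - 1)"
  let ?J = "path_functional T (\<lambda>v. \<phi> v - G 0 v) (G T) (transport T G) (flip_weight G)"
  obtain r' where r': "r < r'" "r' < ?J \<alpha> - l" using dense[OF r0] by (auto simp: l_def)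
  have \<phi>c: "\<phi> \<in> continuous_V" by (rule smooth_V_continuous_V[OF \<phi>])
  have Gc: "G \<in> continuous_TV T" by (rule smooth_TV_continuous[OF G])
  have T0: "0 \<in> {0..T}" "T \<in> {0..T}" using T by auto
  have \<phi>0: "(\<lambda>v. \<phi> v - G 0 v) \<in> continuous_V"
    using \<phi>c continuous_TV_slice[OF Gc T0(1)] by (auto simp: continuous_V_def intro!: continuous_intros)
  have "r' + l < ?J \<alpha>" using r'(2) by simp
  then obtain U B where U: "openin (skorokhod_topology T) U" "\<alpha> \<in> U" "U \<subseteq> skorokhod_space T"
    "\<And>\<beta>. \<beta> \<in> U \<Longrightarrow> r' + l < ?J \<beta>"
    "\<And>\<beta> t. \<beta> \<in> U \<Longrightarrow> t \<in> {0..T} \<Longrightarrow> mass (\<beta> t) \<le> B"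
    by (rule path_functional_lower_semicontinuous[OF \<alpha> T \<phi>0 continuous_TV_slice[OF Gc T0(2)]
          transport_continuous[OF G T] flip_weight_continuous[OF Gc]]) (rule that)
  obtain C N\<^sub>0 where ge: "\<forall>N m \<zeta> B.
    N\<^sub>0 \<le> N \<and> 1 \<le> N \<and> (\<forall>t\<in>{0..T}. \<zeta> t \<in> configs_le N m) \<and> (\<forall>t\<in>{0..<T}. \<forall>\<^sub>F s in at_right t. \<zeta> s = \<zeta> t) \<and>
     (\<lambda>t\<in>{0..T}. empirical_measure N (\<zeta> t)) \<in> skorokhod_space T \<and>
     (\<forall>t\<in>{0..T}. mass (empirical_measure N (\<zeta> t)) \<le> B) \<longrightarrow>
    (\<exists>L. (\<lambda>n. log_mart c N T G (Suc n) \<zeta>) \<longlonglongrightarrow> L \<and>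
      real N * ?J (\<lambda>t\<in>{0..T}. empirical_measure N (\<zeta> t)) - C * B \<le> energy N \<phi> (\<zeta> 0) + L)"
    using log_mart_limit_ge[OF T G \<phi>c] by blast
  define h where "h N = (\<Sum>(x, \<sigma>)\<in>sites N. \<rho> (real_of_int x / real N, \<sigma>) * (exp (\<phi> (real_of_int x / real N, \<sigma>)) - 1))" for N
  have "(\<lambda>N. h (Suc N) / real (Suc N)) \<longlonglongrightarrow> l"
    unfolding h_def l_def by (rule log_initial_moment_tendsto[OF smooth_V_continuous_V[OF \<rho>(1)] \<phi>c])
  then have "(\<lambda>N. h N / real N) \<longlonglongrightarrow> l" by (rule LIMSEQ_imp_Suc)
  moreover have "(\<lambda>N. C * B / real N) \<longlonglongrightarrow> 0" by (rule lim_const_over_n)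
  ultimately have "(\<lambda>N. h N / real N + C * B / real N) \<longlonglongrightarrow> l + 0" by (rule tendsto_add)
  then have ev: "\<forall>\<^sub>F N in sequentially. h N / real N + C * B / real N < l + (r' - r)"
    by (rule order_tendstoD) (use r' in simp)
  have "exp_small M (\<lambda>N. {\<omega> \<in> space (M N). empirical_path T N (\<eta> N) \<omega> \<in> U}) r"
    unfolding exp_small_def using ev eventually_ge_at_top[of N\<^sub>0] eventually_ge_at_top[of 1]
  proof eventually_elim
    case (elim N)
    have N: "N \<ge> 1" using elim(3) .
    \<comment> \<open>A path in \<open>U\<close> has mass at most \<open>B\<close> at all times,
      that is at most \<open>N * B\<close> particles.\<close>
    define m where "m = nat \<lfloor>real N * B\<rfloor>"
    define y where "y = real N * (r' + l) - C * B"
    obtain S where S: "S \<in> sets (M N)"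
      "{\<omega> \<in> space (M N). (\<forall>t\<in>{0..T}. \<eta> N t \<omega> \<in> configs_le N m) \<and>
      (\<exists>L. (\<lambda>n. log_mart c N T G (Suc n) (\<lambda>t. \<eta> N t \<omega>)) \<longlonglongrightarrow> L \<and> y \<le> energy N \<phi> (\<eta> N 0 \<omega>) + L)} \<subseteq> S"
      "emeasure (M N) S \<le> ennreal (exp (- y)) * (\<integral>\<^sup>+\<omega>. ennreal (exp (energy N \<phi> (\<eta> N 0 \<omega>))) \<partial>M N)"
      by (rule exponential_tail[OF pp[OF N] T Gc, of m y "energy N \<phi>"]) (rule that)
    have "\<omega> \<in> S" if \<omega>: "\<omega> \<in> space (M N)" and \<omega>U: "empirical_path T N (\<eta> N) \<omega> \<in> U" for \<omega>
    proof -
      have path: "empirical_path T N (\<eta> N) \<omega> = (\<lambda>t\<in>{0..T}. empirical_measure N (\<eta> N t \<omega>))"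
        by (simp add: empirical_path_def)
      have conf: "\<eta> N t \<omega> \<in> configs N" if "t \<in> {0..T}" for t
        using pp[OF N] \<omega> that unfolding particle_process_def by blast
      have rc: "\<forall>\<^sub>F s in at_right t. \<eta> N s \<omega> = \<eta> N t \<omega>" if "t \<in> {0..<T}" for t
        using pp[OF N] \<omega> that unfolding particle_process_def by blast
      have mass: "mass (empirical_measure N (\<eta> N t \<omega>)) \<le> B" if "t \<in> {0..T}" for t
        using U(5)[OF \<omega>U that] that by (simp add: path)
      have le: "\<eta> N t \<omega> \<in> configs_le N m" if "t \<in> {0..T}" for t
      proof -
        have "real (\<Sum>v\<in>sites N. \<eta> N t \<omega> v) = real N * mass (empirical_measure N (\<eta> N t \<omega>))"
          unfolding pairing_empirical_energy[OF N const_continuous_V] by (simp add: energy_def case_prod_unfold)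
        also have "\<dots> \<le> real N * B" by (intro mult_left_mono mass that) simp
        finally have "(\<Sum>v\<in>sites N. \<eta> N t \<omega> v) \<le> m"
          unfolding m_def by (simp add: le_nat_floor)
        then show ?thesis using conf[OF that] by (simp add: configs_le_def)
      qed
      have "(\<lambda>t\<in>{0..T}. empirical_measure N (\<eta> N t \<omega>)) \<in> skorokhod_space T"
        using U(3) \<omega>U unfolding path by blast
      then obtain L where L: "(\<lambda>n. log_mart c N T G (Suc n) (\<lambda>t. \<eta> N t \<omega>)) \<longlonglongrightarrow> L"
        "real N * ?J (empirical_path T N (\<eta> N) \<omega>) - C * B \<le> energy N \<phi> (\<eta> N 0 \<omega>) + L"
        using ge[rule_format, of N "\<lambda>t. \<eta> N t \<omega>" m B] elim(2) N le rc mass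
        unfolding path by blast
      have "real N * (r' + l) \<le> real N * ?J (empirical_path T N (\<eta> N) \<omega>)"
        using U(4)[OF \<omega>U] by (intro mult_left_mono) auto
      then have "y \<le> energy N \<phi> (\<eta> N 0 \<omega>) + L" using L(2) by (simp add: y_def)
      then show ?thesis using S(2) \<omega> le L(1) by blast
    qed
    moreover have "emeasure (M N) S \<le> ennreal (exp (- (real N * r)))"
    proof -
      have m0: "\<eta> N 0 \<in> M N \<rightarrow>\<^sub>M count_space UNIV"
        using pp[OF N] T0(1) unfolding particle_process_def by blast
      have "(\<integral>\<^sup>+\<omega>. ennreal (exp (energy N \<phi> (\<eta> N 0 \<omega>))) \<partial>M N)
          = (\<integral>\<^sup>+\<xi>. ennreal (exp (energy N \<phi> \<xi>)) \<partial>distr (M N) (count_space UNIV) (\<eta> N 0))"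
        by (rule nn_integral_distr[OF m0, symmetric]) simp
      also have "\<dots> = ennreal (exp (h N))"
        unfolding init[OF N] h_def by (rule nn_integral_exp_energy_initial_law) (rule \<rho>(2))
      finally have "emeasure (M N) S \<le> ennreal (exp (- y) * exp (h N))"
        using S(3) by (simp only: ennreal_mult exp_ge_zero)
      also have "\<dots> = ennreal (exp (h N - y))" by (simp add: exp_diff exp_minus divide_inverse)
      also have "\<dots> \<le> ennreal (exp (- (real N * r)))"
      proof (intro ennreal_leI, simp)
        have "(h N + C * B) / real N < l + (r' - r)" using elim(1) by (simp add: add_divide_distrib)
        then have "h N + C * B < (l + (r' - r)) * real N" using N by (simp add: pos_divide_less_eq)
        then show "h N - y \<le> - (real N * r)" by (simp add: y_def algebra_simps)
      qed
      finally show ?thesis .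
    qed
    ultimately show ?case using S(1) by blast
  qed
  with U(1,2) show thesis by (rule that)
qed

end

section \<open>The upper bound\<close>

text \<open>The prefactor disappears because \<open>ln k / N\<close> tends to 0; where
  \<open>p N\<close> is not positive the term is \<open>-\<infinity>\<close>.\<close>

lemma limsup_log_prob_le:
  fixes p :: "nat \<Rightarrow> real"
  assumes "\<forall>\<^sub>F N in sequentially. p N \<le> k * exp (- (real N * r))" "k > 0"
  shows "limsup (\<lambda>N. ereal (1 / real N) * log_prob (p N)) \<le> ereal (- r)"
proof -
  have "\<forall>\<^sub>F N in sequentially. ereal (1 / real N) * log_prob (p N) \<le> ereal (ln k / real N - r)"
    using assms(1) eventually_ge_at_top[of 1]
  proof eventually_elim
    case (elim N)
    show ?case
    proof (cases "p N > 0")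
      case True
      have "ln (p N) \<le> ln (k * exp (- (real N * r)))" using elim(1) True assms(2) by simp
      also have "\<dots> = ln k - real N * r" using assms(2) by (simp add: ln_mult)
      finally have "1 / real N * ln (p N) \<le> 1 / real N * (ln k - real N * r)"
        by (intro mult_left_mono) auto
      also have "\<dots> = ln k / real N - r" using elim(2) by (simp add: diff_divide_distrib)
      finally show ?thesis using True by (simp add: log_prob_def)
    qed (use elim(2) in \<open>simp add: log_prob_def\<close>)
  qed
  then have "limsup (\<lambda>N. ereal (1 / real N) * log_prob (p N)) \<le> limsup (\<lambda>N. ereal (ln k / real N - r))"
    by (rule Limsup_mono)
  also have "(\<lambda>N. ln k / real N - r) \<longlonglongrightarrow> 0 - r" by (intro tendsto_intros lim_const_over_n)
  then have "limsup (\<lambda>N. ereal (ln k / real N - r)) = ereal (- r)"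
    by (intro lim_imp_Limsup) auto
  finally show ?thesis .
qed

theorem theorem3p4:
  fixes T :: real
    and c :: "int \<Rightarrow> real \<Rightarrow> real"
    and \<rho> :: "real \<times> int \<Rightarrow> real"
    and M :: "nat \<Rightarrow> 'w measure"
    and \<eta> :: "nat \<Rightarrow> real \<Rightarrow> 'w \<Rightarrow> config"
    and \<K> :: "(real \<Rightarrow> (real \<times> int) measure) set"
  assumes "T > 0"
    and "\<exists>a>0. \<exists>b. \<forall>\<sigma>\<in>spins. \<forall>m\<in>{-1..1}. a \<le> c \<sigma> m \<and> c \<sigma> m \<le> b"
    and "\<exists>L>0. \<forall>\<sigma>\<in>spins. \<forall>m\<^sub>1\<in>{-1..1}. \<forall>m\<^sub>2\<in>{-1..1}. \<bar>c \<sigma> m\<^sub>1 - c \<sigma> m\<^sub>2\<bar> \<le> L * \<bar>m\<^sub>1 - m\<^sub>2\<bar>"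
    and "\<rho> \<in> smooth_V"
    and "\<forall>v\<in>V. \<rho> v \<ge> 0"
    and "\<And>N. N \<ge> 1 \<Longrightarrow> particle_process c T N (M N) (\<eta> N)"
    and "\<And>N. N \<ge> 1 \<Longrightarrow> distr (M N) (count_space UNIV) (\<eta> N 0) = measure_pmf (initial_law \<rho> N)"
    and "compactin (skorokhod_topology T) \<K>"
  shows "limsup (\<lambda>N. ereal (1 / real N) *
           log_prob (measure (M N) {\<omega> \<in> space (M N). empirical_path T N (\<eta> N) \<omega> \<in> \<K>}))
         \<le> - (INF \<alpha>\<in>\<K>. rate_function c \<rho> T \<alpha>)"
proof -
  obtain a b where ab: "a > 0" "\<And>\<sigma> m. \<sigma> \<in> spins \<Longrightarrow> m \<in> {-1..1} \<Longrightarrow> a \<le> c \<sigma> m \<and> c \<sigma> m \<le> b"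
    using assms(2) by blast
  obtain L where L: "L > 0" "\<And>\<sigma> m\<^sub>1 m\<^sub>2. \<sigma> \<in> spins \<Longrightarrow> m\<^sub>1 \<in> {-1..1} \<Longrightarrow> m\<^sub>2 \<in> {-1..1} \<Longrightarrow>
      \<bar>c \<sigma> m\<^sub>1 - c \<sigma> m\<^sub>2\<bar> \<le> L * \<bar>m\<^sub>1 - m\<^sub>2\<bar>"
    using assms(3) by blast
  interpret flip_rates c b
  proof
    fix \<sigma> m assume \<sigma>: "\<sigma> \<in> spins"
    show "c \<sigma> m \<ge> 0" "c \<sigma> m \<le> b" if "m \<in> {-1..1}" using ab(1) ab(2)[OF \<sigma> that] by auto
    have "L-lipschitz_on {-1..1} (c \<sigma>)"
      using L(1) L(2)[OF \<sigma>] by (intro lipschitz_onI) (auto simp: dist_real_def)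
    then show "continuous_on {-1..1} (c \<sigma>)" by (rule lipschitz_on_continuous_on)
  qed
  have K: "\<K> \<subseteq> skorokhod_space T"
    using compactin_subset_topspace[OF assms(8)] openin_topspace[of "skorokhod_topology T"]
    unfolding openin_skorokhod_topology skorokhod_open_def by blast
  let ?E = "\<lambda>U N. {\<omega> \<in> space (M N). empirical_path T N (\<eta> N) \<omega> \<in> U}"
  define p where "p N = measure (M N) (?E \<K> N)" for N
  \<comment> \<open>Real levels strictly below the infimum suffice; this also covers an infinite
    infimum, for instance over an empty \<open>\<K>\<close>.\<close>
  have "limsup (\<lambda>N. ereal (1 / real N) * log_prob (p N)) \<le> ereal (- r)"
    if r: "ereal r < (INF \<alpha>\<in>\<K>. rate_function c \<rho> T \<alpha>)" for r
  proof -
    define good where "good U \<longleftrightarrow> openin (skorokhod_topology T) U \<and>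
      exp_small M (?E U) r" for U
    have "\<exists>U. good U \<and> \<alpha> \<in> U" if \<alpha>: "\<alpha> \<in> \<K>" for \<alpha>
    proof -
      have *: "ereal r < rate_function c \<rho> T \<alpha>" using r INF_lower[OF \<alpha>] less_le_trans by blast
      show ?thesis
      proof (rule local_upper_bound[OF assms(1,4) _ _ _ subsetD[OF K \<alpha>] *])
        show "\<rho> v \<ge> 0" if "v \<in> V" for v using assms(5) that by blast
        show "particle_process c T N (M N) (\<eta> N)" if "1 \<le> N" for N using that by (rule assms(6))
        show "distr (M N) (count_space UNIV) (\<eta> N 0) = measure_pmf (initial_law \<rho> N)" if "1 \<le> N" for N
          using that by (rule assms(7))
        fix U assume "openin (skorokhod_topology T) U" "\<alpha> \<in> U"
          "exp_small M (?E U) r"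
        then show "\<exists>U. good U \<and> \<alpha> \<in> U" unfolding good_def by blast
      qed
    qed
    then have "\<K> \<subseteq> \<Union>{U. good U}" by blast
    moreover have "\<And>U. U \<in> {U. good U} \<Longrightarrow> openin (skorokhod_topology T) U" by (simp add: good_def)
    ultimately obtain \<F> where \<F>: "finite \<F>" "\<F> \<subseteq> {U. good U}" "\<K> \<subseteq> \<Union>\<F>"
      using assms(8) unfolding compactin_def by metis
    have "\<forall>\<^sub>F N in sequentially. \<forall>U\<in>\<F>. \<exists>S\<in>sets (M N). ?E U N \<subseteq> S \<and>
      emeasure (M N) S \<le> ennreal (exp (- (real N * r)))"
      using \<F>(1,2) by (intro eventually_ball_finite) (auto simp: good_def exp_small_def)
    \<comment> \<open>The added 1 keeps the prefactor positive even when the finite cover is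
      empty.\<close>
    then have "\<forall>\<^sub>F N in sequentially. p N \<le> (real (card \<F>) + 1) * exp (- (real N * r))"
      using eventually_ge_at_top[of 1]
    proof eventually_elim
      case (elim N)
      interpret prob_space "M N" using assms(6)[OF elim(2)] by (simp add: particle_process_def)
      have "\<forall>U\<in>\<F>. \<exists>S. S \<in> sets (M N) \<and> ?E U N \<subseteq> S \<and>
          emeasure (M N) S \<le> ennreal (exp (- (real N * r)))"
        using elim(1) by blast
      from bchoice[OF this] obtain S where S: "\<And>U. U \<in> \<F> \<Longrightarrow> S U \<in> sets (M N)"
        "\<And>U. U \<in> \<F> \<Longrightarrow> ?E U N \<subseteq> S U"
        "\<And>U. U \<in> \<F> \<Longrightarrow> emeasure (M N) (S U) \<le> ennreal (exp (- (real N * r)))"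
        by blast
      have S': "prob (S U) \<le> exp (- (real N * r))" if "U \<in> \<F>" for U
        using S(3)[OF that] by (simp add: emeasure_eq_measure)
      have "p N \<le> prob (\<Union>U\<in>\<F>. S U)"
      proof (cases "?E \<K> N \<in> sets (M N)")
        case True
        show ?thesis
          unfolding p_def
        proof (rule finite_measure_mono)
          show "?E \<K> N \<subseteq> (\<Union>U\<in>\<F>. S U)"
            using \<F>(3) S(2) by blast
          show "(\<Union>U\<in>\<F>. S U) \<in> sets (M N)" using \<F>(1) S(1) by (intro sets.finite_UN) auto
        qed
      next
        \<comment> \<open>\<open>measure\<close> is 0 on sets that are not measurable, so the
          estimate is trivial here.\<close>
        case False
        then show ?thesis by (simp add: p_def measure_notin_sets)
      qed
      also have "\<dots> \<le> (\<Sum>U\<in>\<F>. prob (S U))"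
        using \<F>(1) S(1) by (intro finite_measure_subadditive_finite) auto
      also have "\<dots> \<le> (\<Sum>U\<in>\<F>. exp (- (real N * r)))"
        by (intro sum_mono S')
      also have "\<dots> \<le> (real (card \<F>) + 1) * exp (- (real N * r))"
        by (simp add: algebra_simps)
      finally show ?case .
    qed
    then show ?thesis by (rule limsup_log_prob_le) (simp add: add_nonneg_pos)
  qed
  note le = this
  show ?thesis
    unfolding p_def[symmetric]
  proof (rule ccontr)
    let ?x = "limsup (\<lambda>N. ereal (1 / real N) * log_prob (p N))"
    assume "\<not> ?x \<le> - (INF \<alpha>\<in>\<K>. rate_function c \<rho> T \<alpha>)"
    then have "- ?x < (INF \<alpha>\<in>\<K>. rate_function c \<rho> T \<alpha>)"
      by (simp add: ereal_uminus_less_reorder not_le)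
    then obtain r where r: "- ?x < ereal r" "ereal r < (INF \<alpha>\<in>\<K>. rate_function c \<rho> T \<alpha>)"
      using ereal_dense2 by blast
    have "- ereal (- r) \<le> - ?x" using le[OF r(2)] by (simp only: ereal_minus_le_minus)
    then show False using r(1) by simp
  qed
qed

end
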